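(* Let $n\ge2$ and $k\in\mathbb Z$, and consider the bases $Q_k',Q_k'',Q_{k-1}'$ of $\mathcal S_n$. Then $Q_k''=\delta_{n,\mathrm{odd}}\,Q_k'$, and $Q_{k-1}'$ is obtained from the basis $\delta_{n,\mathrm{even}}\,Q_k''$ by multiplying the first basis vector of $\delta_{n,\mathrm{even}}\,Q_k''$ by $(-1)^{n+1}s_n(\boldsymbol Z^{-1})$.
   Context: Let $\mathbb C[\boldsymbol Z^{\pm1}]=\mathbb C[Z_1^{\pm1},\dots,Z_n^{\pm1}]$, $f(\boldsymbol Z^{-1})=f(Z_1^{-1},\dots,Z_n^{-1})$, let $s_i(\boldsymbol Z)$ be the $i$-th elementary symmetric function. Solutions. Let $L''\subset\mathbb C^n$ be the set of $\boldsymbol z$ with $z_a-z_b\notin\mathbb Z$ for $a\ne b$. With $H=H_{T^n}(P^{n-1};\mathbb C)=\mathbb C[x,\boldsymbol y,\boldsymbol z]^{S_{n-1}}/\langle (u-x)\prod_{j=1}^{n-1}(u-y_j)-\prod_{a=1}^n(u-z_a)\rangle$ (relation identically in $u$; $S_{n-1}$ permutes $y_1,\dots,y_{n-1}$), put $$\Phi=(e^{\pi\sqrt{-1}(2-n)}p)^t\prod_{a=1}^n\Gamma(z_a-t),\quad W=\prod_{j=1}^{n-1}(y_j-t),\quad \Psi_J=-\sum_{r\ge0}\operatorname{Res}_{t=z_J+r}\Phi W,\quad \Psi^m=\sum_{J=1}^ne^{2\pi\sqrt{-1}(m-1)z_J}\Psi_J,$$ for $J=1,\dots,n$, $m\in\mathbb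 Z$; these are $H$-valued functions of $\boldsymbol z\in L''$ and of $p$ (with a fixed branch of $\arg p$). Put $\acute Z_j=e^{2\pi\sqrt{-1}z_j}$. $\mathcal S_n$ is the space of functions $\sum_{m=1}^nQ_m(\acute Z_1,\dots,\acute Z_n)\Psi^m$, $Q_m\in\mathbb C[\boldsymbol Z^{\pm1}]$, a $\mathbb C[\boldsymbol Z^{\pm1}]$-module on which $Q(\boldsymbol Z)$ acts as multiplication by $Q(\acute Z_1,\dots,\acute Z_n)$. It contains all $\Psi^m$, $m\in\mathbb Z$, and the map $\theta:K\to\mathcal S_n$, $X^{m-1}\mapsto\Psi^m$ ($m\in\mathbb Z$), is an isomorphism of $\mathbb C[\boldsymbol Z^{\pm1}]$-modules, where $K=K_{T^n}(P^{n-1},\mathbb C)=\mathbb C[X^{\pm1},\boldsymbol Z^{\pm1}]/\langle\prod_{a}(X-Z_a)\rangle$. On $K$ there is the sesquilinear form $$A(f,g)=\sum_{a=1}^n\frac{f(Z_a^{-1},\boldsymbol Z^{-1})\,g(Z_a,\boldsymbol Z)}{\prod_{j\ne a}(1-Z_j/Z_a)}\in\mathbb C[\boldsymbol Z^{\pm1}],$$ and $A$ on $\mathcal S_n$ denotes its image under $\theta$; it satisfies $A(c(\boldsymbol Z)v,d(\boldsymbol Z)w)=c(\boldsymbol Z^{-1})d(\boldsymbol Z)A(v,w)$. Braid group. An (ordered) basis $\{v_1,\dots,v_n\}$ of $\mathcal S_n$ is exceptional if $A(v_i,v_i)=1$ and $A(v_i,v_j)=0$ for $i>j$. The braid group $\mathcal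 B_n$ on $n$ strands with standard generators $\tau_1,\dots,\tau_{n-1}$ acts (from the left) on exceptional bases by $\tau_i\{v_1,\dots,v_n\}=\{v_1,\dots,v_{i-1},\,v_{i+1}-A(v_i,v_{i+1})v_i,\,v_i,\,v_{i+2},\dots,v_n\}$. Set $\delta_{n,\mathrm{odd}}=\tau_1\tau_3\cdots\tau_{n-2}$, $\delta_{n,\mathrm{even}}=\tau_2\tau_4\cdots\tau_{n-1}$ for $n$ odd; $\delta_{n,\mathrm{odd}}=\tau_1\tau_3\cdots\tau_{n-1}$, $\delta_{n,\mathrm{even}}=\tau_2\tau_4\cdots\tau_{n-2}$ for $n$ even (empty product $=1$). Bases. Fix $k\in\mathbb Z$, put $v_m=\Psi^{k+m}$ for $1\le m\le n$, and for $1\le l\le m\le n$ put $v_m(l)=v_m-s_1(\boldsymbol Z)v_{m-1}+\dots+(-1)^{m-l}s_{m-l}(\boldsymbol Z)v_l$. If $n=2h+1$: $Q_k'$ has $v_1,\dots,v_{h+1}$ at positions $1,3,\dots,2h+1$ and $v_{2h+2-i}(i+1)$ at position $2i$, $i=1,\dots,h$; $Q_k''$ has $v_1,\dots,v_h,v_{h+1}$ at positions $2,4,\dots,2h,2h+1$ and $v_{2h+2-i}(i)$ at position $2i-1$, $i=1,\dots,h$. If $n=2h$: $Q_k'$ has $v_1,\dots,v_h,v_{h+1}$ at positions $1,3,\dots,2h-1,2h$ and $v_{2h+1-i}(i+1)$ at position $2i$, $i=1,\dots,h-1$; $Q_k''$ has $v_1,\dots,v_h$ at positions $2,4,\dots,2h$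 and $v_{2h+1-i}(i)$ at position $2i-1$, $i=1,\dots,h$. All these bases are exceptional. *)

theory Defs
  imports
    "HOL-Complex_Analysis.Complex_Analysis"
    "HOL-Library.Poly_Mapping"
    "HOL-Combinatorics.Permutations"
    "HOL-Computational_Algebra.Fraction_Field"
    "HOL-Algebra.QuotRing"
    "HOL-Algebra.Module"
begin

text \<open>
  Coordinates, equivariant parameters and basis positions are indexed by \<open>1, \<dots>, n\<close>.
  Polynomials and Laurent polynomials are finitely supported coefficient functions
  (exponent vectors to complex numbers) with the convolution product of
  \<^theory>\<open>HOL-Library.Poly_Mapping\<close>.
\<close>

section \<open>Laurent polynomials in \<open>Z\<^sub>1, \<dots>, Z\<^sub>n\<close>\<close>

type_synonym laurent = "(nat \<Rightarrow>\<^sub>0 int) \<Rightarrow>\<^sub>0 complex"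

definition Laurent :: "nat \<Rightarrow> laurent set" where
  "Laurent n = {q. \<forall>m\<in>Poly_Mapping.keys q. Poly_Mapping.keys m \<subseteq> {1..n}}"

definition laurent_ring :: "nat \<Rightarrow> laurent ring" where
  "laurent_ring n = \<lparr>carrier = Laurent n, mult = (*), one = 1, zero = 0, add = (+)\<rparr>"

text \<open>The monomial \<open>Z\<^sub>a\<^sup>m\<close>, for an integer \<open>m\<close>.\<close>

definition Zpow :: "nat \<Rightarrow> int \<Rightarrow> laurent" where
  "Zpow a m = Poly_Mapping.single (Poly_Mapping.single a m) 1"

text \<open>\<open>f(Z\<^sup>-\<^sup>1)\<close>: the exponent vectors are negated.\<close>

definition inv_Z :: "laurent \<Rightarrow> laurent" where
  "inv_Z = Poly_Mapping.map_key uminus"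

definition eval_Z :: "(nat \<Rightarrow> complex) \<Rightarrow> laurent \<Rightarrow> complex" where
  "eval_Z c q = (\<Sum>m\<in>Poly_Mapping.keys q.
     Poly_Mapping.lookup q m * (\<Prod>a\<in>Poly_Mapping.keys m. c a powi Poly_Mapping.lookup m a))"

definition elem_sym :: "nat \<Rightarrow> nat \<Rightarrow> laurent" where
  "elem_sym n i = (\<Sum>S | S \<subseteq> {1..n} \<and> card S = i. \<Prod>a\<in>S. Zpow a 1)"


section \<open>The ring \<open>K\<close> and its sesquilinear form\<close>

text \<open>\<open>\<complex>[X\<^sup>\<plusminus>\<^sup>1, Z\<^sup>\<plusminus>\<^sup>1]\<close> is represented as the ring of Laurent polynomials in \<open>X\<close>
  with coefficients in \<open>\<complex>[Z\<^sup>\<plusminus>\<^sup>1]\<close>.\<close>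

type_synonym laurentX = "int \<Rightarrow>\<^sub>0 laurent"

definition laurentX_ring :: "nat \<Rightarrow> laurentX ring" where
  "laurentX_ring n =
     \<lparr>carrier = {f. \<forall>m. Poly_Mapping.lookup f m \<in> Laurent n},
      mult = (*), one = 1, zero = 0, add = (+)\<rparr>"

definition K_ideal :: "nat \<Rightarrow> laurentX set" where
  "K_ideal n = Idl\<^bsub>laurentX_ring n\<^esub>
     {\<Prod>a=1..n. Poly_Mapping.single 1 1 - Poly_Mapping.single 0 (Zpow a 1)}"

definition K_ring :: "nat \<Rightarrow> laurentX set ring" where
  "K_ring n = laurentX_ring n Quot K_ideal n"

text \<open>\<open>f(Z\<^sub>a, Z)\<close>. Note that \<open>f(Z\<^sub>a\<^sup>-\<^sup>1, Z\<^sup>-\<^sup>1)\<close> is \<open>inv_Z (subst_X f a)\<close>.\<close>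

definition subst_X :: "laurentX \<Rightarrow> nat \<Rightarrow> laurent" where
  "subst_X f a = (\<Sum>m\<in>Poly_Mapping.keys f. Poly_Mapping.lookup f m * Zpow a m)"

text \<open>The sum defining the form is formed in the fraction field; its value is the
  Laurent polynomial representing it.\<close>

definition A_rep :: "nat \<Rightarrow> laurentX \<Rightarrow> laurentX \<Rightarrow> laurent" where
  "A_rep n f g = (THE q. q \<in> Laurent n \<and>
     Fract q 1 = (\<Sum>a=1..n. Fract (inv_Z (subst_X f a) * subst_X g a)
                                 (\<Prod>j\<in>{1..n} - {a}. 1 - Zpow j 1 * Zpow a (-1))))"

definition A_K :: "nat \<Rightarrow> laurentX set \<Rightarrow> laurentX set \<Rightarrow> laurent" where
  "A_K n C D = the_elem ((\<lambda>(f, g). A_rep n f g) ` (C \<times> D))"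


section \<open>Equivariant cohomology of projective space\<close>

datatype hvar = VX | VY nat | VZ nat

type_synonym hpoly = "(hvar \<Rightarrow>\<^sub>0 nat) \<Rightarrow>\<^sub>0 complex"

definition hX :: hpoly where
  "hX = Poly_Mapping.single (Poly_Mapping.single VX 1) 1"

definition hY :: "nat \<Rightarrow> hpoly" where
  "hY j = Poly_Mapping.single (Poly_Mapping.single (VY j) 1) 1"

definition hZ :: "nat \<Rightarrow> hpoly" where
  "hZ a = Poly_Mapping.single (Poly_Mapping.single (VZ a) 1) 1"

definition hC :: "complex \<Rightarrow> hpoly" where
  "hC c = Poly_Mapping.single 0 c"

definition perm_Y :: "(nat \<Rightarrow> nat) \<Rightarrow> hvar \<Rightarrow> hvar" where
  "perm_Y \<pi> v = (case v of VX \<Rightarrow> VX | VY j \<Rightarrow> VY (\<pi> j) | VZ a \<Rightarrow> VZ a)"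

text \<open>\<open>\<complex>[x, y, z]\<close>, symmetric in \<open>y\<^sub>1, \<dots>, y\<^sub>n\<^sub>-\<^sub>1\<close>.\<close>

definition hpoly_ring :: "nat \<Rightarrow> hpoly ring" where
  "hpoly_ring n =
     \<lparr>carrier = {f. (\<forall>m\<in>Poly_Mapping.keys f.
                       Poly_Mapping.keys m \<subseteq> {VX} \<union> VY ` {1..n-1} \<union> VZ ` {1..n}) \<and>
                    (\<forall>\<pi>. \<pi> permutes {1..n-1} \<longrightarrow>
                       (\<forall>m. Poly_Mapping.lookup f (Poly_Mapping.map_key (perm_Y \<pi>) m) =
                            Poly_Mapping.lookup f m))},
      mult = (*), one = 1, zero = 0, add = (+)\<rparr>"

text \<open>\<open>(u - x) \<Prod>\<^sub>j (u - y\<^sub>j) - \<Prod>\<^sub>a (u - z\<^sub>a)\<close> as a polynomial in \<open>u\<close>; all of its coefficients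
  are relations of \<open>H\<close>.\<close>

definition H_relation :: "nat \<Rightarrow> hpoly poly" where
  "H_relation n = [:- hX, 1:] * (\<Prod>j=1..n-1. [:- hY j, 1:]) - (\<Prod>a=1..n. [:- hZ a, 1:])"

text \<open>An \<open>H\<close>-valued function of \<open>z\<close> takes at a point \<open>z\<close> its value in the fibre of \<open>H\<close> over \<open>z\<close>,
  that is, in \<open>H\<close> modulo the identification of the equivariant parameters with the coordinates
  of the point. Hence the additional generators \<open>hZ a - hC (z a)\<close>.\<close>

definition H_ideal :: "nat \<Rightarrow> (nat \<Rightarrow> complex) \<Rightarrow> hpoly set" where
  "H_ideal n z = Idl\<^bsub>hpoly_ring n\<^esub>
     (range (coeff (H_relation n)) \<union> {hZ a - hC (z a) | a. a \<in> {1..n}})"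

definition H_ring :: "nat \<Rightarrow> (nat \<Rightarrow> complex) \<Rightarrow> hpoly set ring" where
  "H_ring n z = hpoly_ring n Quot H_ideal n z"

definition H_class :: "nat \<Rightarrow> (nat \<Rightarrow> complex) \<Rightarrow> hpoly \<Rightarrow> hpoly set" where
  "H_class n z f = H_ideal n z +>\<^bsub>hpoly_ring n\<^esub> f"


section \<open>The functions \<open>\<Psi>\<^sup>m\<close>\<close>

definition L_dom :: "nat \<Rightarrow> (nat \<Rightarrow> complex) set" where
  "L_dom n = {z \<in> {1..n} \<rightarrow>\<^sub>E UNIV. \<forall>a\<in>{1..n}. \<forall>b\<in>{1..n}. a \<noteq> b \<longrightarrow> z a - z b \<notin> \<int>}"

text \<open>\<open>\<alpha>\<close> is a branch of \<open>arg p\<close> on the region \<open>D\<close>.\<close>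

definition arg_branch :: "complex set \<Rightarrow> (complex \<Rightarrow> real) \<Rightarrow> bool" where
  "arg_branch D \<alpha> \<longleftrightarrow> open D \<and> connected D \<and> D \<noteq> {} \<and> 0 \<notin> D \<and> continuous_on D \<alpha> \<and>
     (\<forall>p\<in>D. p = of_real (norm p) * cis (\<alpha> p))"

text \<open>The power in \<open>\<Phi>\<close> is taken with
  \<open>log (exp (\<pi> \<i> (2 - n)) p) = \<pi> \<i> (2 - n) + log \<bar>p\<bar> + \<i> arg p\<close>.\<close>

definition Phi :: "nat \<Rightarrow> (complex \<Rightarrow> real) \<Rightarrow> (nat \<Rightarrow> complex) \<Rightarrow> complex \<Rightarrow> complex \<Rightarrow> complex" where
  "Phi n \<alpha> z p t =
     exp (t * (of_real pi * \<i> * (2 - of_nat n) + of_real (ln (norm p)) + \<i> * of_real (\<alpha> p))) *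
     (\<Prod>a=1..n. Gamma (z a - t))"

text \<open>\<open>W\<close> as a polynomial in \<open>t\<close> with coefficients in \<open>\<complex>[y]\<close>.\<close>

definition W_poly :: "nat \<Rightarrow> hpoly poly" where
  "W_poly n = (\<Prod>j=1..n-1. [:hY j, -1:])"

text \<open>The residues of \<open>\<Phi> W\<close> and their sum are taken coefficientwise in
  \<open>W = \<Sum>\<^sub>i W\<^sub>i t\<^sup>i\<close>, the coefficients \<open>W\<^sub>i\<close> being constant in \<open>t\<close>.\<close>

definition Psi_J ::
  "nat \<Rightarrow> (complex \<Rightarrow> real) \<Rightarrow> nat \<Rightarrow> (nat \<Rightarrow> complex) \<times> complex \<Rightarrow> hpoly set" where
  "Psi_J n \<alpha> J = (\<lambda>(z, p). H_class n z
     (\<Sum>i<n. hC (- suminf (\<lambda>r. residue (\<lambda>t. Phi n \<alpha> z p t * t ^ i) (z J + of_nat r))) *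
             coeff (W_poly n) i))"

type_synonym hfun = "(nat \<Rightarrow> complex) \<times> complex \<Rightarrow> hpoly set"

definition Psi :: "nat \<Rightarrow> complex set \<Rightarrow> (complex \<Rightarrow> real) \<Rightarrow> int \<Rightarrow> hfun" where
  "Psi n D \<alpha> m = (\<lambda>(z, p)\<in>L_dom n \<times> D.
     \<Oplus>\<^bsub>H_ring n z\<^esub>J\<in>{1..n}.
       H_class n z (hC (exp (2 * of_real pi * \<i> * of_int (m - 1) * z J)))
         \<otimes>\<^bsub>H_ring n z\<^esub> Psi_J n \<alpha> J (z, p))"


section \<open>The module \<open>\<S>\<^sub>n\<close>\<close>

definition Z_acute :: "(nat \<Rightarrow> complex) \<Rightarrow> nat \<Rightarrow> complex" where
  "Z_acute z j = exp (2 * of_real pi * \<i> * z j)"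

text \<open>All \<open>H\<close>-valued functions on \<open>L'' \<times> D\<close>, as a module over the Laurent polynomials.\<close>

definition fun_module :: "nat \<Rightarrow> complex set \<Rightarrow> (laurent, hfun) module" where
  "fun_module n D =
     \<lparr>carrier = (\<Pi>\<^sub>E (z, p)\<in>L_dom n \<times> D. carrier (H_ring n z)),
      mult = (\<lambda>v w. \<lambda>(z, p)\<in>L_dom n \<times> D. v (z, p) \<otimes>\<^bsub>H_ring n z\<^esub> w (z, p)),
      one = (\<lambda>(z, p)\<in>L_dom n \<times> D. \<one>\<^bsub>H_ring n z\<^esub>),
      zero = (\<lambda>(z, p)\<in>L_dom n \<times> D. \<zero>\<^bsub>H_ring n z\<^esub>),
      add = (\<lambda>v w. \<lambda>(z, p)\<in>L_dom n \<times> D. v (z, p) \<oplus>\<^bsub>H_ring n z\<^esub> w (z, p)),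
      smult = (\<lambda>Q v. \<lambda>(z, p)\<in>L_dom n \<times> D.
         H_class n z (hC (eval_Z (Z_acute z) Q)) \<otimes>\<^bsub>H_ring n z\<^esub> v (z, p))\<rparr>"

definition sol_space :: "nat \<Rightarrow> complex set \<Rightarrow> (complex \<Rightarrow> real) \<Rightarrow> (laurent, hfun) module" where
  "sol_space n D \<alpha> = (fun_module n D)
     \<lparr>carrier := {\<Oplus>\<^bsub>fun_module n D\<^esub>m\<in>{1..n}. Q m \<odot>\<^bsub>fun_module n D\<^esub> Psi n D \<alpha> (int m) | Q.
                   Q \<in> {1..n} \<rightarrow> Laurent n}\<rparr>"

text \<open>The map \<open>\<theta>\<close>, sending the class of \<open>X\<^sup>m\<close> to \<open>\<Psi>\<^sup>m\<^sup>+\<^sup>1\<close>, and the transported form.\<close>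

definition theta_rep :: "nat \<Rightarrow> complex set \<Rightarrow> (complex \<Rightarrow> real) \<Rightarrow> laurentX \<Rightarrow> hfun" where
  "theta_rep n D \<alpha> f = (\<Oplus>\<^bsub>sol_space n D \<alpha>\<^esub>m\<in>Poly_Mapping.keys f.
     Poly_Mapping.lookup f m \<odot>\<^bsub>sol_space n D \<alpha>\<^esub> Psi n D \<alpha> (m + 1))"

definition theta :: "nat \<Rightarrow> complex set \<Rightarrow> (complex \<Rightarrow> real) \<Rightarrow> laurentX set \<Rightarrow> hfun" where
  "theta n D \<alpha> C = the_elem (theta_rep n D \<alpha> ` C)"

definition A_form :: "nat \<Rightarrow> complex set \<Rightarrow> (complex \<Rightarrow> real) \<Rightarrow> hfun \<Rightarrow> hfun \<Rightarrow> laurent" where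
  "A_form n D \<alpha> v w =
     A_K n (inv_into (carrier (K_ring n)) (theta n D \<alpha>) v)
           (inv_into (carrier (K_ring n)) (theta n D \<alpha>) w)"


section \<open>The braid group and its action on exceptional bases\<close>

definition exceptional_bases ::
  "nat \<Rightarrow> complex set \<Rightarrow> (complex \<Rightarrow> real) \<Rightarrow> (nat \<Rightarrow> hfun) set" where
  "exceptional_bases n D \<alpha> = {b \<in> {1..n} \<rightarrow>\<^sub>E carrier (sol_space n D \<alpha>).
     (\<forall>v\<in>carrier (sol_space n D \<alpha>). \<exists>!c. c \<in> {1..n} \<rightarrow>\<^sub>E Laurent n \<and>
        v = (\<Oplus>\<^bsub>sol_space n D \<alpha>\<^esub>j\<in>{1..n}. c j \<odot>\<^bsub>sol_space n D \<alpha>\<^esub> b j)) \<and>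
     (\<forall>i\<in>{1..n}. A_form n D \<alpha> (b i) (b i) = 1) \<and>
     (\<forall>i\<in>{1..n}. \<forall>j\<in>{1..n}. i > j \<longrightarrow> A_form n D \<alpha> (b i) (b j) = 0)}"

text \<open>A word is a list of pairs \<open>(i, True)\<close>, \<open>(i, False)\<close>, standing for \<open>\<tau>\<^sub>i\<close> and its inverse.\<close>

type_synonym braid_word = "(nat \<times> bool) list"

definition braid_words :: "nat \<Rightarrow> braid_word set" where
  "braid_words n = lists ({1..<n} \<times> UNIV)"

inductive_set braid_rel :: "nat \<Rightarrow> (braid_word \<times> braid_word) set" for n :: nat where
  refl: "w \<in> braid_words n \<Longrightarrow> (w, w) \<in> braid_rel n"
| sym: "(u, v) \<in> braid_rel n \<Longrightarrow> (v, u) \<in> braid_rel n"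
| trans: "(u, v) \<in> braid_rel n \<Longrightarrow> (v, w) \<in> braid_rel n \<Longrightarrow> (u, w) \<in> braid_rel n"
| cong: "(u, u') \<in> braid_rel n \<Longrightarrow> (v, v') \<in> braid_rel n \<Longrightarrow> (u @ v, u' @ v') \<in> braid_rel n"
| cancel: "i \<in> {1..<n} \<Longrightarrow> ([(i, s), (i, \<not> s)], []) \<in> braid_rel n"
| braid: "i \<in> {1..<n} \<Longrightarrow> Suc i \<in> {1..<n} \<Longrightarrow>
    ([(i, True), (Suc i, True), (i, True)], [(Suc i, True), (i, True), (Suc i, True)])
      \<in> braid_rel n"
| far: "i \<in> {1..<n} \<Longrightarrow> j \<in> {1..<n} \<Longrightarrow> Suc i < j \<Longrightarrow>
    ([(i, True), (j, True)], [(j, True), (i, True)]) \<in> braid_rel n"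

definition braid_group :: "nat \<Rightarrow> braid_word set monoid" where
  "braid_group n =
     \<lparr>carrier = braid_words n // braid_rel n,
      monoid.mult = (\<lambda>C C'. \<Union>u\<in>C. \<Union>v\<in>C'. braid_rel n `` {u @ v}),
      one = braid_rel n `` {[]}\<rparr>"

definition tau :: "nat \<Rightarrow> nat \<Rightarrow> braid_word set" where
  "tau n i = braid_rel n `` {[(i, True)]}"

definition mutation ::
  "nat \<Rightarrow> complex set \<Rightarrow> (complex \<Rightarrow> real) \<Rightarrow> nat \<Rightarrow> (nat \<Rightarrow> hfun) \<Rightarrow> nat \<Rightarrow> hfun" where
  "mutation n D \<alpha> i b = b(
     i := b (i + 1) \<ominus>\<^bsub>sol_space n D \<alpha>\<^esub>
            A_form n D \<alpha> (b i) (b (i + 1)) \<odot>\<^bsub>sol_space n D \<alpha>\<^esub> b i,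
     i + 1 := b i)"

definition letter_act ::
  "nat \<Rightarrow> complex set \<Rightarrow> (complex \<Rightarrow> real) \<Rightarrow> nat \<times> bool \<Rightarrow> (nat \<Rightarrow> hfun) \<Rightarrow> nat \<Rightarrow> hfun" where
  "letter_act n D \<alpha> = (\<lambda>(i, s). if s then mutation n D \<alpha> i
                            else inv_into (exceptional_bases n D \<alpha>) (mutation n D \<alpha> i))"

text \<open>The action is from the left, so the last letter of a word acts first. On exceptional
  bases the result depends only on the braid represented by the word.\<close>

definition braid_act ::
  "nat \<Rightarrow> complex set \<Rightarrow> (complex \<Rightarrow> real) \<Rightarrow> braid_word set \<Rightarrow> (nat \<Rightarrow> hfun) \<Rightarrow> nat \<Rightarrow> hfun" where
  "braid_act n D \<alpha> g b = the_elem ((\<lambda>w. foldr (letter_act n D \<alpha>) w b) ` g)"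

definition delta_odd :: "nat \<Rightarrow> braid_word set" where
  "delta_odd n = foldr (monoid.mult (braid_group n)) (map (tau n) (filter odd [1..<n]))
     \<one>\<^bsub>braid_group n\<^esub>"

definition delta_even :: "nat \<Rightarrow> braid_word set" where
  "delta_even n = foldr (monoid.mult (braid_group n)) (map (tau n) (filter even [1..<n]))
     \<one>\<^bsub>braid_group n\<^esub>"


section \<open>The bases \<open>Q\<^sub>k'\<close> and \<open>Q\<^sub>k''\<close>\<close>

definition vk :: "nat \<Rightarrow> complex set \<Rightarrow> (complex \<Rightarrow> real) \<Rightarrow> int \<Rightarrow> nat \<Rightarrow> hfun" where
  "vk n D \<alpha> k m = Psi n D \<alpha> (k + int m)"

text \<open>\<open>v\<^sub>m(l)\<close>, for \<open>1 \<le> l \<le> m \<le> n\<close>.\<close>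

definition vkl :: "nat \<Rightarrow> complex set \<Rightarrow> (complex \<Rightarrow> real) \<Rightarrow> int \<Rightarrow> nat \<Rightarrow> nat \<Rightarrow> hfun" where
  "vkl n D \<alpha> k m l = (\<Oplus>\<^bsub>sol_space n D \<alpha>\<^esub>i\<in>{0..m - l}.
     ((-1) ^ i * elem_sym n i) \<odot>\<^bsub>sol_space n D \<alpha>\<^esub> vk n D \<alpha> k (m - i))"

definition Qprime ::
  "nat \<Rightarrow> complex set \<Rightarrow> (complex \<Rightarrow> real) \<Rightarrow> int \<Rightarrow> nat \<Rightarrow> hfun" where
  "Qprime n D \<alpha> k = (let h = n div 2 in (\<lambda>j\<in>{1..n}.
     if odd n then
       (if odd j then vk n D \<alpha> k ((j + 1) div 2)
        else (let i = j div 2 in vkl n D \<alpha> k (2 * h + 2 - i) (i + 1)))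
     else
       (if odd j then vk n D \<alpha> k ((j + 1) div 2)
        else if j = 2 * h then vk n D \<alpha> k (h + 1)
        else (let i = j div 2 in vkl n D \<alpha> k (2 * h + 1 - i) (i + 1)))))"

definition Qdprime ::
  "nat \<Rightarrow> complex set \<Rightarrow> (complex \<Rightarrow> real) \<Rightarrow> int \<Rightarrow> nat \<Rightarrow> hfun" where
  "Qdprime n D \<alpha> k = (let h = n div 2 in (\<lambda>j\<in>{1..n}.
     if odd n then
       (if even j then vk n D \<alpha> k (j div 2)
        else if j = 2 * h + 1 then vk n D \<alpha> k (h + 1)
        else (let i = (j + 1) div 2 in vkl n D \<alpha> k (2 * h + 2 - i) i))
     else
       (if even j then vk n D \<alpha> k (j div 2)
        else (let i = (j + 1) div 2 in vkl n D \<alpha> k (2 * h + 1 - i) i))))"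

end

theory Submission
  imports Defs "HOL-Library.Function_Algebras" "HOL-Computational_Algebra.Polynomial_Factorial"
begin

text \<open>
  A class \<open>f(X, Z)\<close> of \<open>K\<close> is determined by its values \<open>f(Z\<^sub>a, Z)\<close> at the roots \<open>X = Z\<^sub>a\<close>, and
  \<open>\<theta>\<close> sends it to \<open>\<Sum>\<^sub>J f(Z\<^sub>J, Z) \<Psi>\<^sub>J\<close>, because \<open>\<Psi>\<^sup>m\<close> weights \<open>\<Psi>\<^sub>J\<close> by the value of \<open>X\<^sup>m\<^sup>-\<^sup>1\<close> at \<open>Z\<^sub>J\<close>.
  The corollary is a computation with such tuples of values (\<open>Kvec\<close>), which is carried over to
  \<open>\<S>\<^sub>n\<close> by the map \<open>Theta\<close>. There are three ingredients.

  The mutations. The form satisfies \<open>A(v\<^sub>i, v\<^sub>j) = a(j - i)\<close>, where \<open>a(0) = 1\<close> and \<open>a(d) = 0\<close> for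
  \<open>-n < d < 0\<close> by Lagrange interpolation (\<open>root_sum_small\<close>), and
  \<open>\<Sum>\<^sub>i (-1)\<^sup>i s\<^sub>i a(d - i) = 0\<close> by the relation \<open>\<Prod>\<^sub>a (X - Z\<^sub>a) = 0\<close> (\<open>root_sum_recurrence\<close>). For
  the truncated sums this gives \<open>A(v\<^sub>l\<^sub>-\<^sub>1, v\<^sub>m(l)) = (-1)\<^sup>m\<^sup>-\<^sup>l s\<^sub>m\<^sub>-\<^sub>l\<^sub>+\<^sub>1\<close>, so that the mutation of
  the pair \<open>(v\<^sub>l\<^sub>-\<^sub>1, v\<^sub>m(l))\<close> is \<open>(v\<^sub>m(l-1), v\<^sub>l\<^sub>-\<^sub>1)\<close> (\<open>tvec_mutation\<close>). In \<open>Q\<^sub>k'\<close> the vectors at positions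
  \<open>2i - 1, 2i\<close> form such pairs, and mutating all of them gives \<open>Q\<^sub>k''\<close> (\<open>odd_mutations_qprime\<close>). In
  \<open>Q\<^sub>k''\<close> the vectors at positions \<open>2i, 2i + 1\<close> form such pairs, and mutating them gives \<open>Q\<^sub>k\<^sub>-\<^sub>1'\<close> except
  for the first vector: it is \<open>v\<^sub>n(1)\<close> instead of \<open>v\<^sub>0\<close>, and the relation between \<open>v\<^sub>0, \<dots>, v\<^sub>n\<close> says
  \<open>v\<^sub>n(1) = (-1)\<^sup>n\<^sup>+\<^sup>1 s\<^sub>n v\<^sub>0\<close> (\<open>even_mutations_qdprime\<close>).

  The braid group. An element of the braid group acts through any word that represents it, and such
  words may contain inverse generators. The action is therefore meaningful only because mutations
  are bijections of the set of exceptional bases and satisfy the braid relations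
  (\<open>bij_betw_mutate\<close>, \<open>mutate_braid\<close>, \<open>class_acts_as_word\<close>), and only for exceptional bases.
  That \<open>Q\<^sub>k'\<close> is exceptional follows from the same values of the form (\<open>exceptional_qprime\<close>); linear
  independence is automatic, because the Gram matrix is unitriangular.

  Injectivity of \<open>\<theta>\<close>. The form on \<open>\<S>\<^sub>n\<close> is defined through the inverse of \<open>\<theta>\<close>, so the \<open>\<Psi>\<^sub>J\<close> have
  to be linearly independent over the functions of \<open>z\<close>. Restricted to a fixed point of the torus, \<open>\<Psi>\<^sub>J\<close> is
  \<open>p\<close> to the power \<open>z\<^sub>J\<close> times an entire function of \<open>p\<close>, up to a rescaling of \<open>p\<close>. A linear relation extends to
  all values of \<open>log p\<close>; going round \<open>p = 0\<close> multiplies the \<open>J\<close>-th term by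
  \<open>exp (2 \<pi> \<i> z\<^sub>J)\<close>, and these numbers are distinct, so by Vandermonde every term vanishes
  (\<open>monodromy_independence\<close>). At the fixed point \<open>J\<close> the entire function of \<open>\<Psi>\<^sub>J\<close> is nonzero at \<open>p = 0\<close>
  (\<open>fixed_coeff_nonzero\<close>), which gives \<open>Theta_inj\<close>.
\<close>

section \<open>Evaluating finitely supported functions\<close>

abbreviation lookup :: "('v \<Rightarrow>\<^sub>0 'c::zero) \<Rightarrow> 'v \<Rightarrow> 'c" where "lookup \<equiv> Poly_Mapping.lookup"

abbreviation keys :: "('v \<Rightarrow>\<^sub>0 'c::zero) \<Rightarrow> 'v set" where "keys \<equiv> Poly_Mapping.keys"

abbreviation single :: "'v \<Rightarrow> 'c::zero \<Rightarrow> 'v \<Rightarrow>\<^sub>0 'c" where "single \<equiv> Poly_Mapping.single"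

abbreviation map_key :: "('v \<Rightarrow> 'w) \<Rightarrow> ('w \<Rightarrow>\<^sub>0 'c::zero) \<Rightarrow> 'v \<Rightarrow>\<^sub>0 'c" where "map_key \<equiv> Poly_Mapping.map_key"

text \<open>Multiplicativity of a map on finitely supported functions reduces, through this induction, to
  the product of two monomials.\<close>

lemma poly_mapping_add_induct [case_names single add]:
  fixes P :: "('m \<Rightarrow>\<^sub>0 'c::comm_monoid_add) \<Rightarrow> bool"
  assumes single: "\<And>m c. P (single m c)"
      and add: "\<And>f g. P f \<Longrightarrow> P g \<Longrightarrow> P (f + g)"
  shows "P f"
proof -
  have "P (\<Sum>m\<in>S. single m (lookup f m))" if "finite S" for S
    using that
  proof induction
    case empty
    show ?case using single[of undefined 0] by simp
  next
    case (insert m S)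
    then show ?case by (simp add: add single)
  qed
  moreover have "(\<Sum>m\<in>keys f. single m (lookup f m)) = f"
    by (rule poly_mapping_eqI)
       (auto simp: lookup_sum lookup_single when_def in_keys_iff sum.delta)
  ultimately show ?thesis
    using finite_keys by metis
qed

definition pm_eval :: "('m \<Rightarrow> 'r) \<Rightarrow> ('m \<Rightarrow>\<^sub>0 'r) \<Rightarrow> 'r::comm_ring_1" where
  "pm_eval \<phi> q = (\<Sum>m\<in>keys q. lookup q m * \<phi> m)"

lemma pm_eval_superset:
  assumes "finite S" "keys q \<subseteq> S"
  shows "pm_eval \<phi> q = (\<Sum>m\<in>S. lookup q m * \<phi> m)"
  unfolding pm_eval_def
  by (rule sum.mono_neutral_left) (use assms in \<open>auto simp: in_keys_iff\<close>)

lemma pm_eval_0 [simp]: "pm_eval \<phi> 0 = 0"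
  by (simp add: pm_eval_def)

lemma pm_eval_single: "pm_eval \<phi> (single m c) = c * \<phi> m"
  by (cases "c = 0") (simp_all add: pm_eval_def)

lemma pm_eval_add: "pm_eval \<phi> (f + g) = pm_eval \<phi> f + pm_eval \<phi> g"
proof -
  let ?S = "keys f \<union> keys g"
  have "pm_eval \<phi> h = (\<Sum>m\<in>?S. lookup h m * \<phi> m)" if "h \<in> {f, g, f + g}" for h
    using that keys_add[of f g] by (intro pm_eval_superset) auto
  then show ?thesis
    by (simp add: lookup_add distrib_right sum.distrib)
qed

lemma pm_eval_uminus: "pm_eval \<phi> (- f) = - pm_eval \<phi> f"
  using pm_eval_add[of \<phi> f "- f"] by (simp add: eq_neg_iff_add_eq_0 add.commute)

lemma pm_eval_diff: "pm_eval \<phi> (f - g) = pm_eval \<phi> f - pm_eval \<phi> g"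
  using pm_eval_add[of \<phi> f "- g"] by (simp add: pm_eval_uminus)

lemma pm_eval_sum: "pm_eval \<phi> (\<Sum>i\<in>I. f i) = (\<Sum>i\<in>I. pm_eval \<phi> (f i))"
  by (induction I rule: infinite_finite_induct) (simp_all add: pm_eval_add)

lemma pm_eval_mult:
  fixes \<phi> :: "'m::comm_monoid_add \<Rightarrow> 'r::comm_ring_1"
  assumes "\<And>a b. \<phi> (a + b) = \<phi> a * \<phi> b"
  shows "pm_eval \<phi> (f * g) = pm_eval \<phi> f * pm_eval \<phi> g"
proof (induction f rule: poly_mapping_add_induct)
  case (single m c)
  show ?case
    by (induction g rule: poly_mapping_add_induct)
       (simp_all add: mult_single pm_eval_single assms distrib_left pm_eval_add mult.assoc mult.left_commute)
qed (simp add: distrib_right pm_eval_add)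

lemma pm_eval_one: "\<phi> 0 = 1 \<Longrightarrow> pm_eval \<phi> 1 = 1"
  by (simp flip: single_one add: pm_eval_single)

lemma pm_eval_prod:
  fixes \<phi> :: "'m::comm_monoid_add \<Rightarrow> 'r::comm_ring_1"
  assumes "\<And>a b. \<phi> (a + b) = \<phi> a * \<phi> b" "\<phi> 0 = 1"
  shows "pm_eval \<phi> (\<Prod>i\<in>I. f i) = (\<Prod>i\<in>I. pm_eval \<phi> (f i))"
  by (induction I rule: infinite_finite_induct) (simp_all add: pm_eval_mult pm_eval_one assms)

text \<open>The substitution \<open>Z \<mapsto> Z\<^sup>-\<^sup>1\<close> and the permutations of the \<open>y\<^sub>j\<close> both rename exponents along
  an additive bijection.\<close>

lemma map_key_single_bij:
  assumes "bij \<sigma>"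
  shows "map_key \<sigma> (single m c) = single (inv_into UNIV \<sigma> m) c"
  using map_key_single[of \<sigma> "inv_into UNIV \<sigma> m" c] assms by (simp add: bij_is_inj bij_is_surj surj_f_inv_f)

lemma map_key_mult:
  fixes \<sigma> :: "'m::comm_monoid_add \<Rightarrow> 'm" and f g :: "'m \<Rightarrow>\<^sub>0 'r::comm_ring_1"
  assumes "bij \<sigma>" "\<And>a b. \<sigma> (a + b) = \<sigma> a + \<sigma> b"
  shows "map_key \<sigma> (f * g) = map_key \<sigma> f * map_key \<sigma> g"
proof -
  have i: "inj \<sigma>" using assms bij_is_inj by blast
  have inv: "inv_into UNIV \<sigma> (a + b) = inv_into UNIV \<sigma> a + inv_into UNIV \<sigma> b" for a b
    by (metis assms bij_inv_eq_iff)
  show ?thesis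
  proof (induction f rule: poly_mapping_add_induct)
    case (single m c)
    show ?case
      by (induction g rule: poly_mapping_add_induct)
         (simp_all add: mult_single map_key_single_bij assms distrib_left map_key_plus i inv)
  qed (simp add: distrib_right map_key_plus i)
qed

lemma map_key_one_bij:
  fixes \<sigma> :: "'m::comm_monoid_add \<Rightarrow> 'm"
  assumes "bij \<sigma>" "\<sigma> 0 = 0"
  shows "map_key \<sigma> (1 :: 'm \<Rightarrow>\<^sub>0 'r::comm_ring_1) = 1"
  using map_key_single_bij[OF assms(1), of 0 "1::'r"] assms
  by (metis bij_inv_eq_iff single_one)

text \<open>The passage from type-class rings, where the computations take place, to the rings with
  explicit carriers in which ideals and quotients are formed.\<close>

lemma cring_carrier_closed:
  fixes C :: "'r::comm_ring_1 set"
  assumes "0 \<in> C" "1 \<in> C" "\<And>a b. a \<in> C \<Longrightarrow> b \<in> C \<Longrightarrow> a + b \<in> C"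
    and "\<And>a b. a \<in> C \<Longrightarrow> b \<in> C \<Longrightarrow> a * b \<in> C" "\<And>a. a \<in> C \<Longrightarrow> - a \<in> C"
  shows "cring \<lparr>carrier = C, mult = (*), one = 1, zero = 0, add = (+)\<rparr>"
proof (rule cringI)
  show "abelian_group \<lparr>carrier = C, mult = (*), one = 1, zero = 0, add = (+)\<rparr>"
  proof (rule abelian_groupI)
    fix x assume "x \<in> carrier \<lparr>carrier = C, mult = (*), one = 1, zero = 0, add = (+)\<rparr>"
    then show "\<exists>y\<in>carrier \<lparr>carrier = C, mult = (*), one = 1, zero = 0, add = (+)\<rparr>.
      y \<oplus>\<^bsub>\<lparr>carrier = C, mult = (*), one = 1, zero = 0, add = (+)\<rparr>\<^esub> x =
      \<zero>\<^bsub>\<lparr>carrier = C, mult = (*), one = 1, zero = 0, add = (+)\<rparr>\<^esub>"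
      using assms(5) by (intro bexI[of _ "- x"]) auto
  qed (use assms in \<open>auto simp: add_ac\<close>)
  show "Group.comm_monoid \<lparr>carrier = C, mult = (*), one = 1, zero = 0, add = (+)\<rparr>"
    by (rule comm_monoidI) (use assms in \<open>auto simp: mult_ac\<close>)
qed (auto simp: distrib_right)


text \<open>To see that a ring homomorphism vanishes on a generated ideal it suffices to look at the
  generators. The relations of \<open>H\<close> and of \<open>K\<close> are only ever used in this form: as vanishing of
  the values at the fixed points, respectively at the roots.\<close>

lemma genideal_in_kernel:
  fixes C :: "'r::comm_ring_1 set" and h :: "'r \<Rightarrow> 's::comm_ring_1"
  defines "R \<equiv> \<lparr>carrier = C, mult = (*), one = 1, zero = 0, add = (+)\<rparr>"
  assumes ring: "cring R"
    and h: "\<And>a b. h (a + b) = h a + h b" "\<And>a b. h (a * b) = h a * h b"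
    and S: "S \<subseteq> C" "\<And>s. s \<in> S \<Longrightarrow> h s = 0" and f: "f \<in> Idl\<^bsub>R\<^esub> S"
  shows "h f = 0"
proof -
  interpret cring R by (rule ring)
  have h0: "h 0 = 0" using h(1)[of 0 0] by simp
  have closed: "0 \<in> C" "\<And>a b. a \<in> C \<Longrightarrow> b \<in> C \<Longrightarrow> a + b \<in> C" "\<And>a b. a \<in> C \<Longrightarrow> b \<in> C \<Longrightarrow> a * b \<in> C"
    using zero_closed a_closed m_closed by (simp_all add: R_def)
  have "ideal {f \<in> C. h f = 0} R"
  proof (rule idealI[OF ring_axioms])
    show "subgroup {f \<in> C. h f = 0} (add_monoid R)"
    proof (rule add.subgroupI)
      fix f assume f: "f \<in> {f \<in> C. h f = 0}"
      then have g: "\<ominus>\<^bsub>R\<^esub> f \<in> C" "\<ominus>\<^bsub>R\<^esub> f + f = 0"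
        using l_neg[of f] a_inv_closed[of f] by (simp_all add: R_def)
      then show "\<ominus>\<^bsub>R\<^esub> f \<in> {f \<in> C. h f = 0}"
        using h(1)[of "\<ominus>\<^bsub>R\<^esub> f" f] f h0 by simp
    qed (auto simp: R_def closed h h0 intro!: exI[of _ 0])
  qed (auto simp: R_def closed h)
  then have "Idl\<^bsub>R\<^esub> S \<subseteq> {f \<in> C. h f = 0}"
    using S by (intro genideal_minimal) auto
  then show ?thesis using f by auto
qed

definition supported_in :: "'v set \<Rightarrow> (('v \<Rightarrow>\<^sub>0 'e::comm_monoid_add) \<Rightarrow>\<^sub>0 'c::comm_ring_1) set" where
  "supported_in V = {f. \<forall>m\<in>keys f. keys m \<subseteq> V}"

lemma supported_in_single: "keys m \<subseteq> V \<Longrightarrow> single m c \<in> supported_in V"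
  by (auto simp: supported_in_def)

lemma supported_in_0: "0 \<in> supported_in V" and supported_in_1: "1 \<in> supported_in V"
  by (simp_all add: supported_in_def)

lemma supported_in_add: "f \<in> supported_in V \<Longrightarrow> g \<in> supported_in V \<Longrightarrow> f + g \<in> supported_in V"
  unfolding supported_in_def using keys_add[of f g] by fastforce

lemma supported_in_uminus: "f \<in> supported_in V \<Longrightarrow> - f \<in> supported_in V"
  by (auto simp: supported_in_def in_keys_iff)

lemma supported_in_mult:
  assumes "f \<in> supported_in V" "g \<in> supported_in V"
  shows "f * g \<in> supported_in V"
  unfolding supported_in_def
proof (intro CollectI ballI)
  fix m assume "m \<in> keys (f * g)"
  then obtain a b where "m = a + b" "a \<in> keys f" "b \<in> keys g"
    using keys_mult[of f g] by blast
  then show "keys m \<subseteq> V"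
    using assms keys_add[of a b] unfolding supported_in_def by blast
qed

lemma monomial_value_superset:
  fixes val :: "'v \<Rightarrow> 'e::comm_monoid_add \<Rightarrow> 'r::comm_monoid_mult"
  assumes "\<And>v. val v 0 = 1" "finite S" "keys m \<subseteq> S"
  shows "(\<Prod>v\<in>keys m. val v (lookup m v)) = (\<Prod>v\<in>S. val v (lookup m v))"
  by (rule prod.mono_neutral_left) (use assms in \<open>auto simp: in_keys_iff\<close>)

lemma monomial_value_add:
  fixes val :: "'v \<Rightarrow> 'e::comm_monoid_add \<Rightarrow> 'r::comm_monoid_mult"
  assumes val: "\<And>v. val v 0 = 1" "\<And>v a b. val v (a + b) = val v a * val v b"
  shows "(\<Prod>v\<in>keys (m + m'). val v (lookup (m + m') v)) =
    (\<Prod>v\<in>keys m. val v (lookup m v)) *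
    (\<Prod>v\<in>keys m'. val v (lookup m' v))"
proof -
  let ?S = "keys m \<union> keys m'"
  have *: "(\<Prod>v\<in>keys l. val v (lookup l v)) = (\<Prod>v\<in>?S. val v (lookup l v))"
    if "l \<in> {m, m', m + m'}" for l
    using that keys_add[of m m'] by (intro monomial_value_superset val(1)) auto
  show ?thesis
    unfolding *[of m, simplified] *[of m', simplified] *[of "m + m'", simplified]
    by (simp add: lookup_add val(2) prod.distrib)
qed


section \<open>Laurent polynomials\<close>

lemma Laurent_eq: "Laurent n = supported_in {1..n}"
  by (simp add: Laurent_def supported_in_def)

lemma Laurent_0 [simp, intro]: "0 \<in> Laurent n" and Laurent_1 [simp, intro]: "1 \<in> Laurent n"
  by (simp_all add: Laurent_eq supported_in_0 supported_in_1)

lemma Laurent_add: "f \<in> Laurent n \<Longrightarrow> g \<in> Laurent n \<Longrightarrow> f + g \<in> Laurent n"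
  and Laurent_mult: "f \<in> Laurent n \<Longrightarrow> g \<in> Laurent n \<Longrightarrow> f * g \<in> Laurent n"
  and Laurent_uminus: "f \<in> Laurent n \<Longrightarrow> - f \<in> Laurent n"
  by (simp_all add: Laurent_eq supported_in_add supported_in_mult supported_in_uminus)

lemma Laurent_diff: "f \<in> Laurent n \<Longrightarrow> g \<in> Laurent n \<Longrightarrow> f - g \<in> Laurent n"
  using Laurent_add[of f n "- g"] Laurent_uminus by simp

lemma Laurent_sum: "(\<And>i. i \<in> I \<Longrightarrow> f i \<in> Laurent n) \<Longrightarrow> (\<Sum>i\<in>I. f i) \<in> Laurent n"
  by (induction I rule: infinite_finite_induct) (simp_all add: Laurent_add)

lemma Laurent_prod: "(\<And>i. i \<in> I \<Longrightarrow> f i \<in> Laurent n) \<Longrightarrow> (\<Prod>i\<in>I. f i) \<in> Laurent n"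
  by (induction I rule: infinite_finite_induct) (simp_all add: Laurent_mult)

lemma Laurent_power: "f \<in> Laurent n \<Longrightarrow> f ^ i \<in> Laurent n"
  by (induction i) (simp_all add: Laurent_mult)

lemma Zpow_add: "Zpow a (i + j) = Zpow a i * Zpow a j"
  by (simp add: Zpow_def mult_single single_add)

lemma Zpow_0 [simp]: "Zpow a 0 = 1"
  by (simp add: Zpow_def)

lemma Zpow_in_Laurent: "a \<in> {1..n} \<Longrightarrow> Zpow a i \<in> Laurent n"
  unfolding Zpow_def Laurent_eq by (rule supported_in_single) simp

lemma Zpow_nonzero: "Zpow a i \<noteq> 0"
  by (metis Zpow_def lookup_single_eq lookup_zero one_neq_zero)

lemma Zpow_eq_iff: "Zpow a 1 = Zpow b 1 \<longleftrightarrow> a = b"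
proof
  assume "Zpow a 1 = Zpow b 1"
  then have "keys (Zpow a 1) = keys (Zpow b 1)" by simp
  then have "single a (1::int) = single b 1"
    by (simp add: Zpow_def)
  then have "keys (single a (1::int)) = keys (single b (1::int))"
    by simp
  then show "a = b" by simp
qed simp

lemma elem_sym_in_Laurent: "elem_sym n i \<in> Laurent n"
  unfolding elem_sym_def by (intro Laurent_sum Laurent_prod Zpow_in_Laurent) auto

lemma elem_sym_0 [simp]: "elem_sym n 0 = 1"
proof -
  have "{S. S \<subseteq> {1..n} \<and> card S = 0} = {{}}"
    using finite_subset[of _ "{1..n}"] by auto
  then show ?thesis by (simp add: elem_sym_def)
qed

lemma elem_sym_top: "elem_sym n n = (\<Prod>a=1..n. Zpow a 1)"
proof -
  have "{S. S \<subseteq> {1..n} \<and> card S = n} = {{1..n}}"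
    using card_subset_eq[of "{1..n}"] by auto
  then show ?thesis by (simp add: elem_sym_def)
qed

text \<open>Vieta's formula for \<open>\<Prod>\<^sub>j (X - Z\<^sub>j)\<close> at its root \<open>X = Z\<^sub>a\<close>. Every linear relation between the
  \<open>\<Psi>\<^sup>m\<close> and every recurrence for the form comes from this identity.\<close>

lemma elem_sym_root:
  assumes "a \<in> {1..n}"
  shows "(\<Sum>i=0..n. (-1) ^ i * elem_sym n i * Zpow a (m - int i)) = 0"
proof -
  have pw: "Zpow a (int k) = Zpow a 1 ^ k" for k
    by (induction k) (simp_all add: Zpow_add add.commute)
  have "0 = (\<Prod>j=1..n. - Zpow j 1 + Zpow a 1)"
    using assms by (subst eq_commute, intro prod_zero) auto
  also have "\<dots> = (\<Sum>S\<in>Pow {1..n}. (\<Prod>j\<in>S. - Zpow j 1) * (\<Prod>j\<in>{1..n} - S. Zpow a 1))"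
    by (rule prod_add) simp
  also have "\<dots> = (\<Sum>S\<in>Pow {1..n}. (-1) ^ card S * (\<Prod>j\<in>S. Zpow j 1) * Zpow a (int n - int (card S)))"
  proof (rule sum.cong[OF HOL.refl])
    fix S assume "S \<in> Pow {1..n}"
    then have S: "finite S" "S \<subseteq> {1..n}" "card S \<le> n"
      using finite_subset[of S "{1..n}"] card_mono[of "{1..n}" S] by auto
    then have "(\<Prod>j\<in>{1..n} - S. Zpow a 1) = Zpow a (int n - int (card S))"
      by (simp add: card_Diff_subset flip: pw of_nat_diff)
    moreover have "(\<Prod>j\<in>S. - Zpow j 1) = (-1) ^ card S * (\<Prod>j\<in>S. Zpow j 1)"
      by (rule prod_uminus)
    ultimately show "(\<Prod>j\<in>S. - Zpow j 1) * (\<Prod>j\<in>{1..n} - S. Zpow a 1) =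
      (-1) ^ card S * (\<Prod>j\<in>S. Zpow j 1) * Zpow a (int n - int (card S))" by simp
  qed
  also have "\<dots> = (\<Sum>i\<in>{0..n}. \<Sum>S\<in>{S \<in> Pow {1..n}. card S = i}.
      (-1) ^ card S * (\<Prod>j\<in>S. Zpow j 1) * Zpow a (int n - int (card S)))"
    by (rule sum.group[symmetric]) (use card_mono[of "{1..n}"] in \<open>auto\<close>)
  also have "\<dots> = (\<Sum>i=0..n. (-1) ^ i * elem_sym n i * Zpow a (int n - int i))"
    unfolding elem_sym_def by (intro sum.cong HOL.refl) (simp add: sum_distrib_left sum_distrib_right)
  finally have "0 = Zpow a (m - int n) * (\<Sum>i=0..n. (-1) ^ i * elem_sym n i * Zpow a (int n - int i))"
    by simp
  also have "\<dots> = (\<Sum>i=0..n. (-1) ^ i * elem_sym n i * Zpow a (m - int i))"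
    by (simp add: sum_distrib_left mult_ac flip: Zpow_add)
  finally show ?thesis by simp
qed

lemma bij_uminus_exponent: "bij (uminus :: (nat \<Rightarrow>\<^sub>0 int) \<Rightarrow> nat \<Rightarrow>\<^sub>0 int)"
  by (simp add: bij_uminus)

lemma inv_Z_add: "inv_Z (f + g) = inv_Z f + inv_Z g"
  unfolding inv_Z_def using bij_is_inj[OF bij_uminus_exponent] by (simp add: map_key_plus)

lemma inv_Z_mult: "inv_Z (f * g) = inv_Z f * inv_Z g"
  unfolding inv_Z_def using bij_uminus_exponent by (rule map_key_mult) simp

lemma inv_Z_Zpow: "inv_Z (Zpow a m) = Zpow a (- m)"
proof -
  have "inv_into UNIV uminus (single a m) = single a (- m)"
    using bij_uminus_exponent by (metis bij_inv_eq_iff single_uminus minus_minus)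
  then show ?thesis
    by (simp add: inv_Z_def Zpow_def map_key_single_bij[OF bij_uminus_exponent])
qed

lemma inv_Z_1 [simp]: "inv_Z 1 = 1"
  using inv_Z_Zpow[of undefined 0] by simp

lemma inv_Z_0 [simp]: "inv_Z 0 = 0"
  by (simp add: inv_Z_def)

lemma inv_Z_uminus: "inv_Z (- f) = - inv_Z f"
  using inv_Z_add[of f "- f"] by (simp add: eq_neg_iff_add_eq_0 add.commute)

lemma inv_Z_prod: "inv_Z (\<Prod>i\<in>I. f i) = (\<Prod>i\<in>I. inv_Z (f i))"
  by (induction I rule: infinite_finite_induct) (simp_all add: inv_Z_mult)

lemma inv_Z_in_Laurent: "f \<in> Laurent n \<Longrightarrow> inv_Z f \<in> Laurent n"
proof -
  assume f: "f \<in> Laurent n"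
  have "keys (inv_Z f) = uminus -` keys f"
    unfolding inv_Z_def using bij_is_inj[OF bij_uminus_exponent] by (rule keys_map_key)
  then show ?thesis
    using f unfolding Laurent_def by (auto simp: keys_minus) (metis keys_minus subsetD atLeastAtMost_iff)+
qed

lemma inv_Z_elem_sym_top: "inv_Z (elem_sym n n) * elem_sym n n = 1"
  unfolding elem_sym_top inv_Z_prod inv_Z_Zpow
  by (simp flip: prod.distrib Zpow_add)

lemma eval_Z_conv_pm_eval:
  "eval_Z c = pm_eval (\<lambda>m. \<Prod>a\<in>keys m. c a powi lookup m a)"
  by (simp add: eval_Z_def pm_eval_def fun_eq_iff)

lemma eval_Z_add: "eval_Z c (f + g) = eval_Z c f + eval_Z c g"
  by (simp add: eval_Z_conv_pm_eval pm_eval_add)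

lemma eval_Z_diff: "eval_Z c (f - g) = eval_Z c f - eval_Z c g"
  by (simp add: eval_Z_conv_pm_eval pm_eval_diff)

lemma eval_Z_mult: "(\<And>a. c a \<noteq> 0) \<Longrightarrow> eval_Z c (f * g) = eval_Z c f * eval_Z c g"
  unfolding eval_Z_conv_pm_eval
  by (rule pm_eval_mult) (rule monomial_value_add[where val = "\<lambda>a i. c a powi i"], simp_all add: power_int_add)

lemma eval_Z_one: "eval_Z c 1 = 1"
  unfolding eval_Z_conv_pm_eval by (rule pm_eval_one) simp

lemma eval_Z_Zpow: "eval_Z c (Zpow a m) = c a powi m"
  by (cases "m = 0") (simp_all add: eval_Z_one, simp add: eval_Z_conv_pm_eval pm_eval_single Zpow_def)

lemma Z_acute_nonzero: "Z_acute z a \<noteq> 0"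
  by (simp add: Z_acute_def)

section \<open>Words in the braid group\<close>

lemma braid_rel_words: "(u, v) \<in> braid_rel n \<Longrightarrow> u \<in> braid_words n \<and> v \<in> braid_words n"
  by (induction rule: braid_rel.induct) (auto simp: braid_words_def)

lemma equiv_braid_rel: "equiv (braid_words n) (braid_rel n)"
proof (rule equivI)
  show "braid_rel n \<subseteq> braid_words n \<times> braid_words n"
    using braid_rel_words by auto
  show "refl_on (braid_words n) (braid_rel n)"
    by (rule refl_onI) (rule braid_rel.refl)
  show "Relation.sym (braid_rel n)" by (rule symI) (rule braid_rel.sym)
  show "Relation.trans (braid_rel n)" by (rule transI) (rule braid_rel.trans)
qed

lemma braid_group_mult:
  assumes "u \<in> braid_words n" "v \<in> braid_words n"
  shows "(braid_rel n `` {u}) \<otimes>\<^bsub>braid_group n\<^esub> (braid_rel n `` {v}) = braid_rel n `` {u @ v}"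
proof -
  have "(\<Union>u'\<in>braid_rel n `` {u}. \<Union>v'\<in>braid_rel n `` {v}. braid_rel n `` {u' @ v'}) =
        braid_rel n `` {u @ v}"
  proof -
    have "braid_rel n `` {u' @ v'} = braid_rel n `` {u @ v}"
      if "u' \<in> braid_rel n `` {u}" "v' \<in> braid_rel n `` {v}" for u' v'
    proof -
      have "(u @ v, u' @ v') \<in> braid_rel n"
        using that by (intro braid_rel.cong) auto
      from equiv_class_eq[OF equiv_braid_rel this] show ?thesis by simp
    qed
    moreover have "u \<in> braid_rel n `` {u}" "v \<in> braid_rel n `` {v}"
      using braid_rel.refl[OF assms(1)] braid_rel.refl[OF assms(2)] by simp_all
    ultimately show ?thesis by (intro equalityI UN_least) (blast+)
  qed
  then show ?thesis unfolding braid_group_def by (simp only: monoid.simps)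
qed

lemma braid_product_word:
  assumes "set is \<subseteq> {1..<n}"
  shows "foldr (monoid.mult (braid_group n)) (map (tau n) is) \<one>\<^bsub>braid_group n\<^esub> =
         braid_rel n `` {map (\<lambda>i. (i, True)) is}"
  using assms
proof (induction "is")
  case Nil
  show ?case by (simp add: braid_group_def)
next
  case (Cons i "is")
  then have "[(i, True)] \<in> braid_words n" "map (\<lambda>i. (i, True)) is \<in> braid_words n"
    by (auto simp: braid_words_def)
  with Cons show ?case
    by (simp add: tau_def braid_group_mult)
qed

text \<open>Bijections of a set that satisfy the braid relations let every word act, and equivalent
  words act in the same way. Surjectivity matters for the words \<open>\<tau>\<^sub>i \<tau>\<^sub>i\<^sup>-\<^sup>1\<close>.\<close>

locale braid_bijections =
  fixes n :: nat and f :: "nat \<Rightarrow> 's \<Rightarrow> 's" and E :: "'s set"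
  assumes bij: "i \<in> {1..<n} \<Longrightarrow> bij_betw (f i) E E"
    and braid_relation: "i \<in> {1..<n} \<Longrightarrow> Suc i \<in> {1..<n} \<Longrightarrow> b \<in> E \<Longrightarrow>
      f i (f (Suc i) (f i b)) = f (Suc i) (f i (f (Suc i) b))"
    and far_relation: "i \<in> {1..<n} \<Longrightarrow> j \<in> {1..<n} \<Longrightarrow> Suc i < j \<Longrightarrow> b \<in> E \<Longrightarrow> f i (f j b) = f j (f i b)"
begin

definition letter :: "nat \<times> bool \<Rightarrow> 's \<Rightarrow> 's" where
  "letter = (\<lambda>(i, s). if s then f i else inv_into E (f i))"

lemma letter_closed: "i \<in> {1..<n} \<Longrightarrow> b \<in> E \<Longrightarrow> letter (i, s) b \<in> E"
  using bij[of i] bij_betw_inv_into[of "f i" E E] by (auto simp: letter_def bij_betw_def)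

lemma word_closed: "w \<in> braid_words n \<Longrightarrow> b \<in> E \<Longrightarrow> foldr letter w b \<in> E"
  by (induction w) (auto simp: braid_words_def letter_closed)

lemma word_respects_braid_rel:
  "(u, v) \<in> braid_rel n \<Longrightarrow> b \<in> E \<Longrightarrow> foldr letter u b = foldr letter v b"
proof (induction arbitrary: b rule: braid_rel.induct)
  case (sym u v)
  show ?case by (rule sym.IH[OF sym.prems, symmetric])
next
  case (trans u v w)
  show ?case using trans.IH(1)[OF trans.prems] trans.IH(2)[OF trans.prems] by (rule HOL.trans)
next
  case (cong u u' v v')
  then show ?case
    using word_closed[of v' b] braid_rel_words[of v v' n] by (metis foldr_append)
next
  case (cancel i s)
  have "inv_into E (f i) (f i b) = b" "f i (inv_into E (f i) b) = b"
    using bij[OF cancel(1)] cancel(2)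
    by (auto simp: bij_betw_def inv_into_f_f f_inv_into_f)
  then show ?case by (cases s) (simp_all add: letter_def)
next
  case (braid i)
  then show ?case using braid_relation by (simp add: letter_def)
next
  case (far i j)
  then show ?case using far_relation by (simp add: letter_def)
qed (rule HOL.refl)

lemma class_acts_as_word:
  assumes "w \<in> braid_words n" "b \<in> E"
  shows "the_elem ((\<lambda>w. foldr letter w b) ` (braid_rel n `` {w})) = foldr letter w b"
proof (rule the_elem_image_unique)
  show "braid_rel n `` {w} \<noteq> {}"
    using braid_rel.refl[OF assms(1)] by blast
  fix w' assume "w' \<in> braid_rel n `` {w}"
  then have "(w, w') \<in> braid_rel n" by simp
  from word_respects_braid_rel[OF this assms(2)]
  show "foldr letter w' b = foldr letter w b" by (rule HOL.sym)
qed

end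


section \<open>Mutations of exceptional bases in a sesquilinear module\<close>

text \<open>Here \<open>M\<close> is a module over the ring \<open>R\<close> with involution \<open>bar\<close>; both are subsets of ambient
  types, so that all computations take place in a type of class \<open>ab_group_add\<close>.\<close>

locale sesquilinear_module = Modules.module scale
  for scale :: "'r::comm_ring_1 \<Rightarrow> 'm::ab_group_add \<Rightarrow> 'm" (infixr \<open>\<cdot>\<close> 75) +
  fixes R :: "'r set" and bar :: "'r \<Rightarrow> 'r" and M :: "'m set" and A :: "'m \<Rightarrow> 'm \<Rightarrow> 'r"
  assumes R_0: "0 \<in> R" and R_1: "1 \<in> R" and R_add: "a \<in> R \<Longrightarrow> b \<in> R \<Longrightarrow> a + b \<in> R"
    and R_mult: "a \<in> R \<Longrightarrow> b \<in> R \<Longrightarrow> a * b \<in> R" and R_uminus: "a \<in> R \<Longrightarrow> - a \<in> R"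
    and R_bar: "a \<in> R \<Longrightarrow> bar a \<in> R"
    and bar_uminus: "a \<in> R \<Longrightarrow> bar (- a) = - bar a"
    and bar_bar: "a \<in> R \<Longrightarrow> bar (bar a) = a"
    and M_0: "0 \<in> M" and M_add: "u \<in> M \<Longrightarrow> v \<in> M \<Longrightarrow> u + v \<in> M"
    and M_scale: "a \<in> R \<Longrightarrow> u \<in> M \<Longrightarrow> a \<cdot> u \<in> M"
    and A_closed: "u \<in> M \<Longrightarrow> v \<in> M \<Longrightarrow> A u v \<in> R"
    and A_add_left: "u \<in> M \<Longrightarrow> u' \<in> M \<Longrightarrow> v \<in> M \<Longrightarrow> A (u + u') v = A u v + A u' v"
    and A_add_right: "u \<in> M \<Longrightarrow> v \<in> M \<Longrightarrow> v' \<in> M \<Longrightarrow> A u (v + v') = A u v + A u v'"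
    and A_scale_left: "a \<in> R \<Longrightarrow> u \<in> M \<Longrightarrow> v \<in> M \<Longrightarrow> A (a \<cdot> u) v = bar a * A u v"
    and A_scale_right: "a \<in> R \<Longrightarrow> u \<in> M \<Longrightarrow> v \<in> M \<Longrightarrow> A u (a \<cdot> v) = a * A u v"
begin

lemma M_uminus: "u \<in> M \<Longrightarrow> - u \<in> M"
  using M_scale[of "-1" u] R_1 R_uminus by simp

lemma M_diff: "u \<in> M \<Longrightarrow> v \<in> M \<Longrightarrow> u - v \<in> M"
  using M_add[of u "- v"] M_uminus by simp

lemma M_sum: "(\<And>i. i \<in> I \<Longrightarrow> f i \<in> M) \<Longrightarrow> (\<Sum>i\<in>I. f i) \<in> M"
  by (induction I rule: infinite_finite_induct) (simp_all add: M_0 M_add)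

lemma A_0_left: "v \<in> M \<Longrightarrow> A 0 v = 0"
  using A_add_left[of 0 0 v] M_0 by simp

lemma A_0_right: "u \<in> M \<Longrightarrow> A u 0 = 0"
  using A_add_right[of u 0 0] M_0 by simp

lemma A_diff_left: "u \<in> M \<Longrightarrow> u' \<in> M \<Longrightarrow> v \<in> M \<Longrightarrow> A (u - u') v = A u v - A u' v"
  using A_add_left[of "u - u'" u' v] M_diff by (simp add: algebra_simps)

lemma A_diff_right: "u \<in> M \<Longrightarrow> v \<in> M \<Longrightarrow> v' \<in> M \<Longrightarrow> A u (v - v') = A u v - A u v'"
  using A_add_right[of u "v - v'" v'] M_diff by (simp add: algebra_simps)

lemma A_sum_left: "(\<And>i. i \<in> I \<Longrightarrow> f i \<in> M) \<Longrightarrow> v \<in> M \<Longrightarrow> A (\<Sum>i\<in>I. f i) v = (\<Sum>i\<in>I. A (f i) v)"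
  by (induction I rule: infinite_finite_induct) (simp_all add: A_0_left A_add_left M_sum)

lemma A_sum_right: "(\<And>i. i \<in> I \<Longrightarrow> f i \<in> M) \<Longrightarrow> u \<in> M \<Longrightarrow> A u (\<Sum>i\<in>I. f i) = (\<Sum>i\<in>I. A u (f i))"
  by (induction I rule: infinite_finite_induct) (simp_all add: A_0_right A_add_right M_sum)

lemma A_lincomb_left:
  assumes "\<And>i. i \<in> I \<Longrightarrow> c i \<in> R" "\<And>i. i \<in> I \<Longrightarrow> f i \<in> M" "v \<in> M"
  shows "A (\<Sum>i\<in>I. c i \<cdot> f i) v = (\<Sum>i\<in>I. bar (c i) * A (f i) v)"
  using assms by (simp add: A_sum_left A_scale_left M_scale)

lemma A_lincomb_right:
  assumes "\<And>i. i \<in> I \<Longrightarrow> c i \<in> R" "\<And>i. i \<in> I \<Longrightarrow> f i \<in> M" "u \<in> M"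
  shows "A u (\<Sum>i\<in>I. c i \<cdot> f i) = (\<Sum>i\<in>I. c i * A u (f i))"
  using assms by (simp add: A_sum_right A_scale_right M_scale)

definition lin_comb :: "nat \<Rightarrow> (nat \<Rightarrow> 'r) \<Rightarrow> (nat \<Rightarrow> 'm) \<Rightarrow> 'm" where
  "lin_comb n c b = (\<Sum>j\<in>{1..n}. c j \<cdot> b j)"

definition combs :: "nat \<Rightarrow> (nat \<Rightarrow> 'm) \<Rightarrow> 'm set" where
  "combs n b = {lin_comb n c b | c. c \<in> {1..n} \<rightarrow> R}"

lemma combs_0: "0 \<in> combs n b"
  unfolding combs_def lin_comb_def
  by (intro CollectI exI[of _ "\<lambda>_. 0"]) (simp add: R_0)

lemma combs_add:
  assumes "u \<in> combs n b" "v \<in> combs n b"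
  shows "u + v \<in> combs n b"
proof -
  obtain c d where cd: "c \<in> {1..n} \<rightarrow> R" "d \<in> {1..n} \<rightarrow> R" "u = lin_comb n c b" "v = lin_comb n d b"
    using assms by (auto simp: combs_def)
  have "u + v = lin_comb n (\<lambda>j. c j + d j) b"
    by (simp add: cd lin_comb_def scale_left_distrib sum.distrib)
  then show ?thesis
    unfolding combs_def using cd by (auto intro!: exI[of _ "\<lambda>j. c j + d j"] R_add)
qed

lemma combs_scale:
  assumes "u \<in> combs n b" "a \<in> R"
  shows "a \<cdot> u \<in> combs n b"
proof -
  obtain c where c: "c \<in> {1..n} \<rightarrow> R" "u = lin_comb n c b"
    using assms by (auto simp: combs_def)
  have "a \<cdot> u = lin_comb n (\<lambda>j. a * c j) b"
    by (simp add: c lin_comb_def scale_sum_right)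
  then show ?thesis
    unfolding combs_def using c assms by (auto intro!: exI[of _ "\<lambda>j. a * c j"] R_mult)
qed

lemma combs_diff: "u \<in> combs n b \<Longrightarrow> v \<in> combs n b \<Longrightarrow> u - v \<in> combs n b"
  using combs_add[of u n b "(-1) \<cdot> v"] combs_scale[of v n b "-1"] R_1 R_uminus by simp

lemma combs_sum: "(\<And>i. i \<in> I \<Longrightarrow> f i \<in> combs n b) \<Longrightarrow> (\<Sum>i\<in>I. f i) \<in> combs n b"
  by (induction I rule: infinite_finite_induct) (simp_all add: combs_0 combs_add)

lemma combs_base:
  assumes "j \<in> {1..n}"
  shows "b j \<in> combs n b"
proof -
  have "b j = lin_comb n (\<lambda>i. if i = j then 1 else 0) b"
  proof -
    have "lin_comb n (\<lambda>i. if i = j then 1 else 0) b = (\<Sum>i\<in>{1..n}. if i = j then b i else 0)"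
      unfolding lin_comb_def by (rule sum.cong) auto
    then show ?thesis using assms by simp
  qed
  then show ?thesis
    unfolding combs_def using R_0 R_1 by (auto intro!: exI[of _ "\<lambda>i. if i = j then 1 else 0"])
qed

lemma combs_subset: "(\<And>j. j \<in> {1..n} \<Longrightarrow> b j \<in> combs n b') \<Longrightarrow> combs n b \<subseteq> combs n b'"
proof
  fix u assume *: "\<And>j. j \<in> {1..n} \<Longrightarrow> b j \<in> combs n b'" and "u \<in> combs n b"
  then obtain c where c: "c \<in> {1..n} \<rightarrow> R" "u = (\<Sum>j\<in>{1..n}. c j \<cdot> b j)"
    by (auto simp: combs_def lin_comb_def)
  show "u \<in> combs n b'"
    unfolding c(2) using * c(1) by (intro combs_sum combs_scale) auto
qed

lemma combs_subset_M: "b \<in> {1..n} \<rightarrow> M \<Longrightarrow> combs n b \<subseteq> M"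
  by (auto simp: combs_def lin_comb_def intro!: M_sum M_scale)

definition gram_unitriangular :: "nat \<Rightarrow> (nat \<Rightarrow> 'm) \<Rightarrow> bool" where
  "gram_unitriangular n b \<longleftrightarrow> (\<forall>i\<in>{1..n}. A (b i) (b i) = 1) \<and>
     (\<forall>i\<in>{1..n}. \<forall>j\<in>{1..n}. i > j \<longrightarrow> A (b i) (b j) = 0)"

text \<open>A spanning family with unitriangular Gram matrix is a basis, by \<open>gram_independent\<close> below; so
  only spanning has to be followed through a mutation.\<close>

definition exceptional :: "nat \<Rightarrow> (nat \<Rightarrow> 'm) set" where
  "exceptional n = {b \<in> {1..n} \<rightarrow>\<^sub>E M. M \<subseteq> combs n b \<and> gram_unitriangular n b}"

text \<open>Pairing a relation with the last vector that occurs in it isolates its coefficient.\<close>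

lemma gram_independent:
  assumes b: "b \<in> {1..n} \<rightarrow> M" "gram_unitriangular n b"
    and c: "c \<in> {1..n} \<rightarrow> R" "lin_comb n c b = 0" and j: "j \<in> {1..n}"
  shows "c j = 0"
proof (rule ccontr)
  define S where "S = {j \<in> {1..n}. c j \<noteq> 0}"
  assume "c j \<noteq> 0"
  then have S: "finite S" "S \<noteq> {}" using j by (auto simp: S_def)
  define m where "m = Max S"
  have m: "m \<in> {1..n}" "c m \<noteq> 0" "\<And>i. i \<in> {1..n} \<Longrightarrow> i > m \<Longrightarrow> c i = 0"
    using Max_in[OF S] Max_ge[OF S(1)] unfolding m_def S_def by fastforce+
  have "0 = A (b m) (lin_comb n c b)"
    using A_0_right[of "b m"] b m c(2) by (auto simp: Pi_iff)
  also have "\<dots> = (\<Sum>i\<in>{1..n}. c i * A (b m) (b i))"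
    unfolding lin_comb_def using b c m
    by (subst A_sum_right) (auto intro!: M_scale sum.cong A_scale_right)
  also have "\<dots> = (\<Sum>i\<in>{1..n}. if i = m then c m else 0)"
  proof (rule sum.cong[OF HOL.refl])
    fix i assume "i \<in> {1..n}"
    then show "c i * A (b m) (b i) = (if i = m then c m else 0)"
      using m b(2) unfolding gram_unitriangular_def
      by (cases i m rule: linorder_cases) auto
  qed
  also have "\<dots> = c m" using m by simp
  finally show False using m by simp
qed

lemma exceptional_coeffs_unique:
  assumes b: "b \<in> exceptional n" and u: "u \<in> M"
  shows "\<exists>!c. c \<in> {1..n} \<rightarrow>\<^sub>E R \<and> u = lin_comb n c b"
proof -
  obtain c where c: "c \<in> {1..n} \<rightarrow> R" "u = lin_comb n c b"
    using b u by (auto simp: exceptional_def combs_def)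
  show ?thesis
  proof (rule ex1I[of _ "restrict c {1..n}"])
    show "restrict c {1..n} \<in> {1..n} \<rightarrow>\<^sub>E R \<and> u = lin_comb n (restrict c {1..n}) b"
      using c by (auto simp: lin_comb_def)
    fix d assume d: "d \<in> {1..n} \<rightarrow>\<^sub>E R \<and> u = lin_comb n d b"
    have "d j = c j" if j: "j \<in> {1..n}" for j
    proof -
      have "lin_comb n (\<lambda>j. d j - c j) b = 0"
        using c d by (simp add: lin_comb_def scale_left_diff_distrib sum_subtractf)
      moreover have "(\<lambda>j. d j - c j) \<in> {1..n} \<rightarrow> R"
      proof
        fix i assume "i \<in> {1..n}"
        then have "d i + - c i \<in> R" using c d by (intro R_add R_uminus) auto
        then show "d i - c i \<in> R" by simp
      qed
      ultimately have "d j - c j = 0"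
        using gram_independent[of b n "\<lambda>j. d j - c j" j] b j by (auto simp: exceptional_def)
      then show ?thesis by simp
    qed
    then show "d = restrict c {1..n}"
      using d by (auto simp: restrict_def fun_eq_iff PiE_def extensional_def)
  qed
qed

definition mutate :: "nat \<Rightarrow> (nat \<Rightarrow> 'm) \<Rightarrow> nat \<Rightarrow> 'm" where
  "mutate i b = b(i := b (i + 1) - A (b i) (b (i + 1)) \<cdot> b i, i + 1 := b i)"

text \<open>After the mutation \<open>(u, v) \<mapsto> (v - x u, u)\<close> with \<open>x = A u v\<close> the new pair has pairing \<open>- bar x\<close>,
  because \<open>A v u = 0\<close>. This is why the inverse mutation involves \<open>bar\<close>.\<close>

definition unmutate :: "nat \<Rightarrow> (nat \<Rightarrow> 'm) \<Rightarrow> nat \<Rightarrow> 'm" where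
  "unmutate i b = b(i := b (i + 1), i + 1 := b i - bar (A (b i) (b (i + 1))) \<cdot> b (i + 1))"

context
  fixes n i :: nat and b
  assumes i: "i \<in> {1..<n}" and b: "b \<in> exceptional n"
begin

private lemma b_in_M: "j \<in> {1..n} \<Longrightarrow> b j \<in> M"
  using b by (auto simp: exceptional_def)

private lemma pos: "Suc 0 \<le> i" "i \<le> n" "Suc i \<le> n"
  using i by auto

private lemma positions: "i \<in> {1..n}" "Suc i \<in> {1..n}"
  using pos by auto

private lemma gram:
  "j \<in> {1..n} \<Longrightarrow> A (b j) (b j) = 1"
  "j \<in> {1..n} \<Longrightarrow> k \<in> {1..n} \<Longrightarrow> k < j \<Longrightarrow> A (b j) (b k) = 0"
  using b by (auto simp: exceptional_def gram_unitriangular_def)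

private lemma A_in_R: "j \<in> {1..n} \<Longrightarrow> k \<in> {1..n} \<Longrightarrow> A (b j) (b k) \<in> R"
  by (simp add: A_closed b_in_M)

private lemmas basis_facts = b_in_M pos gram A_in_R

lemma exceptional_mutate: "mutate i b \<in> exceptional n"
proof -
  let ?b = "mutate i b" and ?x = "A (b i) (b (Suc i))"
  have "?b \<in> {1..n} \<rightarrow>\<^sub>E M"
    using b i by (auto simp: basis_facts mutate_def exceptional_def M_diff M_scale PiE_def extensional_def Pi_def)
  moreover have "M \<subseteq> combs n ?b"
  proof -
    have at: "?b i = b (Suc i) - ?x \<cdot> b i" "?b (Suc i) = b i"
      by (simp_all add: mutate_def)
    have "b (Suc i) = ?b i + ?x \<cdot> ?b (Suc i)" by (simp add: at)
    then have "b (Suc i) \<in> combs n ?b"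
      using combs_add combs_scale combs_base[of _ n ?b] A_in_R positions by metis
    moreover have "b i \<in> combs n ?b"
      using combs_base[of "Suc i" n ?b] at positions by metis
    moreover have "b j \<in> combs n ?b" if "j \<in> {1..n}" "j \<noteq> i" "j \<noteq> Suc i" for j
      using combs_base[of j n ?b] that by (simp add: mutate_def)
    ultimately have "combs n b \<subseteq> combs n ?b"
      by (intro combs_subset) metis
    then show ?thesis using b by (auto simp: exceptional_def)
  qed
  moreover have "gram_unitriangular n ?b"
    unfolding gram_unitriangular_def
  proof (intro conjI ballI impI)
    fix j assume j: "j \<in> {1..n}"
    show "A (?b j) (?b j) = 1"
      using j i by (auto simp: basis_facts mutate_def A_diff_left A_diff_right A_scale_left A_scale_right
        M_diff M_scale)
  next
    fix j k assume jk: "j \<in> {1..n}" "k \<in> {1..n}" "k < j"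
    then show "A (?b j) (?b k) = 0"
      using i by (auto simp: basis_facts mutate_def A_diff_left A_diff_right A_scale_left A_scale_right
        M_diff M_scale)
  qed
  ultimately show ?thesis by (simp add: exceptional_def)
qed

lemma exceptional_unmutate: "unmutate i b \<in> exceptional n"
proof -
  let ?b = "unmutate i b" and ?x = "bar (A (b i) (b (Suc i)))"
  have "?b \<in> {1..n} \<rightarrow>\<^sub>E M"
    using b i by (auto simp: basis_facts unmutate_def exceptional_def M_diff M_scale R_bar PiE_def extensional_def Pi_def)
  moreover have "M \<subseteq> combs n ?b"
  proof -
    have at: "?b (Suc i) = b i - ?x \<cdot> b (Suc i)" "?b i = b (Suc i)"
      by (simp_all add: unmutate_def)
    have "b i = ?b (Suc i) + ?x \<cdot> ?b i" by (simp add: at)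
    then have "b i \<in> combs n ?b"
      using combs_add combs_scale combs_base[of _ n ?b] A_in_R positions R_bar by metis
    moreover have "b (Suc i) \<in> combs n ?b"
      using combs_base[of "i" n ?b] at positions by metis
    moreover have "b j \<in> combs n ?b" if "j \<in> {1..n}" "j \<noteq> i" "j \<noteq> Suc i" for j
      using combs_base[of j n ?b] that by (simp add: unmutate_def)
    ultimately have "combs n b \<subseteq> combs n ?b"
      by (intro combs_subset) metis
    then show ?thesis using b by (auto simp: exceptional_def)
  qed
  moreover have "gram_unitriangular n ?b"
    unfolding gram_unitriangular_def
  proof (intro conjI ballI impI)
    fix j assume j: "j \<in> {1..n}"
    show "A (?b j) (?b j) = 1"
      using j i by (auto simp: basis_facts unmutate_def A_diff_left A_diff_right A_scale_left A_scale_right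
        M_diff M_scale R_bar bar_bar)
  next
    fix j k assume jk: "j \<in> {1..n}" "k \<in> {1..n}" "k < j"
    then show "A (?b j) (?b k) = 0"
      using i by (auto simp: basis_facts unmutate_def A_diff_left A_diff_right A_scale_left A_scale_right
        M_diff M_scale R_bar bar_bar)
  qed
  ultimately show ?thesis by (simp add: exceptional_def)
qed

lemma unmutate_mutate: "unmutate i (mutate i b) = b"
  by (rule ext)
     (simp add: basis_facts mutate_def unmutate_def A_diff_left A_scale_left M_scale M_diff bar_bar R_bar
       bar_uminus)

lemma mutate_unmutate: "mutate i (unmutate i b) = b"
  by (rule ext)
     (simp add: basis_facts mutate_def unmutate_def A_diff_right A_scale_right M_scale M_diff bar_bar R_bar)

text \<open>For a triple \<open>(u, v, w)\<close> with \<open>x = A u v\<close>, \<open>y = A v w\<close>, \<open>z = A u w\<close>, both sides are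
  \<open>(w - y v - (z - y x) u, v - x u, u)\<close>. The point is \<open>A (v - x u) (w - z u) = y\<close>, where
  the terms \<open>bar x * z\<close> cancel.\<close>

lemma mutate_braid:
  assumes "Suc i \<in> {1..<n}"
  shows "mutate i (mutate (Suc i) (mutate i b)) = mutate (Suc i) (mutate i (mutate (Suc i) b))"
proof -
  define u v w where "u = b i" and "v = b (Suc i)" and "w = b (Suc (Suc i))"
  have p: "Suc (Suc i) \<in> {1..n}" using assms by auto
  have M: "u \<in> M" "v \<in> M" "w \<in> M"
    using b_in_M[OF p] b_in_M[OF positions(1)] b_in_M[OF positions(2)] by (simp_all only: u_def v_def w_def)
  define x y z where "x = A u v" and "y = A v w" and "z = A u w"
  have R: "x \<in> R" "y \<in> R" "z \<in> R" using M by (simp_all add: x_def y_def z_def A_closed)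
  have u: "A u u = 1" "A v u = 0"
    using positions by (simp_all add: gram u_def v_def)
  have 1: "A (v - x \<cdot> u) (w - z \<cdot> u) = y"
    using M R u by (simp add: A_diff_left A_diff_right A_scale_left A_scale_right M_scale M_diff
        x_def[symmetric] y_def[symmetric] z_def[symmetric])
  have 2: "A u (w - y \<cdot> v) = z - y * x"
    using M R u by (simp add: A_diff_right A_scale_right M_scale x_def[symmetric] z_def[symmetric])
  have "w - z \<cdot> u - y \<cdot> (v - x \<cdot> u) = w - y \<cdot> v - (z - y * x) \<cdot> u"
    by (simp add: scale_right_diff_distrib scale_left_diff_distrib)
  then show ?thesis
    using 1 2 unfolding u_def v_def w_def x_def y_def z_def
    by (intro ext) (simp add: mutate_def)
qed

end

lemma mutate_far: "Suc i < j \<Longrightarrow> mutate i (mutate j b) = mutate j (mutate i b)"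
  by (rule ext) (simp add: mutate_def)

lemma bij_betw_mutate: "i \<in> {1..<n} \<Longrightarrow> bij_betw (mutate i) (exceptional n) (exceptional n)"
  by (rule bij_betw_byWitness[where f' = "unmutate i"])
     (auto simp: unmutate_mutate mutate_unmutate exceptional_mutate exceptional_unmutate)

text \<open>Mutations at positions of equal parity touch disjoint pairs of vectors.\<close>

lemma foldr_mutate_parity:
  assumes "distinct is" "\<forall>i\<in>set is. even i = e"
  shows "foldr mutate is b = (\<lambda>j. if j \<in> set is then b (j + 1) - A (b j) (b (j + 1)) \<cdot> b j
           else if j > 0 \<and> j - 1 \<in> set is then b (j - 1) else b j)"
  using assms
proof (induction "is")
  case Nil
  show ?case by simp
next
  case (Cons i "is")
  let ?F = "\<lambda>S j. if j \<in> S then b (j + 1) - A (b j) (b (j + 1)) \<cdot> b j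
      else if j > 0 \<and> j - 1 \<in> S then b (j - 1) else b j"
  have notin: "i \<notin> set is" "i + 1 \<notin> set is" "\<not> (i > 0 \<and> i - 1 \<in> set is)"
    using Cons.prems by (auto dest: bspec)
  have IH: "foldr mutate is b = ?F (set is)"
    using Cons.IH Cons.prems by auto
  have at: "?F (set is) i = b i" "?F (set is) (i + 1) = b (i + 1)"
    using notin by auto
  show ?case
  proof
    fix j
    have "foldr mutate (i # is) b j = mutate i (?F (set is)) j"
      by (simp only: foldr.simps o_apply IH)
    also have "\<dots> = ?F (set (i # is)) j"
    proof -
      consider "j = i" | "j = i + 1" | "j \<noteq> i" "j \<noteq> i + 1" by blast
      then show ?thesis
      proof cases
        case 1
        then show ?thesis unfolding mutate_def at using notin by auto
      next
        case 2
        then show ?thesis unfolding mutate_def at using notin by auto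
      next
        case 3
        then have "j \<in> set (i # is) \<longleftrightarrow> j \<in> set is"
          "j > 0 \<and> j - 1 \<in> set (i # is) \<longleftrightarrow> j > 0 \<and> j - 1 \<in> set is"
          by auto
        with 3 show ?thesis unfolding mutate_def by simp
      qed
    qed
    finally show "foldr mutate (i # is) b j = ?F (set (i # is)) j" .
  qed
qed

end

section \<open>The sesquilinear form\<close>

text \<open>Compare leading coefficients in the interpolation formula for \<open>X\<^sup>e\<close>.\<close>

lemma lagrange_leading_coeff:
  fixes x :: "'i \<Rightarrow> 'f::field"
  assumes "finite I" "inj_on x I" "e < card I"
  shows "(\<Sum>a\<in>I. x a ^ e / (\<Prod>j\<in>I - {a}. x a - x j)) = (if Suc e = card I then 1 else 0)"
proof -
  define L where "L a = (\<Prod>j\<in>I - {a}. [:- x j, 1:])" for a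
  define D where "D a = (\<Prod>j\<in>I - {a}. x a - x j)" for a
  define p where "p = (\<Sum>a\<in>I. Polynomial.smult (x a ^ e / D a) (L a))"
  have deg: "degree (L a) = card I - 1" "coeff (L a) (card I - 1) = 1" if "a \<in> I" for a
  proof -
    have "degree (\<Prod>j\<in>S. [:- x j, 1:]) = card S \<and> lead_coeff (\<Prod>j\<in>S. [:- x j, 1:]) = 1"
      if "finite S" for S
      using that
    proof induction
      case (insert j S)
      have "degree ([:- x j, 1:] * (\<Prod>j\<in>S. [:- x j, 1:])) = Suc (degree (\<Prod>j\<in>S. [:- x j, 1:]))"
        using insert.hyps by (subst degree_mult_eq) auto
      moreover have "coeff (\<Prod>j\<in>S. [:- x j, 1:]) (card S) = 1"
        using insert.IH by metis
      moreover from this have "lead_coeff ([:- x j, 1:] * (\<Prod>j\<in>S. [:- x j, 1:])) = 1"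
        using insert by (simp only: lead_coeff_mult) simp
      ultimately show ?case
        using insert.hyps insert.IH by (simp only: prod.insert card_insert_disjoint) simp
    qed simp
    from this[of "I - {a}"] show "degree (L a) = card I - 1" "coeff (L a) (card I - 1) = 1"
      using that assms unfolding L_def by (simp_all add: card_Diff_singleton) metis
  qed
  have D: "D a \<noteq> 0" if "a \<in> I" for a
    using that assms by (auto simp: D_def inj_on_def)
  have "p = monom 1 e"
  proof (rule poly_eqI_degree)
    fix y assume "y \<in> x ` I"
    then obtain b where b: "b \<in> I" "y = x b" by auto
    have "poly p y = (\<Sum>a\<in>I. if a = b then x b ^ e else 0)"
      unfolding p_def poly_sum
    proof (rule sum.cong[OF HOL.refl])
      fix a assume a: "a \<in> I"
      show "poly (Polynomial.smult (x a ^ e / D a) (L a)) y = (if a = b then x b ^ e else 0)"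
      proof (cases "a = b")
        case True
        then show ?thesis using D[OF a] by (simp add: L_def D_def poly_prod b)
      next
        case False
        then have "poly (L a) y = 0"
          unfolding L_def poly_prod using b a assms by (intro prod_zero) auto
        then show ?thesis using False by simp
      qed
    qed
    also have "\<dots> = poly (monom 1 e) y" using b assms by (simp add: poly_monom)
    finally show "poly p y = poly (monom 1 e) y" .
  next
    have card: "card (x ` I) = card I" using assms by (simp add: card_image)
    have "degree p \<le> card I - 1"
      unfolding p_def using assms deg
      by (intro degree_sum_le) (auto intro: order_trans[OF degree_smult_le])
    then show "degree p < card (x ` I)" using assms card by linarith
    show "degree (monom (1::'f) e) < card (x ` I)"
      using assms card by (simp add: degree_monom_eq)
  qed
  then have "coeff p (card I - 1) = (if Suc e = card I then 1 else 0)"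
    using assms by auto
  moreover have "coeff p (card I - 1) = (\<Sum>a\<in>I. x a ^ e / D a)"
    unfolding p_def coeff_sum using deg by (intro sum.cong) auto
  ultimately show ?thesis by (simp add: D_def)
qed

text \<open>A class of \<open>K\<close> is recorded by its values at the roots \<open>X = Z\<^sub>a\<close>; \<open>pvec n m\<close> is the
  class of \<open>X\<^sup>m\<^sup>-\<^sup>1\<close>.\<close>

definition pvec :: "nat \<Rightarrow> int \<Rightarrow> nat \<Rightarrow> laurent" where
  "pvec n m = (\<lambda>a. if a \<in> {1..n} then Zpow a (m - 1) else 0)"

definition vscale :: "laurent \<Rightarrow> (nat \<Rightarrow> laurent) \<Rightarrow> nat \<Rightarrow> laurent" where
  "vscale c u = (\<lambda>a. c * u a)"

definition Kvec :: "nat \<Rightarrow> (nat \<Rightarrow> laurent) set" where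
  "Kvec n = {\<Sum>m\<in>{1..n}. vscale (Q m) (pvec n (int m)) | Q. Q \<in> {1..n} \<rightarrow> Laurent n}"

definition root_denom :: "nat \<Rightarrow> nat \<Rightarrow> laurent" where
  "root_denom n a = (\<Prod>j\<in>{1..n} - {a}. 1 - Zpow j 1 * Zpow a (-1))"

text \<open>The form is a sum of fractions; sesquilinearity is checked for \<open>frac_form\<close> in the fraction
  field and then passes to its Laurent polynomial value \<open>laurent_form\<close>.\<close>

definition frac_form :: "nat \<Rightarrow> (nat \<Rightarrow> laurent) \<Rightarrow> (nat \<Rightarrow> laurent) \<Rightarrow> laurent fract" where
  "frac_form n u w = (\<Sum>a=1..n. to_fract (inv_Z (u a) * w a) / to_fract (root_denom n a))"

definition laurent_form :: "nat \<Rightarrow> (nat \<Rightarrow> laurent) \<Rightarrow> (nat \<Rightarrow> laurent) \<Rightarrow> laurent" where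
  "laurent_form n u w = (THE q. q \<in> Laurent n \<and> to_fract q = frac_form n u w)"

lemma sum_fun_apply: "(\<Sum>i\<in>I. f i) a = (\<Sum>i\<in>I. f i a)"
  for f :: "'i \<Rightarrow> 'b \<Rightarrow> 'c::comm_monoid_add"
  by (induction I rule: infinite_finite_induct) simp_all

interpretation vscale: Modules.module vscale
  by standard (simp_all add: vscale_def fun_eq_iff distrib_left distrib_right mult.assoc)

lemma A_rep_eq_laurent_form: "A_rep n f g = laurent_form n (subst_X f) (subst_X g)"
  by (simp add: A_rep_def laurent_form_def frac_form_def root_denom_def Fract_conv_to_fract)

lemma to_fract_sum: "to_fract (\<Sum>i\<in>I. f i) = (\<Sum>i\<in>I. to_fract (f i))"
  by (induction I rule: infinite_finite_induct) simp_all

lemma to_fract_prod: "to_fract (\<Prod>i\<in>I. f i) = (\<Prod>i\<in>I. to_fract (f i))"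
  by (induction I rule: infinite_finite_induct) simp_all

lemma laurent_form_eqI: "q \<in> Laurent n \<Longrightarrow> to_fract q = frac_form n u w \<Longrightarrow> laurent_form n u w = q"
  unfolding laurent_form_def by (rule the_equality) (auto, metis to_fract_eq_iff)

lemma frac_form_add_left: "frac_form n (u + u') w = frac_form n u w + frac_form n u' w"
  by (simp add: frac_form_def inv_Z_add distrib_right add_divide_distrib sum.distrib)

lemma frac_form_add_right: "frac_form n u (w + w') = frac_form n u w + frac_form n u w'"
  by (simp add: frac_form_def distrib_left add_divide_distrib sum.distrib)

lemma frac_form_scale_left: "frac_form n (vscale c u) w = to_fract (inv_Z c) * frac_form n u w"
  by (simp add: frac_form_def vscale_def inv_Z_mult sum_distrib_left mult_ac)

lemma frac_form_scale_right: "frac_form n u (vscale c w) = to_fract c * frac_form n u w"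
  by (simp add: frac_form_def vscale_def sum_distrib_left mult_ac)

lemma frac_form_zero_left: "frac_form n 0 w = 0" and frac_form_zero_right: "frac_form n u 0 = 0"
  by (simp_all add: frac_form_def)

lemma frac_form_sum_left: "frac_form n (\<Sum>i\<in>I. f i) w = (\<Sum>i\<in>I. frac_form n (f i) w)"
  by (induction I rule: infinite_finite_induct) (simp_all only: sum.infinite sum.empty sum.insert HOL.simp_thms frac_form_add_left frac_form_zero_left)

lemma frac_form_sum_right: "frac_form n u (\<Sum>i\<in>I. f i) = (\<Sum>i\<in>I. frac_form n u (f i))"
  by (induction I rule: infinite_finite_induct) (simp_all only: sum.infinite sum.empty sum.insert HOL.simp_thms frac_form_add_right frac_form_zero_right)

text \<open>The value of the form on \<open>(X\<^sup>i, X\<^sup>j)\<close> with \<open>d = j - i\<close>.\<close>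

definition root_sum :: "nat \<Rightarrow> int \<Rightarrow> laurent fract" where
  "root_sum n d = (\<Sum>a=1..n. to_fract (Zpow a d) / to_fract (root_denom n a))"

lemma frac_form_pvec: "frac_form n (pvec n i) (pvec n j) = root_sum n (j - i)"
  unfolding frac_form_def root_sum_def
proof (intro sum.cong HOL.refl)
  fix a assume "a \<in> {1..n}"
  moreover have "- (i - 1) + (j - 1) = j - i" by simp
  ultimately show "to_fract (inv_Z (pvec n i a) * pvec n j a) / to_fract (root_denom n a) =
      to_fract (Zpow a (j - i)) / to_fract (root_denom n a)"
    by (simp only: pvec_def inv_Z_Zpow if_True Zpow_add[symmetric])
qed

lemma to_fract_Zpow_nat: "to_fract (Zpow a (int k)) = to_fract (Zpow a 1) ^ k"
proof (induction k)
  case (Suc k)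
  have "Zpow a (int (Suc k)) = Zpow a 1 * Zpow a (int k)"
    by (simp only: Zpow_add of_nat_Suc)
  with Suc show ?case by simp
qed simp

lemma root_denom_eq:
  assumes "a \<in> {1..n}"
  shows "to_fract (root_denom n a) * to_fract (Zpow a (int n - 1)) =
         (\<Prod>j\<in>{1..n} - {a}. to_fract (Zpow a 1) - to_fract (Zpow j 1))"
proof -
  have inv: "Zpow a (-1) * Zpow a 1 = 1"
    unfolding Zpow_add[symmetric] by simp
  have "to_fract (Zpow a 1) - to_fract (Zpow j 1) =
      to_fract (1 - Zpow j 1 * Zpow a (-1)) * to_fract (Zpow a 1)" for j
    unfolding to_fract_mult[symmetric] to_fract_diff[symmetric] left_diff_distrib mult.assoc inv
    by simp
  then have "(\<Prod>j\<in>{1..n} - {a}. to_fract (Zpow a 1) - to_fract (Zpow j 1)) =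
        to_fract (root_denom n a) * (\<Prod>j\<in>{1..n} - {a}. to_fract (Zpow a 1))"
    unfolding root_denom_def to_fract_prod by (simp only: prod.distrib)
  also have "(\<Prod>j\<in>{1..n} - {a}. to_fract (Zpow a 1)) = to_fract (Zpow a (int (n - 1)))"
    using assms unfolding to_fract_Zpow_nat by simp
  also have "int (n - 1) = int n - 1"
    using assms by auto
  finally show ?thesis by (rule HOL.sym)
qed

text \<open>Since \<open>1 - Z\<^sub>j / Z\<^sub>a = (Z\<^sub>a - Z\<^sub>j) / Z\<^sub>a\<close>, this is the interpolation identity with exponent
  \<open>e = d + n - 1\<close>, which lies in the range \<open>0 \<le> e < n\<close>.\<close>

lemma root_sum_small:
  assumes "- int n < d" "d \<le> 0"
  shows "root_sum n d = (if d = 0 then 1 else 0)"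
proof -
  define e where "e = nat (d + int n - 1)"
  define x where "x a = to_fract (Zpow a 1)" for a
  have e: "int e = d + int n - 1" "e < n"
    using assms by (auto simp: e_def)
  have inj: "inj_on x {1..n}"
    by (auto simp: inj_on_def x_def Zpow_eq_iff)
  have "root_sum n d = (\<Sum>a\<in>{1..n}. x a ^ e / (\<Prod>j\<in>{1..n} - {a}. x a - x j))"
    unfolding root_sum_def
  proof (intro sum.cong HOL.refl)
    fix a assume a: "a \<in> {1..n}"
    have "x a ^ e = to_fract (Zpow a d) * to_fract (Zpow a (int n - 1))"
      unfolding x_def to_fract_Zpow_nat[symmetric] to_fract_mult[symmetric] Zpow_add[symmetric]
      by (simp only: e add_diff_eq)
    then show "to_fract (Zpow a d) / to_fract (root_denom n a) =
        x a ^ e / (\<Prod>j\<in>{1..n} - {a}. x a - x j)"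
      unfolding x_def root_denom_eq[OF a, symmetric] by (simp add: Zpow_nonzero)
  qed
  also have "\<dots> = (if Suc e = card {1..n} then 1 else 0)"
    by (rule lagrange_leading_coeff) (use inj e in auto)
  finally show ?thesis using e by (auto split: if_splits)
qed

lemma root_sum_recurrence: "(\<Sum>i=0..n. to_fract ((-1) ^ i * elem_sym n i) * root_sum n (d - int i)) = 0"
proof -
  define t where "t i a = to_fract ((-1) ^ i * elem_sym n i * Zpow a (d - int i)) / to_fract (root_denom n a)"
    for i a
  have "to_fract ((-1) ^ i * elem_sym n i) * root_sum n (d - int i) = (\<Sum>a=1..n. t i a)" for i
    unfolding root_sum_def t_def sum_distrib_left to_fract_mult times_divide_eq_right
    by (rule HOL.refl)
  then have "(\<Sum>i=0..n. to_fract ((-1) ^ i * elem_sym n i) * root_sum n (d - int i)) =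
      (\<Sum>i=0..n. \<Sum>a=1..n. t i a)"
    by (simp only:)
  also have "\<dots> = (\<Sum>a=1..n. \<Sum>i=0..n. t i a)"
    by (rule sum.swap)
  also have "\<dots> = 0"
  proof (rule sum.neutral, rule ballI)
    fix a assume a: "a \<in> {1..n}"
    show "(\<Sum>i=0..n. t i a) = 0"
      unfolding t_def sum_divide_distrib[symmetric] to_fract_sum[symmetric] elem_sym_root[OF a]
      by simp
  qed
  finally show ?thesis .
qed

text \<open>The recurrence has leading coefficient \<open>1\<close>, so it propagates integrality upwards from the
  initial values \<open>0\<close> and \<open>1\<close>.\<close>

lemma root_sum_Laurent:
  assumes "- int n < d"
  shows "\<exists>q\<in>Laurent n. to_fract q = root_sum n d"
  using assms
proof (induction "nat (d + int n)" arbitrary: d rule: less_induct)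
  case less
  show ?case
  proof (cases "d \<le> 0")
    case True
    then show ?thesis
      using root_sum_small[OF less.prems] by (auto intro: bexI[of _ 1] bexI[of _ 0])
  next
    case False
    have "\<forall>i\<in>{1..n}. \<exists>q\<in>Laurent n. to_fract q = root_sum n (d - int i)"
      using less.prems False by (intro ballI less.hyps) auto
    then obtain q where q: "\<And>i. i \<in> {1..n} \<Longrightarrow> q i \<in> Laurent n \<and> to_fract (q i) = root_sum n (d - int i)"
      by metis
    let ?r = "- (\<Sum>i=1..n. (-1) ^ i * elem_sym n i * q i)"
    have "0 = root_sum n d + (\<Sum>i=1..n. to_fract ((-1) ^ i * elem_sym n i) * root_sum n (d - int i))"
      using root_sum_recurrence[of n d] by (simp add: sum.atLeast_Suc_atMost del: to_fract_mult)
    also have "(\<Sum>i=1..n. to_fract ((-1) ^ i * elem_sym n i) * root_sum n (d - int i)) = - to_fract ?r"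
      using q by (simp add: to_fract_sum)
    finally have "to_fract ?r = root_sum n d" by (simp only: ab_group_add_class.ab_diff_conv_add_uminus[symmetric] eq_commute[of 0] right_minus_eq)
    moreover have "?r \<in> Laurent n"
      using q by (intro Laurent_uminus Laurent_sum Laurent_mult Laurent_power elem_sym_in_Laurent) auto
    ultimately show ?thesis by blast
  qed
qed

lemma Kvec_form_Laurent:
  assumes "u \<in> Kvec n" "w \<in> Kvec n"
  shows "\<exists>q\<in>Laurent n. to_fract q = frac_form n u w"
proof -
  obtain P Q where PQ: "P \<in> {1..n} \<rightarrow> Laurent n" "u = (\<Sum>m\<in>{1..n}. vscale (P m) (pvec n (int m)))"
    "Q \<in> {1..n} \<rightarrow> Laurent n" "w = (\<Sum>m\<in>{1..n}. vscale (Q m) (pvec n (int m)))"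
    using assms by (auto simp: Kvec_def)
  have "\<forall>i\<in>{1..n}. \<forall>j\<in>{1..n}. \<exists>q\<in>Laurent n. to_fract q = root_sum n (int j - int i)"
    by (intro ballI root_sum_Laurent) auto
  then obtain q where q: "\<And>i j. i \<in> {1..n} \<Longrightarrow> j \<in> {1..n} \<Longrightarrow>
      q i j \<in> Laurent n \<and> to_fract (q i j) = root_sum n (int j - int i)"
    by metis
  let ?r = "\<Sum>i\<in>{1..n}. \<Sum>j\<in>{1..n}. inv_Z (P i) * (Q j * q i j)"
  have "to_fract ?r = frac_form n u w"
    using q by (simp add: PQ(2,4) frac_form_sum_left frac_form_sum_right frac_form_scale_left
        frac_form_scale_right frac_form_pvec to_fract_sum sum_distrib_left mult.left_commute) (rule sum.swap)
  moreover have "?r \<in> Laurent n"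
    using PQ q by (intro Laurent_sum Laurent_mult inv_Z_in_Laurent) auto
  ultimately show ?thesis by blast
qed

lemma
  assumes "u \<in> Kvec n" "w \<in> Kvec n"
  shows laurent_form_in_Laurent: "laurent_form n u w \<in> Laurent n"
    and to_fract_laurent_form: "to_fract (laurent_form n u w) = frac_form n u w"
  using Kvec_form_Laurent[OF assms] laurent_form_eqI[of _ n u w] by auto

lemma inv_Z_inv_Z: "inv_Z (inv_Z f) = f"
proof -
  have "inv_into UNIV (uminus :: (nat \<Rightarrow>\<^sub>0 int) \<Rightarrow> _) = uminus"
    by (rule inv_unique_comp) auto
  then show ?thesis
  by (induction f rule: poly_mapping_add_induct)
     (simp_all add: inv_Z_add, simp add: inv_Z_def map_key_single_bij[OF bij_uminus_exponent])
qed

lemma Kvec_0: "0 \<in> Kvec n"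
  unfolding Kvec_def by (intro CollectI exI[of _ "\<lambda>_. 0"]) simp

lemma Kvec_add: 
  assumes "u \<in> Kvec n" "w \<in> Kvec n"
  shows "u + w \<in> Kvec n"
proof -
  obtain P Q where PQ: "P \<in> {1..n} \<rightarrow> Laurent n" "u = (\<Sum>m\<in>{1..n}. vscale (P m) (pvec n (int m)))"
    "Q \<in> {1..n} \<rightarrow> Laurent n" "w = (\<Sum>m\<in>{1..n}. vscale (Q m) (pvec n (int m)))"
    using assms by (auto simp: Kvec_def)
  have "u + w = (\<Sum>m\<in>{1..n}. vscale (P m + Q m) (pvec n (int m)))"
    by (simp add: PQ vscale.scale_left_distrib sum.distrib)
  moreover have "(\<lambda>m. P m + Q m) \<in> {1..n} \<rightarrow> Laurent n"
    using PQ by (auto intro: Laurent_add)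
  ultimately show ?thesis by (auto simp: Kvec_def)
qed

lemma Kvec_scale:
  assumes "u \<in> Kvec n" "c \<in> Laurent n"
  shows "vscale c u \<in> Kvec n"
proof -
  obtain P where P: "P \<in> {1..n} \<rightarrow> Laurent n" "u = (\<Sum>m\<in>{1..n}. vscale (P m) (pvec n (int m)))"
    using assms by (auto simp: Kvec_def)
  have "vscale c u = (\<Sum>m\<in>{1..n}. vscale (c * P m) (pvec n (int m)))"
    by (simp add: P vscale.scale_sum_right)
  moreover have "(\<lambda>m. c * P m) \<in> {1..n} \<rightarrow> Laurent n"
    using P assms by (auto intro: Laurent_mult)
  ultimately show ?thesis by (auto simp: Kvec_def)
qed

lemma sesquilinear_Kvec: "sesquilinear_module vscale (Laurent n) inv_Z (Kvec n) (laurent_form n)"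
proof unfold_locales
  fix u u' w w' c
  assume u: "u \<in> Kvec n" and w: "w \<in> Kvec n"
  show "laurent_form n (u + u') w = laurent_form n u w + laurent_form n u' w" if "u' \<in> Kvec n"
    using that u w by (intro laurent_form_eqI Laurent_add)
      (simp_all add: laurent_form_in_Laurent to_fract_laurent_form frac_form_add_left)
  show "laurent_form n u (w + w') = laurent_form n u w + laurent_form n u w'" if "w' \<in> Kvec n"
    using that u w by (intro laurent_form_eqI Laurent_add)
      (simp_all add: laurent_form_in_Laurent to_fract_laurent_form frac_form_add_right)
  show "laurent_form n (vscale c u) w = inv_Z c * laurent_form n u w" if "c \<in> Laurent n"
    using that u w by (intro laurent_form_eqI Laurent_mult inv_Z_in_Laurent)
      (simp_all add: laurent_form_in_Laurent to_fract_laurent_form frac_form_scale_left)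
  show "laurent_form n u (vscale c w) = c * laurent_form n u w" if "c \<in> Laurent n"
    using that u w by (intro laurent_form_eqI Laurent_mult)
      (simp_all add: laurent_form_in_Laurent to_fract_laurent_form frac_form_scale_right)
qed (simp_all add: Laurent_add Laurent_mult Laurent_uminus inv_Z_in_Laurent inv_Z_uminus inv_Z_inv_Z
      Kvec_0 Kvec_add Kvec_scale laurent_form_in_Laurent)

lemma pvec_recurrence: "(\<Sum>i=0..n. vscale ((-1) ^ i * elem_sym n i) (pvec n (m - int i))) = 0"
proof
  fix a
  have "(\<Sum>i=0..n. (-1) ^ i * elem_sym n i * Zpow a (m - 1 - int i)) = 0" if "a \<in> {1..n}"
    using that by (rule elem_sym_root)
  moreover have "m - int i - 1 = m - 1 - int i" for i by simp
  ultimately show "(\<Sum>i=0..n. vscale ((-1) ^ i * elem_sym n i) (pvec n (m - int i))) a = 0 a"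
    by (cases "a \<in> {1..n}") (simp_all only: sum_fun_apply vscale_def pvec_def zero_fun_apply if_True if_False mult_zero_right sum.neutral_const)
qed

text \<open>Solving the recurrence for its first or its last term moves any window of \<open>n\<close>
  consecutive powers up or down; the last coefficient is \<open>\<plusminus>s\<^sub>n\<close>, a unit.\<close>

lemma pvec_window_generates:
  assumes S0: "0 \<in> S" and Sadd: "\<And>u w. u \<in> S \<Longrightarrow> w \<in> S \<Longrightarrow> u + w \<in> S"
    and Sscale: "\<And>c u. c \<in> Laurent n \<Longrightarrow> u \<in> S \<Longrightarrow> vscale c u \<in> S"
    and win: "\<And>j. j \<in> {1..n} \<Longrightarrow> pvec n (k + int j) \<in> S" and n: "n \<ge> 1"
  shows "pvec n m \<in> S"
proof -
  have sum: "(\<Sum>i\<in>I. vscale (c i) (f i)) \<in> S" 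
    if "\<And>i. i \<in> I \<Longrightarrow> c i \<in> Laurent n" "\<And>i. i \<in> I \<Longrightarrow> f i \<in> S" for I :: "nat set" and c f
    using that by (induction I rule: infinite_finite_induct) (simp_all add: S0 Sadd Sscale)
  have coeff: "(-1) ^ i * elem_sym n i \<in> Laurent n" for i
    by (intro Laurent_mult Laurent_power Laurent_uminus Laurent_1 elem_sym_in_Laurent)
  have neg: "- u \<in> S" if "u \<in> S" for u
    using Sscale[of "-1" u] that Laurent_uminus[OF Laurent_1] by simp
  have up: "pvec n (k' + int j) \<in> S" if win: "\<And>j. j \<in> {1..n} \<Longrightarrow> pvec n (k' + int j) \<in> S" for k' j
  proof (induction j rule: less_induct)
    case (less j)
    consider "j \<in> {1..n}" | "j = 0" | "j > n" by force
    then show ?case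
    proof cases
      case 2
      have "0 = (\<Sum>i=0..n. vscale ((-1) ^ i * elem_sym n i) (pvec n (k' + int n - int i)))"
        by (rule pvec_recurrence[symmetric])
      also have "\<dots> = (\<Sum>i\<in>{0..<n}. vscale ((-1) ^ i * elem_sym n i) (pvec n (k' + int n - int i)))
          + vscale ((-1) ^ n * elem_sym n n) (pvec n k')"
        by (simp add: sum.last_plus atLeast0AtMost lessThan_Suc_atMost[symmetric] atLeast0LessThan)
      finally have eq: "vscale ((-1) ^ n * elem_sym n n) (pvec n k') =
        - (\<Sum>i\<in>{0..<n}. vscale ((-1) ^ i * elem_sym n i) (pvec n (k' + int n - int i)))"
        by (simp add: eq_neg_iff_add_eq_0 add.commute)
      have "(\<Sum>i\<in>{0..<n}. vscale ((-1) ^ i * elem_sym n i) (pvec n (k' + int n - int i))) \<in> S"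
      proof (rule sum[OF coeff])
        fix i assume i: "i \<in> {0..<n}"
        then show "pvec n (k' + int n - int i) \<in> S"
          using win[of "n - i"] by (simp add: of_nat_diff algebra_simps)
      qed
      with eq have *: "vscale ((-1) ^ n * elem_sym n n) (pvec n k') \<in> S"
        using neg by simp
      have "vscale ((-1) ^ n * inv_Z (elem_sym n n)) (vscale ((-1) ^ n * elem_sym n n) (pvec n k')) \<in> S"
        by (rule Sscale[OF _ *]) (intro Laurent_mult Laurent_power Laurent_uminus Laurent_1
            inv_Z_in_Laurent elem_sym_in_Laurent)
      moreover have "(-1) ^ n * inv_Z (elem_sym n n) * ((-1) ^ n * elem_sym n n) = 1"
      proof -
        have "(-1) ^ n * inv_Z (elem_sym n n) * ((-1) ^ n * elem_sym n n) =
              ((-1) ^ n * (-1) ^ n) * (inv_Z (elem_sym n n) * elem_sym n n)"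
          by (simp only: mult_ac)
        then show ?thesis by (simp add: inv_Z_elem_sym_top flip: power_mult_distrib)
      qed
      ultimately have "pvec n k' \<in> S" by (metis vscale.scale_scale vscale.scale_one)
      then show ?thesis using 2 by simp
    next
      case 3
      have "0 = pvec n (k' + int j) + (\<Sum>i\<in>{1..n}. vscale ((-1) ^ i * elem_sym n i) (pvec n (k' + int j - int i)))"
        using pvec_recurrence[of n "k' + int j"] by (simp add: sum.atLeast_Suc_atMost)
      then have eq: "pvec n (k' + int j) = - (\<Sum>i\<in>{1..n}. vscale ((-1) ^ i * elem_sym n i) (pvec n (k' + int j - int i)))"
        by (simp add: eq_neg_iff_add_eq_0)
      have "(\<Sum>i\<in>{1..n}. vscale ((-1) ^ i * elem_sym n i) (pvec n (k' + int j - int i))) \<in> S"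
      proof (rule sum[OF coeff])
        fix i assume i: "i \<in> {1..n}"
        then show "pvec n (k' + int j - int i) \<in> S"
          using less[of "j - i"] 3 by (simp add: of_nat_diff algebra_simps)
      qed
      then show ?thesis unfolding eq by (rule neg)
    qed (rule win)
  qed
  have down: "pvec n (k - int d + int j) \<in> S" if "j \<in> {1..n}" for d j
    using that
  proof (induction d arbitrary: j)
    case 0
    then show ?case using win by simp
  next
    case (Suc d)
    then show ?case
      using up[of "k - int d" "j - 1"] by (simp add: of_nat_diff algebra_simps)
  qed
  show ?thesis
  proof (cases "m \<ge> k")
    case True
    then show ?thesis using up[OF win, of "nat (m - k)"] by simp
  next
    case False
    then show ?thesis using up[OF down, of "nat (k - m)" 0] by simp
  qed
qed

section \<open>The two bases and the mutations between them\<close>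

interpretation K: sesquilinear_module vscale "Laurent n" inv_Z "Kvec n" "laurent_form n" for n
  by (rule sesquilinear_Kvec)

lemma pvec_in_Kvec: "n \<ge> 1 \<Longrightarrow> pvec n m \<in> Kvec n"
proof (rule pvec_window_generates[where k = 0])
  fix j assume j: "j \<in> {1..n}"
  have "pvec n (int j) = (\<Sum>m\<in>{1..n}. vscale (if m = j then 1 else 0) (pvec n (int m)))"
    using j by (subst sum.remove[of _ j]) auto
  moreover have "(\<lambda>m. if m = j then 1 else 0) \<in> {1..n} \<rightarrow> Laurent n" by auto
  ultimately show "pvec n (0 + int j) \<in> Kvec n"
    unfolding Kvec_def add_0
    by (intro CollectI exI[of _ "\<lambda>m. if m = j then 1 else 0"] conjI)
qed (simp_all add: Kvec_0 Kvec_add Kvec_scale)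

definition power_form :: "nat \<Rightarrow> int \<Rightarrow> laurent" where
  "power_form n d = laurent_form n (pvec n 0) (pvec n d)"

lemma laurent_form_pvec: "laurent_form n (pvec n i) (pvec n j) = power_form n (j - i)"
  by (simp add: power_form_def laurent_form_def frac_form_pvec)

lemma to_fract_power_form: "n \<ge> 1 \<Longrightarrow> to_fract (power_form n d) = root_sum n d"
  by (simp add: power_form_def to_fract_laurent_form pvec_in_Kvec frac_form_pvec)

lemma power_form_0: "n \<ge> 1 \<Longrightarrow> power_form n 0 = 1"
  using to_fract_power_form[of n 0] root_sum_small[of n 0]
  by (intro iffD1[OF to_fract_eq_iff[of "power_form n 0" 1]]) simp

lemma power_form_neg: "n \<ge> 1 \<Longrightarrow> - int n < d \<Longrightarrow> d < 0 \<Longrightarrow> power_form n d = 0"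
  using to_fract_power_form[of n d] root_sum_small[of n d]
  by (intro iffD1[OF to_fract_eq_0_iff[of "power_form n d"]]) simp

lemma power_form_recurrence:
  assumes "0 < d" "d < n"
  shows "(\<Sum>i=0..d. (-1) ^ i * elem_sym n i * power_form n (int d - int i)) = 0"
proof -
  have n: "n \<ge> 1" using assms by simp
  have "to_fract (\<Sum>i=0..n. (-1) ^ i * elem_sym n i * power_form n (int d - int i)) = 0"
    unfolding to_fract_sum using root_sum_recurrence[of n "int d"]
    by (simp only: to_fract_mult to_fract_power_form[OF n])
  then have "0 = (\<Sum>i=0..n. (-1) ^ i * elem_sym n i * power_form n (int d - int i))"
    by (simp only: to_fract_eq_0_iff)
  also have "\<dots> = (\<Sum>i=0..d. (-1) ^ i * elem_sym n i * power_form n (int d - int i))"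
    using assms n by (intro sum.mono_neutral_right) (auto intro!: power_form_neg)
  finally show ?thesis by (rule HOL.sym)
qed

text \<open>The class corresponding to \<open>v\<^sub>m(l)\<close>.\<close>

definition tvec :: "nat \<Rightarrow> int \<Rightarrow> nat \<Rightarrow> nat \<Rightarrow> nat \<Rightarrow> laurent" where
  "tvec n k m l = (\<Sum>i\<in>{0..m - l}. vscale ((-1) ^ i * elem_sym n i) (pvec n (k + int (m - i))))"

lemma sign_elem_sym_in_Laurent: "(-1) ^ i * elem_sym n i' \<in> Laurent n"
  by (intro Laurent_mult Laurent_power Laurent_uminus Laurent_1 elem_sym_in_Laurent)

lemma tvec_self: "tvec n k m m = pvec n (k + int m)"
  by (simp add: tvec_def)

lemma tvec_in_Kvec: "n \<ge> 1 \<Longrightarrow> tvec n k m l \<in> Kvec n"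
  unfolding tvec_def by (intro K.M_sum Kvec_scale pvec_in_Kvec sign_elem_sym_in_Laurent)

lemma tvec_extend:
  assumes "1 \<le> l" "l \<le> m"
  shows "tvec n k m (l - 1) = tvec n k m l +
    vscale ((-1) ^ (m - l + 1) * elem_sym n (m - l + 1)) (pvec n (k + int (l - 1)))"
proof -
  have *: "m - (l - 1) = Suc (m - l)" "m - Suc (m - l) = l - 1" using assms by auto
  then show ?thesis by (simp add: tvec_def)
qed

lemma tvec_shift:
  assumes "1 \<le> l" "l \<le> m"
  shows "tvec n (k - 1) (m + 1) (l + 1) = tvec n k m l"
  unfolding tvec_def
proof (rule sum.cong)
  fix i assume "i \<in> {0..m - l}"
  then have "i \<le> m" using assms by simp
  then have "k - 1 + int (m + 1 - i) = k + int (m - i)" by linarith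
  then show "vscale ((- 1) ^ i * elem_sym n i) (pvec n (k - 1 + int (m + 1 - i))) =
    vscale ((- 1) ^ i * elem_sym n i) (pvec n (k + int (m - i)))" by (simp only:)
qed simp

context
  fixes n :: nat and k :: int
  assumes n: "n \<ge> 1"
begin

text \<open>If \<open>w\<close> is orthogonal to all lower terms of \<open>v\<^sub>m(l)\<close>, only the leading term \<open>v\<^sub>m\<close> is seen.\<close>

lemma form_tvec_left:
  assumes "w \<in> Kvec n" "l \<le> m"
    and "\<And>p. l \<le> p \<Longrightarrow> p < m \<Longrightarrow> laurent_form n (pvec n (k + int p)) w = 0"
  shows "laurent_form n (tvec n k m l) w = laurent_form n (pvec n (k + int m)) w"
proof -
  have "laurent_form n (tvec n k m l) w =
      (\<Sum>i\<in>{0..m - l}. inv_Z ((-1) ^ i * elem_sym n i) * laurent_form n (pvec n (k + int (m - i))) w)"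
    unfolding tvec_def
    by (rule K.A_lincomb_left[OF sign_elem_sym_in_Laurent pvec_in_Kvec[OF n] assms(1)])
  also have "\<dots> = (\<Sum>i\<in>{0..m - l}. if i = 0 then laurent_form n (pvec n (k + int m)) w else 0)"
  proof (rule sum.cong[OF HOL.refl])
    fix i assume i: "i \<in> {0..m - l}"
    show "inv_Z ((-1) ^ i * elem_sym n i) * laurent_form n (pvec n (k + int (m - i))) w =
      (if i = 0 then laurent_form n (pvec n (k + int m)) w else 0)"
      using i assms(2) assms(3)[of "m - i"] by (cases "i = 0") auto
  qed
  also have "\<dots> = laurent_form n (pvec n (k + int m)) w" by simp
  finally show ?thesis .
qed

lemma form_tvec_right_raw:
  assumes "l \<le> m"
  shows "laurent_form n (pvec n (k + int j)) (tvec n k m l) =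
    (\<Sum>i\<in>{0..m - l}. (-1) ^ i * elem_sym n i * power_form n (int m - int j - int i))"
proof -
  have "laurent_form n (pvec n (k + int j)) (tvec n k m l) =
      (\<Sum>i\<in>{0..m - l}. (-1) ^ i * elem_sym n i * laurent_form n (pvec n (k + int j)) (pvec n (k + int (m - i))))"
    unfolding tvec_def
    by (rule K.A_lincomb_right[OF sign_elem_sym_in_Laurent pvec_in_Kvec[OF n] pvec_in_Kvec[OF n]])
  also have "\<dots> = (\<Sum>i\<in>{0..m - l}. (-1) ^ i * elem_sym n i * power_form n (int m - int j - int i))"
  proof (rule sum.cong[OF HOL.refl])
    fix i assume "i \<in> {0..m - l}"
    then have "k + int (m - i) - (k + int j) = int m - int j - int i"
      using assms by (simp add: of_nat_diff)
    then show "(-1) ^ i * elem_sym n i * laurent_form n (pvec n (k + int j)) (pvec n (k + int (m - i))) =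
      (-1) ^ i * elem_sym n i * power_form n (int m - int j - int i)"
      by (simp only: laurent_form_pvec)
  qed
  finally show ?thesis .
qed

text \<open>The terms \<open>v\<^sub>p\<close> of \<open>v\<^sub>m(l)\<close> with \<open>p < j\<close> pair to zero with \<open>v\<^sub>j\<close>, so that for \<open>l \<le> j\<close> the
  truncation at \<open>l\<close> cannot be noticed and the recurrence applies.\<close>

lemma form_pvec_tvec:
  assumes "1 \<le> l" "l \<le> j" "j \<le> m" "m \<le> n"
  shows "laurent_form n (pvec n (k + int j)) (tvec n k m l) = (if j = m then 1 else 0)"
proof -
  have "laurent_form n (pvec n (k + int j)) (tvec n k m l) =
      (\<Sum>i\<in>{0..m - l}. (-1) ^ i * elem_sym n i * power_form n (int m - int j - int i))"
    using assms by (intro form_tvec_right_raw) auto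
  also have "\<dots> = (\<Sum>i\<in>{0..m - j}. (-1) ^ i * elem_sym n i * power_form n (int m - int j - int i))"
    using assms n by (intro sum.mono_neutral_right) (auto intro!: power_form_neg)
  also have "int m - int j = int (m - j)"
    using assms by simp
  also have "(\<Sum>i\<in>{0..m - j}. (-1) ^ i * elem_sym n i * power_form n (int (m - j) - int i)) =
      (if j = m then 1 else 0)"
  proof (cases "j = m")
    case True
    then show ?thesis by (simp add: power_form_0[OF n])
  next
    case False
    then have "0 < m - j" "m - j < n" using assms by simp_all
    from power_form_recurrence[OF this] False show ?thesis by (simp only: if_False)
  qed
  finally show ?thesis .
qed

text \<open>Here the truncation omits exactly one nonzero term of the recurrence, namely that of
  \<open>v\<^sub>l\<^sub>-\<^sub>1\<close>.\<close>

lemma form_pvec_tvec_pred: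
  assumes "2 \<le> l" "l \<le> m" "m \<le> n"
  shows "laurent_form n (pvec n (k + int (l - 1))) (tvec n k m l) =
    - ((-1) ^ (m - l + 1) * elem_sym n (m - l + 1))"
proof -
  let ?t = "\<lambda>i. (-1) ^ i * elem_sym n i * power_form n (int (m - l + 1) - int i)"
  have "int m - int (l - 1) = int (m - l + 1)" using assms by simp
  with form_tvec_right_raw[OF assms(2), of "l - 1"]
  have 1: "laurent_form n (pvec n (k + int (l - 1))) (tvec n k m l) = (\<Sum>i\<in>{0..m - l}. ?t i)"
    by (simp only:)
  have d: "0 < m - l + 1" "m - l + 1 < n" using assms by simp_all
  have 2: "(\<Sum>i\<in>{0..m - l}. ?t i) + ?t (m - l + 1) = 0"
    using power_form_recurrence[OF d] by (simp only: Suc_eq_plus1[symmetric] sum.atLeast0_atMost_Suc)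
  have 3: "?t (m - l + 1) = (-1) ^ (m - l + 1) * elem_sym n (m - l + 1)"
    by (simp add: power_form_0[OF n])
  show ?thesis
    using 1 2 unfolding 3 by (simp only: eq_neg_iff_add_eq_0)
qed

text \<open>The mechanism behind both parts of the corollary: mutating \<open>(v\<^sub>l\<^sub>-\<^sub>1, v\<^sub>m(l))\<close> subtracts exactly the
  next term of the alternating sum and gives \<open>(v\<^sub>m(l-1), v\<^sub>l\<^sub>-\<^sub>1)\<close>.\<close>

lemma tvec_mutation:
  assumes "2 \<le> l" "l \<le> m" "m \<le> n"
  shows "tvec n k m l - vscale (laurent_form n (pvec n (k + int (l - 1))) (tvec n k m l))
           (pvec n (k + int (l - 1))) = tvec n k m (l - 1)"
  using assms by (simp only: form_pvec_tvec_pred tvec_extend vscale.scale_minus_left diff_minus_eq_add)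

lemma form_tvec_pvec:
  assumes "1 \<le> j" "j < l" "l \<le> m" "m \<le> n"
  shows "laurent_form n (tvec n k m l) (pvec n (k + int j)) = 0"
proof -
  have zero: "laurent_form n (pvec n (k + int p)) (pvec n (k + int j)) = 0" if "l \<le> p" "p \<le> m" for p
  proof -
    have "- int n < int j - int p" "int j - int p < 0" using that assms by linarith+
    from power_form_neg[OF n this] show ?thesis
      by (simp add: laurent_form_pvec)
  qed
  have "laurent_form n (tvec n k m l) (pvec n (k + int j)) =
      laurent_form n (pvec n (k + int m)) (pvec n (k + int j))"
    by (rule form_tvec_left[OF pvec_in_Kvec[OF n] assms(3)]) (rule zero, simp_all)
  also have "\<dots> = 0" using assms(3) by (rule zero) simp
  finally show ?thesis .
qed

lemma form_tvec_tvec: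
  assumes "1 \<le> l" "l \<le> l'" "l' \<le> m'" "m' \<le> m" "m \<le> n"
  shows "laurent_form n (tvec n k m' l') (tvec n k m l) = (if m' = m then 1 else 0)"
proof -
  have form: "laurent_form n (pvec n (k + int p)) (tvec n k m l) = (if p = m then 1 else 0)"
    if "l' \<le> p" "p \<le> m'" for p
    by (rule form_pvec_tvec[OF assms(1)])
       (rule order_trans[OF assms(2) that(1)] order_trans[OF that(2) assms(4)] assms(5))+
  have "laurent_form n (tvec n k m' l') (tvec n k m l) = laurent_form n (pvec n (k + int m')) (tvec n k m l)"
  proof (rule form_tvec_left[OF tvec_in_Kvec[OF n] assms(3)])
    fix p assume "l' \<le> p" "p < m'"
    then show "laurent_form n (pvec n (k + int p)) (tvec n k m l) = 0"
      using form[of p] assms by simp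
  qed
  then show ?thesis using form[of m'] assms by simp
qed

end

text \<open>The bases \<open>Q\<^sub>k'\<close> and \<open>Q\<^sub>k''\<close> in terms of values at the roots. A last vector \<open>v\<^sub>h\<^sub>+\<^sub>1\<close> that seems to
  break the pattern is \<open>v\<^sub>h\<^sub>+\<^sub>1(h+1)\<close>, which gives one formula for both parities of \<open>n\<close>.\<close>

definition qprime :: "nat \<Rightarrow> int \<Rightarrow> nat \<Rightarrow> nat \<Rightarrow> laurent" where
  "qprime n k = (\<lambda>j\<in>{1..n}. if odd j then pvec n (k + int ((j + 1) div 2))
     else tvec n k (n + 1 - j div 2) (j div 2 + 1))"

definition qdprime :: "nat \<Rightarrow> int \<Rightarrow> nat \<Rightarrow> nat \<Rightarrow> laurent" where
  "qdprime n k = (\<lambda>j\<in>{1..n}. if even j then pvec n (k + int (j div 2))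
     else tvec n k (n + 1 - (j + 1) div 2) ((j + 1) div 2))"

lemma qprime_odd: "2 * h + 1 \<le> n \<Longrightarrow> qprime n k (2 * h + 1) = pvec n (k + int (h + 1))"
  by (simp add: qprime_def)

lemma qprime_even: "1 \<le> h \<Longrightarrow> 2 * h \<le> n \<Longrightarrow> qprime n k (2 * h) = tvec n k (n + 1 - h) (h + 1)"
  by (simp add: qprime_def)

lemma qdprime_even: "1 \<le> h \<Longrightarrow> 2 * h \<le> n \<Longrightarrow> qdprime n k (2 * h) = pvec n (k + int h)"
  by (simp add: qdprime_def)

lemma qdprime_odd: "2 * h + 1 \<le> n \<Longrightarrow> qdprime n k (2 * h + 1) = tvec n k (n - h) (h + 1)"
  by (simp add: qdprime_def)

lemma position_cases:
  assumes "j \<in> {1..n}"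
  obtains h where "j = 2 * h + 1" "2 * h + 1 \<le> n" | h where "j = 2 * h" "1 \<le> h" "2 * h \<le> (n::nat)"
proof (cases "odd j")
  case True
  then obtain h where "j = 2 * h + 1" by (rule oddE)
  then show ?thesis using assms by (intro that(1)[of h]) simp_all
next
  case False
  then obtain h where "j = 2 * h" by blast
  then show ?thesis using assms by (intro that(2)[of h]) simp_all
qed

lemma gram_qprime:
  assumes n: "n \<ge> 1"
  shows "K.gram_unitriangular n n (qprime n k)"
  unfolding K.gram_unitriangular_def
proof (intro conjI ballI impI)
  fix i assume i: "i \<in> {1..n}"
  from i show "laurent_form n (qprime n k i) (qprime n k i) = 1"
  proof (cases rule: position_cases)
    case (1 h)
    show ?thesis
      unfolding 1(1) qprime_odd[OF 1(2)] laurent_form_pvec by (simp add: power_form_0[OF n])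
  next
    case (2 h)
    have "1 \<le> h + 1" "h + 1 \<le> h + 1" "h + 1 \<le> n + 1 - h" "n + 1 - h \<le> n + 1 - h" "n + 1 - h \<le> n"
      using 2 by linarith+
    from form_tvec_tvec[OF n this] show ?thesis
      unfolding 2(1) qprime_even[OF 2(2,3)] by simp
  qed
next
  fix i j assume ij: "i \<in> {1..n}" "j \<in> {1..n}" "j < i"
  from ij(1) show "laurent_form n (qprime n k i) (qprime n k j) = 0"
  proof (cases rule: position_cases)
    case i: (1 g)
    from ij(2) show ?thesis
    proof (cases rule: position_cases)
      case j: (1 h)
      have "- int n < k + int (h + 1) - (k + int (g + 1))" "k + int (h + 1) - (k + int (g + 1)) < 0"
        using i j ij(3) by linarith+
      from power_form_neg[OF n this] show ?thesis
        unfolding i(1) j(1) qprime_odd[OF i(2)] qprime_odd[OF j(2)] laurent_form_pvec .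
    next
      case j: (2 h)
      have "1 \<le> h + 1" "h + 1 \<le> g + 1" "g + 1 \<le> n + 1 - h" "n + 1 - h \<le> n" "g + 1 \<noteq> n + 1 - h"
        using i j ij(3) by linarith+
      with form_pvec_tvec[OF n this(1-4), of k] show ?thesis
        unfolding i(1) j(1) qprime_odd[OF i(2)] qprime_even[OF j(2,3)] by (simp only: if_False)
    qed
  next
    case i: (2 g)
    from ij(2) show ?thesis
    proof (cases rule: position_cases)
      case j: (1 h)
      have "1 \<le> h + 1" "h + 1 < g + 1" "g + 1 \<le> n + 1 - g" "n + 1 - g \<le> n"
        using i j ij(3) by linarith+
      from form_tvec_pvec[OF n this] show ?thesis
        unfolding i(1) j(1) qprime_odd[OF j(2)] qprime_even[OF i(2,3)] .
    next
      case j: (2 h)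
      have "1 \<le> h + 1" "h + 1 \<le> g + 1" "g + 1 \<le> n + 1 - g" "n + 1 - g \<le> n + 1 - h"
        "n + 1 - h \<le> n" "n + 1 - g \<noteq> n + 1 - h"
        using i j ij(3) by linarith+
      with form_tvec_tvec[OF n this(1-5), of k] show ?thesis
        unfolding i(1) j(1) qprime_even[OF j(2,3)] qprime_even[OF i(2,3)] by (simp only: if_False)
    qed
  qed
qed

text \<open>Spanning is an induction on \<open>m\<close>: for \<open>2 m - 1 \<le> n\<close> the vector \<open>v\<^sub>m\<close> belongs to the family, and for
  larger \<open>m\<close> the member \<open>v\<^sub>m(i + 1)\<close>, \<open>i = n + 1 - m\<close>, is \<open>v\<^sub>m\<close> up to lower vectors.\<close>

lemma exceptional_qprime:
  assumes n: "n \<ge> 1"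
  shows "qprime n k \<in> K.exceptional n n"
proof -
  let ?S = "K.combs n n (qprime n k)"
  have win: "pvec n (k + int m) \<in> ?S" if "m \<in> {1..n}" for m
    using that
  proof (induction m rule: less_induct)
    case (less m)
    show ?case
    proof (cases "2 * m - 1 \<le> n")
      case True
      have "1 \<le> m" using less.prems by simp
      then have h: "2 * (m - 1) + 1 \<le> n" "m - 1 + 1 = m"
        using True by linarith+
      from h(1) have pos: "2 * (m - 1) + 1 \<in> {1..n}" by simp
      show ?thesis
        using K.combs_base[OF pos, of "qprime n k" n] unfolding qprime_odd[OF h(1)] h(2) .
    next
      case False
      define i where "i = n + 1 - m"
      have m: "1 \<le> m" "m \<le> n" using less.prems by simp_all
      have i: "1 \<le> i" "2 * i \<le> n" "n + 1 - i = m" "i + 1 \<le> m"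
        using False m unfolding i_def by linarith+
      have "tvec n k m (i + 1) = pvec n (k + int m) +
          (\<Sum>t\<in>{1..m - (i + 1)}. vscale ((-1) ^ t * elem_sym n t) (pvec n (k + int (m - t))))"
        by (simp add: tvec_def sum.atLeast_Suc_atMost del: of_nat_diff)
      then have "pvec n (k + int m) = tvec n k m (i + 1) -
          (\<Sum>t\<in>{1..m - (i + 1)}. vscale ((-1) ^ t * elem_sym n t) (pvec n (k + int (m - t))))"
        by (simp only: add_diff_cancel_right')
      also have "tvec n k m (i + 1) = qprime n k (2 * i)"
        unfolding qprime_even[OF i(1,2)] i(3) ..
      also have "qprime n k (2 * i) -
          (\<Sum>t\<in>{1..m - (i + 1)}. vscale ((-1) ^ t * elem_sym n t) (pvec n (k + int (m - t)))) \<in> ?S"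
      proof (rule K.combs_diff[OF _ K.combs_sum])
        show "qprime n k (2 * i) \<in> ?S" 
          by (rule K.combs_base) (use i in simp)
        fix t assume "t \<in> {1..m - (i + 1)}"
        then have "m - t < m" "m - t \<in> {1..n}" using m by auto
        then have "pvec n (k + int (m - t)) \<in> ?S" by (rule less.IH)
        then show "vscale ((-1) ^ t * elem_sym n t) (pvec n (k + int (m - t))) \<in> ?S"
          by (rule K.combs_scale[OF _ sign_elem_sym_in_Laurent])
      qed
      finally show ?thesis .
    qed
  qed
  have gen: "pvec n m \<in> ?S" for m
    by (rule pvec_window_generates[OF K.combs_0 K.combs_add K.combs_scale win n])
  have "Kvec n \<subseteq> ?S"
  proof
    fix u assume "u \<in> Kvec n"
    then obtain Q where Q: "Q \<in> {1..n} \<rightarrow> Laurent n" "u = (\<Sum>m\<in>{1..n}. vscale (Q m) (pvec n (int m)))"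
      by (auto simp: Kvec_def)
    show "u \<in> ?S"
      unfolding Q(2) by (rule K.combs_sum, rule K.combs_scale[OF gen]) (rule funcset_mem[OF Q(1)])
  qed
  moreover have "qprime n k \<in> {1..n} \<rightarrow>\<^sub>E Kvec n"
    unfolding qprime_def by (rule restrict_PiE[THEN iffD2]) (simp add: pvec_in_Kvec[OF n] tvec_in_Kvec[OF n])
  ultimately show ?thesis
    using gram_qprime[OF n] unfolding K.exceptional_def by simp
qed

text \<open>At positions \<open>2h + 1\<close>, \<open>2h + 2\<close> stand \<open>v\<^sub>h\<^sub>+\<^sub>1\<close> and \<open>v\<^sub>n\<^sub>-\<^sub>h(h + 2)\<close>, a pair as in
  \<open>tvec_mutation\<close>.\<close>

lemma odd_mutations_qprime:
  "foldr (K.mutate n) (filter odd [1..<n]) (qprime n k) = qdprime n k"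
proof
  fix j
  define b where "b = foldr (K.mutate n) (filter odd [1..<n]) (qprime n k)"
  have mem: "i \<in> set (filter odd [1..<n]) \<longleftrightarrow> odd i \<and> i < n" for i
    by (auto intro: odd_pos Suc_leI)
  have b: "b j = (if odd j \<and> j < n then qprime n k (j + 1) -
          vscale (laurent_form n (qprime n k j) (qprime n k (j + 1))) (qprime n k j)
     else if j > 0 \<and> odd (j - 1) \<and> j - 1 < n then qprime n k (j - 1) else qprime n k j)" for j
    unfolding b_def
    by (subst K.foldr_mutate_parity[where e = False]) (simp_all only: mem distinct_filter distinct_upt, simp)
  show "b j = qdprime n k j"
  proof (cases "j \<in> {1..n}")
    case False
    then consider "j = 0" | "j > n" "\<not> j - 1 < n" by force
    then show ?thesis by cases (simp_all add: b qprime_def qdprime_def)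
  next
    case True
    then show ?thesis
    proof (cases rule: position_cases)
      case (2 h)
      then have h: "2 * (h - 1) + 1 \<le> n" "2 * h - 1 = 2 * (h - 1) + 1" "h - 1 + 1 = h" by simp_all
      have "2 * (h - 1) + 1 < n" using 2 by linarith
      then have "b (2 * h) = qprime n k (2 * h - 1)"
        using 2 unfolding b h(2) by simp
      then show ?thesis
        unfolding 2(1) qdprime_even[OF 2(2,3)] h(2) qprime_odd[OF h(1)] h(3) .
    next
      case (1 h)
      show ?thesis
      proof (cases "j < n")
        case True
        then have h: "1 \<le> h + 1" "2 * (h + 1) \<le> n" "2 * h + 1 + 1 = 2 * (h + 1)" "n + 1 - (h + 1) = n - h"
          "2 \<le> h + 1 + 1" "h + 1 + 1 \<le> n - h" "n - h \<le> n" "h + 1 + 1 - 1 = h + 1" "1 \<le> n" "odd (2 * h + 1)"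
          "2 * h + 1 < n"
          using 1 by simp_all
        have "b (2 * h + 1) = qprime n k (2 * (h + 1)) -
          vscale (laurent_form n (qprime n k (2 * h + 1)) (qprime n k (2 * (h + 1)))) (qprime n k (2 * h + 1))"
          unfolding b h(3) using h(10,11) by (simp only: HOL.simp_thms if_True)
        also have "\<dots> = tvec n k (n - h) (h + 1)"
          using tvec_mutation[OF h(9,5-7), of k]
          unfolding qprime_odd[OF 1(2)] qprime_even[OF h(1,2)] h(4,8) .
        finally show ?thesis
          unfolding 1(1) qdprime_odd[OF 1(2)] .
      next
        case False
        then have h: "n - h = h + 1" "\<not> 2 * h + 1 < n" using 1 by simp_all
        then have "b (2 * h + 1) = qprime n k (2 * h + 1)"
          unfolding b by simp
        then show ?thesis
          unfolding 1(1) qdprime_odd[OF 1(2)] qprime_odd[OF 1(2)] h(1) tvec_self .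
      qed
    qed
  qed
qed

text \<open>At positions \<open>2h\<close>, \<open>2h + 1\<close> stand \<open>v\<^sub>h\<close> and \<open>v\<^sub>n\<^sub>-\<^sub>h(h + 1)\<close>; mutation gives \<open>v\<^sub>n\<^sub>-\<^sub>h(h)\<close>, which is
  \<open>v\<^sub>n\<^sub>+\<^sub>1\<^sub>-\<^sub>h(h + 1)\<close> for the index \<open>k - 1\<close>. The first vector \<open>v\<^sub>n(1)\<close> is not touched; the full relation
  of length \<open>n + 1\<close> identifies it with \<open>(-1)\<^sup>n\<^sup>+\<^sup>1 s\<^sub>n v\<^sub>0\<close>, and \<open>v\<^sub>0\<close> opens \<open>Q\<^sub>k\<^sub>-\<^sub>1'\<close>.\<close>

lemma even_mutations_qdprime:
  assumes n: "n \<ge> 1" and b_def: "b = foldr (K.mutate n) (filter even [1..<n]) (qdprime n k)"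
  shows "b(1 := vscale ((-1) ^ (n + 1) * inv_Z (elem_sym n n)) (b 1)) = qprime n (k - 1)"
proof
  fix j
  have mem: "i \<in> set (filter even [1..<n]) \<longleftrightarrow> even i \<and> 0 < i \<and> i < n" for i
    by auto
  have b: "b j = (if even j \<and> 0 < j \<and> j < n then qdprime n k (j + 1) -
          vscale (laurent_form n (qdprime n k j) (qdprime n k (j + 1))) (qdprime n k j)
     else if j > 0 \<and> even (j - 1) \<and> 0 < j - 1 \<and> j - 1 < n then qdprime n k (j - 1) else qdprime n k j)" for j
    unfolding b_def
    by (subst K.foldr_mutate_parity[where e = True]) (simp_all only: mem distinct_filter distinct_upt, simp)
  show "(b(1 := vscale ((-1) ^ (n + 1) * inv_Z (elem_sym n n)) (b 1))) j = qprime n (k - 1) j"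
  proof (cases "j \<in> {1..n}")
    case False
    then consider "j = 0" | "j > n" "\<not> j - 1 < n" by force
    then show ?thesis using n by cases (simp_all add: b qprime_def qdprime_def)
  next
    case True
    then show ?thesis
    proof (cases rule: position_cases)
      case (2 h)
      then have j1: "j \<noteq> 1" by auto
      have "b (2 * h) = qprime n (k - 1) (2 * h)"
      proof (cases "2 * h < n")
        case True
        then have h: "2 * h + 1 \<le> n" "2 \<le> h + 1" "h + 1 \<le> n - h" "n - h \<le> n" "h + 1 - 1 = h"
          "1 \<le> h" "h \<le> n - h" "n - h + 1 = n + 1 - h" "even (2 * h)" "0 < 2 * h"
          using 2 by simp_all
        have "b (2 * h) = qdprime n k (2 * h + 1) -
          vscale (laurent_form n (qdprime n k (2 * h)) (qdprime n k (2 * h + 1))) (qdprime n k (2 * h))"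
          unfolding b using h(9,10) True by (simp only: HOL.simp_thms if_True)
        also have "\<dots> = tvec n k (n - h) h"
          using tvec_mutation[OF n h(2-4), of k]
          unfolding qdprime_odd[OF h(1)] qdprime_even[OF 2(2,3)] h(5) .
        also have "\<dots> = tvec n (k - 1) (n + 1 - h) (h + 1)"
          using tvec_shift[OF h(6,7), of n k] unfolding h(8) by (rule HOL.sym)
        also have "\<dots> = qprime n (k - 1) (2 * h)"
          by (rule qprime_even[OF 2(2,3), symmetric])
        finally show ?thesis .
      next
        case False
        then have h: "n + 1 - h = h + 1" "k - 1 + int (h + 1) = k + int h" "\<not> 2 * h < n"
          using 2 by simp_all
        have "odd (2 * h - 1)" using 2 by simp
        then have "b (2 * h) = qdprime n k (2 * h)"
          unfolding b using h(3) by (simp only: HOL.simp_thms if_False)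
        then show ?thesis
          unfolding qdprime_even[OF 2(2,3)] qprime_even[OF 2(2,3)] h(1) tvec_self h(2) .
      qed
      then show ?thesis using j1 2(1) by simp
    next
      case (1 h)
      show ?thesis
      proof (cases "h = 0")
        case False
        then have h: "1 \<le> h" "2 * h \<le> n" "2 * h + 1 - 1 = 2 * h" "k - 1 + int (h + 1) = k + int h"
          "0 < 2 * h" "2 * h < n" "0 < 2 * h + 1"
          using 1 by simp_all
        have "b (2 * h + 1) = qdprime n k (2 * h)"
          unfolding b h(3) using h by simp
        also have "\<dots> = qprime n (k - 1) (2 * h + 1)"
          unfolding qdprime_even[OF h(1,2)] qprime_odd[OF 1(2)] h(4) ..
        finally show ?thesis using 1(1) False by simp
      next
        case True
        define c where "c = (-1) ^ n * elem_sym n n"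
        have top: "n - 1 + 1 = n" using n by simp
        \<comment> \<open>the term \<open>i = n\<close> of the full relation is the multiple of \<open>v\<^sub>0\<close> that \<open>v\<^sub>n(1)\<close> omits\<close>
        have "(\<Sum>i=0..n. vscale ((-1) ^ i * elem_sym n i) (pvec n (k + int (n - i)))) =
            tvec n k n 1 + vscale c (pvec n k)"
          using n by (cases n) (simp_all add: tvec_def c_def)
        moreover have "(\<Sum>i=0..n. vscale ((-1) ^ i * elem_sym n i) (pvec n (k + int (n - i)))) =
            (\<Sum>i=0..n. vscale ((-1) ^ i * elem_sym n i) (pvec n (k + int n - int i)))"
          by (rule sum.cong) (simp_all add: of_nat_diff add_diff_eq)
        ultimately have "tvec n k n 1 + vscale c (pvec n k) = 0"
          by (simp only: pvec_recurrence)
        then have t: "tvec n k n 1 = vscale (- c) (pvec n k)"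
          by (simp only: eq_neg_iff_add_eq_0 vscale.scale_minus_left)
        have "(-1) ^ (n + 1) * inv_Z (elem_sym n n) * - c =
            ((-1) ^ n * (-1) ^ n) * (inv_Z (elem_sym n n) * elem_sym n n)"
          by (simp add: c_def mult.assoc mult.left_commute)
        also have "\<dots> = 1"
          unfolding inv_Z_elem_sym_top power_mult_distrib[symmetric] by simp
        finally have "vscale ((-1) ^ (n + 1) * inv_Z (elem_sym n n)) (tvec n k n 1) = pvec n k"
          unfolding t vscale.scale_scale by (simp only: vscale.scale_one)
        moreover have "b 1 = tvec n k n 1"
          using qdprime_odd[of 0 n k] n by (simp add: b)
        moreover have "qprime n (k - 1) 1 = pvec n k"
          using qprime_odd[of 0 n "k - 1"] n by simp
        ultimately show ?thesis using 1(1) True by simp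
      qed
    qed
  qed
qed

section \<open>The equivariant cohomology ring and its fixed points\<close>

lemma perm_Y_bij:
  assumes "bij \<pi>"
  shows "bij (perm_Y \<pi>)"
proof (rule bijI)
  show "inj (perm_Y \<pi>)"
    using bij_is_inj[OF assms] by (auto simp: inj_def perm_Y_def split: hvar.splits)
  show "surj (perm_Y \<pi>)"
  proof (rule surjI)
    fix v show "perm_Y \<pi> (perm_Y (inv_into UNIV \<pi>) v) = v"
      using bij_is_surj[OF assms] by (simp add: perm_Y_def surj_f_inv_f split: hvar.splits)
  qed
qed

lemma map_key_bij:
  assumes "bij f"
  shows "bij (map_key f :: ('b \<Rightarrow>\<^sub>0 'c::zero) \<Rightarrow> _)"
proof -
  have i: "inj f" "inj (inv_into UNIV f)"
    using assms bij_imp_bij_inv bij_is_inj by blast+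
  have f: "inv_into UNIV f \<circ> f = id" "f \<circ> inv_into UNIV f = id"
    using assms by (auto simp: fun_eq_iff bij_is_inj bij_is_surj surj_f_inv_f)
  show ?thesis
    by (rule o_bij[where g = "map_key (inv_into UNIV f)"])
       (simp_all add: fun_eq_iff map_key_compose i f map_key_id[folded id_def])
qed

text \<open>The action of a permutation of the \<open>y\<^sub>j\<close> on polynomials; with it the symmetry condition becomes
  invariance under ring automorphisms, hence is stable under products.\<close>

definition perm_h :: "(nat \<Rightarrow> nat) \<Rightarrow> hpoly \<Rightarrow> hpoly" where
  "perm_h \<pi> = map_key (map_key (perm_Y \<pi>))"

context
  fixes \<pi> :: "nat \<Rightarrow> nat"
  assumes \<pi>: "bij \<pi>"
begin

lemma perm_exponents_bij: "bij (map_key (perm_Y \<pi>) :: (hvar \<Rightarrow>\<^sub>0 nat) \<Rightarrow> _)"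
  by (intro map_key_bij perm_Y_bij \<pi>)

lemma perm_exponents_add:
  "map_key (perm_Y \<pi>) (a + b :: hvar \<Rightarrow>\<^sub>0 nat) =
   map_key (perm_Y \<pi>) a + map_key (perm_Y \<pi>) b"
  by (rule map_key_plus) (rule bij_is_inj[OF perm_Y_bij[OF \<pi>]])

lemma perm_h_add: "perm_h \<pi> (f + g) = perm_h \<pi> f + perm_h \<pi> g"
  unfolding perm_h_def by (rule map_key_plus) (rule bij_is_inj[OF perm_exponents_bij])

lemma perm_h_mult: "perm_h \<pi> (f * g) = perm_h \<pi> f * perm_h \<pi> g"
  unfolding perm_h_def by (rule map_key_mult[OF perm_exponents_bij perm_exponents_add])

lemma perm_h_0: "perm_h \<pi> 0 = 0"
  unfolding perm_h_def by (rule map_key_zero) (rule bij_is_inj[OF perm_exponents_bij])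

lemma perm_h_1: "perm_h \<pi> 1 = 1"
  unfolding perm_h_def by (rule map_key_one_bij[OF perm_exponents_bij]) (rule map_key_zero[OF bij_is_inj[OF perm_Y_bij[OF \<pi>]]])

lemma perm_h_uminus: "perm_h \<pi> (- f) = - perm_h \<pi> f"
  using perm_h_add[of f "- f"] by (simp add: perm_h_0 eq_neg_iff_add_eq_0 add.commute)

lemma perm_h_var:
  "perm_h \<pi> (single (single v 1) c) =
   single (single (perm_Y \<pi> v) 1) c"
proof -
  have "single v (1::nat) =
      map_key (perm_Y \<pi>) (single (perm_Y \<pi> v) 1)"
    by (rule map_key_single[symmetric]) (rule bij_is_inj[OF perm_Y_bij[OF \<pi>]])
  then show ?thesis
    unfolding perm_h_def
    by (simp only: map_key_single[OF bij_is_inj[OF perm_exponents_bij]])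
qed

lemma perm_h_hX: "perm_h \<pi> hX = hX"
  unfolding hX_def perm_h_var by (simp add: perm_Y_def)

lemma perm_h_hY: "perm_h \<pi> (hY j) = hY (\<pi> j)"
  unfolding hY_def perm_h_var by (simp add: perm_Y_def)

lemma perm_h_hZ: "perm_h \<pi> (hZ a) = hZ a"
  unfolding hZ_def perm_h_var by (simp add: perm_Y_def)

lemma perm_h_hC: "perm_h \<pi> (hC c) = hC c"
proof -
  have "map_key (map_key (perm_Y \<pi>)) (single (map_key (perm_Y \<pi>) (0 :: hvar \<Rightarrow>\<^sub>0 nat)) c)
      = single 0 c"
    by (rule map_key_single[OF bij_is_inj[OF perm_exponents_bij]])
  then show ?thesis
    unfolding hC_def perm_h_def map_key_zero[OF bij_is_inj[OF perm_Y_bij[OF \<pi>]]] .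
qed

end

definition hvars :: "nat \<Rightarrow> hvar set" where
  "hvars n = {VX} \<union> VY ` {1..n-1} \<union> VZ ` {1..n}"

definition Hpoly :: "nat \<Rightarrow> hpoly set" where
  "Hpoly n = {f \<in> supported_in (hvars n). \<forall>\<pi>. \<pi> permutes {1..n-1} \<longrightarrow> perm_h \<pi> f = f}"

lemma carrier_hpoly_ring: "carrier (hpoly_ring n) = Hpoly n"
proof -
  have "(\<forall>m. lookup f (map_key (perm_Y \<pi>) m) = lookup f m) \<longleftrightarrow>
      perm_h \<pi> f = f" if "\<pi> permutes {1..n-1}" for \<pi> f
    using bij_is_inj[OF perm_exponents_bij[OF permutes_bij[OF that]]]
    by (simp add: perm_h_def poly_mapping_eq_iff map_key.rep_eq fun_eq_iff)
  then show ?thesis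
    unfolding hpoly_ring_def Hpoly_def supported_in_def hvars_def partial_object.simps by blast
qed

lemma hpoly_ring_eq: "hpoly_ring n = \<lparr>carrier = Hpoly n, mult = (*), one = 1, zero = 0, add = (+)\<rparr>"
  using carrier_hpoly_ring[of n] by (simp add: hpoly_ring_def)

lemma Hpoly_0: "0 \<in> Hpoly n"
  by (auto simp: Hpoly_def supported_in_def perm_h_0[OF permutes_bij])

lemma Hpoly_1: "1 \<in> Hpoly n"
  by (auto simp: Hpoly_def supported_in_def perm_h_1[OF permutes_bij])

lemma Hpoly_add: "f \<in> Hpoly n \<Longrightarrow> g \<in> Hpoly n \<Longrightarrow> f + g \<in> Hpoly n"
  by (auto simp: Hpoly_def supported_in_add perm_h_add[OF permutes_bij])

lemma Hpoly_mult: "f \<in> Hpoly n \<Longrightarrow> g \<in> Hpoly n \<Longrightarrow> f * g \<in> Hpoly n"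
  by (auto simp: Hpoly_def supported_in_mult perm_h_mult[OF permutes_bij])

lemma Hpoly_uminus: "f \<in> Hpoly n \<Longrightarrow> - f \<in> Hpoly n"
  by (auto simp: Hpoly_def supported_in_uminus perm_h_uminus[OF permutes_bij])

lemma Hpoly_sum: "(\<And>i. i \<in> I \<Longrightarrow> f i \<in> Hpoly n) \<Longrightarrow> (\<Sum>i\<in>I. f i) \<in> Hpoly n"
  by (induction I rule: infinite_finite_induct) (simp_all add: Hpoly_0 Hpoly_add)

lemma hC_in_Hpoly: "hC c \<in> Hpoly n"
  by (auto simp: Hpoly_def perm_h_hC[OF permutes_bij]) (simp add: hC_def supported_in_single)

lemma hZ_in_Hpoly: "a \<in> {1..n} \<Longrightarrow> hZ a \<in> Hpoly n"
  by (auto simp: Hpoly_def perm_h_hZ[OF permutes_bij]) (auto simp: hZ_def hvars_def intro!: supported_in_single)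

lemma cring_hpoly_ring: "cring (hpoly_ring n)"
  unfolding hpoly_ring_eq
  by (rule cring_carrier_closed) (simp_all add: Hpoly_0 Hpoly_1 Hpoly_add Hpoly_mult Hpoly_uminus)

text \<open>The relations of \<open>H\<close> and \<open>W\<close> are given by the coefficients of products of linear factors; these are
  followed through ring homomorphisms and inside subrings.\<close>

lemma coeff_mult_hom:
  fixes h :: "'a::comm_ring_1 \<Rightarrow> 'b::comm_ring_1"
  assumes "h 0 = 0" "\<And>x y. h (x + y) = h x + h y" "\<And>x y. h (x * y) = h x * h y"
    and "\<And>i. h (coeff p i) = coeff p' i" "\<And>i. h (coeff q i) = coeff q' i"
  shows "h (coeff (p * q) i) = coeff (p' * q') i"
proof -
  have "h (\<Sum>k\<in>I. f k) = (\<Sum>k\<in>I. h (f k))" for I :: "nat set" and f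
    by (induction I rule: infinite_finite_induct) (simp_all add: assms)
  then show ?thesis by (simp add: coeff_mult assms)
qed

lemma coeff_prod_hom:
  fixes h :: "'a::comm_ring_1 \<Rightarrow> 'b::comm_ring_1"
  assumes "h 0 = 0" "h 1 = 1" "\<And>x y. h (x + y) = h x + h y" "\<And>x y. h (x * y) = h x * h y"
    and "\<And>j i. j \<in> S \<Longrightarrow> h (coeff (p j) i) = coeff (p' j) i"
  shows "h (coeff (\<Prod>j\<in>S. p j) i) = coeff (\<Prod>j\<in>S. p' j) i"
  using assms(5)
proof (induction S arbitrary: i rule: infinite_finite_induct)
  case (insert j S)
  show ?case
    unfolding prod.insert[OF insert.hyps]
    by (rule coeff_mult_hom) (use assms insert in auto)
qed (simp_all add: coeff_1 assms)

lemma coeff_mult_closed: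
  fixes C :: "'a::comm_ring_1 set"
  assumes "0 \<in> C" "\<And>x y. x \<in> C \<Longrightarrow> y \<in> C \<Longrightarrow> x + y \<in> C" "\<And>x y. x \<in> C \<Longrightarrow> y \<in> C \<Longrightarrow> x * y \<in> C"
    and "\<And>i. coeff p i \<in> C" "\<And>i. coeff q i \<in> C"
  shows "coeff (p * q) i \<in> C"
proof -
  have "(\<Sum>k\<in>I. f k) \<in> C" if "\<And>k. f k \<in> C" for I :: "nat set" and f
    using that by (induction I rule: infinite_finite_induct) (simp_all add: assms)
  then show ?thesis by (simp add: coeff_mult assms)
qed

lemma coeff_prod_closed:
  fixes C :: "'a::comm_ring_1 set"
  assumes "0 \<in> C" "1 \<in> C" "\<And>x y. x \<in> C \<Longrightarrow> y \<in> C \<Longrightarrow> x + y \<in> C"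
    and "\<And>x y. x \<in> C \<Longrightarrow> y \<in> C \<Longrightarrow> x * y \<in> C"
    and "\<And>j i. j \<in> S \<Longrightarrow> coeff (p j) i \<in> C"
  shows "coeff (\<Prod>j\<in>S. p j) i \<in> C"
  using assms(5)
proof (induction S arbitrary: i rule: infinite_finite_induct)
  case (insert j S)
  show ?case
    unfolding prod.insert[OF insert.hyps]
    by (rule coeff_mult_closed) (use assms insert in auto)
qed (simp_all add: coeff_1 assms)

lemma coeff_linear: "coeff [:a, b:] i = (if i = 0 then a else if i = 1 then b else 0)"
  by (simp add: coeff_pCons split: nat.splits)

text \<open>Permuting the \<open>y\<^sub>j\<close> only reorders the factors. The signs cover the factors \<open>u - y\<^sub>j\<close> of the
  relation and \<open>y\<^sub>j - t\<close> of \<open>W\<close>.\<close>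

lemma coeff_Y_product_in_Hpoly:
  "coeff (\<Prod>j=1..n-1. [:e * hY j, d:]) i \<in> Hpoly n"
  if e: "e \<in> {1, -1}" and d: "d \<in> {1, -1}"
proof -
  have V: "coeff (\<Prod>j=1..n-1. [:e * hY j, d:]) i \<in> supported_in (hvars n)"
  proof (rule coeff_prod_closed)
    have one: "1 \<in> supported_in (hvars n)" by (simp add: supported_in_def)
    then have "e \<in> supported_in (hvars n)" "d \<in> supported_in (hvars n)" using e d supported_in_uminus by auto
    moreover fix j i :: nat assume "j \<in> {1..n-1}"
    then have "hY j \<in> supported_in (hvars n)"
      unfolding hY_def by (intro supported_in_single) (auto simp: hvars_def)
    ultimately show "coeff [:e * hY j, d:] i \<in> supported_in (hvars n)"
      by (simp add: coeff_linear supported_in_mult) (simp add: supported_in_def)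
  qed (simp_all add: supported_in_add supported_in_mult, simp_all add: supported_in_def)
  have "perm_h \<pi> (coeff (\<Prod>j=1..n-1. [:e * hY j, d:]) i) = coeff (\<Prod>j=1..n-1. [:e * hY j, d:]) i"
    if \<pi>: "\<pi> permutes {1..n-1}" for \<pi>
  proof -
    have b: "bij \<pi>" by (rule permutes_bij[OF \<pi>])
    have c: "perm_h \<pi> e = e" "perm_h \<pi> d = d"
      using e d by (auto simp: perm_h_1[OF b] perm_h_uminus[OF b])
    have "perm_h \<pi> (coeff (\<Prod>j=1..n-1. [:e * hY j, d:]) i) = coeff (\<Prod>j=1..n-1. [:e * hY (\<pi> j), d:]) i"
      by (rule coeff_prod_hom)
         (simp_all add: perm_h_0 perm_h_1 perm_h_add perm_h_mult perm_h_hY b c coeff_linear)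
    also have "(\<Prod>j=1..n-1. [:e * hY (\<pi> j), d:]) = (\<Prod>j=1..n-1. [:e * hY j, d:])"
      using prod.permute[OF \<pi>, of "\<lambda>j. [:e * hY j, d:]"] by (simp add: o_def)
    finally show ?thesis .
  qed
  with V show ?thesis by (simp add: Hpoly_def)
qed

lemma coeff_W_poly_in_Hpoly: "coeff (W_poly n) i \<in> Hpoly n"
  using coeff_Y_product_in_Hpoly[of 1 "-1" n i] by (simp add: W_poly_def)

lemma hX_in_Hpoly: "hX \<in> Hpoly n"
  by (auto simp: Hpoly_def perm_h_hX[OF permutes_bij]) (auto simp: hX_def hvars_def intro!: supported_in_single)

lemma coeff_H_relation_in_Hpoly: "coeff (H_relation n) i \<in> Hpoly n"
proof -
  have 1: "coeff (\<Prod>j=1..n-1. [:- hY j, 1:]) i \<in> Hpoly n" for i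
    using coeff_Y_product_in_Hpoly[of "-1" 1 n i] by simp
  have 2: "coeff [:- hX, 1:] i \<in> Hpoly n" for i
    by (simp add: coeff_linear hX_in_Hpoly Hpoly_uminus Hpoly_0 Hpoly_1)
  have 3: "coeff ([:- hX, 1:] * (\<Prod>j=1..n-1. [:- hY j, 1:])) i \<in> Hpoly n"
    by (rule coeff_mult_closed[OF Hpoly_0 Hpoly_add Hpoly_mult 2 1])
  have 4: "coeff (\<Prod>a=1..n. [:- hZ a, 1:]) i \<in> Hpoly n"
    by (rule coeff_prod_closed[OF Hpoly_0 Hpoly_1 Hpoly_add Hpoly_mult])
       (simp_all add: coeff_linear hZ_in_Hpoly Hpoly_uminus Hpoly_0 Hpoly_1)
  show ?thesis
    using Hpoly_add[OF 3 Hpoly_uminus[OF 4]] by (simp add: H_relation_def)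
qed

lemma H_generators_in_Hpoly: "range (coeff (H_relation n)) \<union> {hZ a - hC (z a) |a. a \<in> {1..n}} \<subseteq> Hpoly n"
proof -
  have "hZ a - hC (z a) \<in> Hpoly n" if "a \<in> {1..n}" for a
    using Hpoly_add[OF hZ_in_Hpoly[OF that] Hpoly_uminus[OF hC_in_Hpoly]] by simp
  then show ?thesis using coeff_H_relation_in_Hpoly by blast
qed

lemma ideal_H_ideal: "ideal (H_ideal n z) (hpoly_ring n)"
  unfolding H_ideal_def
  by (rule ring.genideal_ideal[OF cring.axioms(1)[OF cring_hpoly_ring]])
     (simp only: carrier_hpoly_ring H_generators_in_Hpoly)

lemma cring_H_ring: "cring (H_ring n z)"
  unfolding H_ring_def by (rule ideal.quotient_is_cring[OF ideal_H_ideal cring_hpoly_ring])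

lemma H_class_ring_hom: "H_class n z \<in> ring_hom (hpoly_ring n) (H_ring n z)"
  unfolding H_class_def[abs_def] H_ring_def by (rule ideal.rcos_ring_hom[OF ideal_H_ideal])

lemma H_class_closed: "f \<in> Hpoly n \<Longrightarrow> H_class n z f \<in> carrier (H_ring n z)"
  using ring_hom_closed[OF H_class_ring_hom] by (simp add: carrier_hpoly_ring)

lemma H_class_add:
  "f \<in> Hpoly n \<Longrightarrow> g \<in> Hpoly n \<Longrightarrow> H_class n z (f + g) = H_class n z f \<oplus>\<^bsub>H_ring n z\<^esub> H_class n z g"
  using ring_hom_add[OF H_class_ring_hom, of f n g z] by (simp add: hpoly_ring_eq)

lemma H_class_mult:
  "f \<in> Hpoly n \<Longrightarrow> g \<in> Hpoly n \<Longrightarrow> H_class n z (f * g) = H_class n z f \<otimes>\<^bsub>H_ring n z\<^esub> H_class n z g"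
  using ring_hom_mult[OF H_class_ring_hom, of f n g z] by (simp add: hpoly_ring_eq)

text \<open>Restriction to the fixed point \<open>I\<close> of the torus: \<open>x = z\<^sub>I\<close>, and the \<open>y\<^sub>j\<close> are the other
  \<open>z\<^sub>a\<close>, in the order given by skipping the index \<open>I\<close>.\<close>

definition skip :: "nat \<Rightarrow> nat \<Rightarrow> nat" where
  "skip I j = (if j < I then j else Suc j)"

definition fixed_point_coord :: "(nat \<Rightarrow> complex) \<Rightarrow> nat \<Rightarrow> hvar \<Rightarrow> complex" where
  "fixed_point_coord z I v = (case v of VX \<Rightarrow> z I | VY j \<Rightarrow> z (skip I j) | VZ a \<Rightarrow> z a)"

definition at_fixed_point :: "(nat \<Rightarrow> complex) \<Rightarrow> nat \<Rightarrow> hpoly \<Rightarrow> complex" where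
  "at_fixed_point z I = pm_eval (\<lambda>m. \<Prod>v\<in>keys m.
     fixed_point_coord z I v ^ lookup m v)"

lemma at_fixed_point_add: "at_fixed_point z I (f + g) = at_fixed_point z I f + at_fixed_point z I g"
  by (simp add: at_fixed_point_def pm_eval_add)

lemma at_fixed_point_diff: "at_fixed_point z I (f - g) = at_fixed_point z I f - at_fixed_point z I g"
  by (simp add: at_fixed_point_def pm_eval_diff)

lemma at_fixed_point_uminus: "at_fixed_point z I (- f) = - at_fixed_point z I f"
  by (simp add: at_fixed_point_def pm_eval_uminus)

lemma at_fixed_point_sum: "at_fixed_point z I (\<Sum>i\<in>S. f i) = (\<Sum>i\<in>S. at_fixed_point z I (f i))"
  by (simp add: at_fixed_point_def pm_eval_sum)

lemma at_fixed_point_mult: "at_fixed_point z I (f * g) = at_fixed_point z I f * at_fixed_point z I g"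
  unfolding at_fixed_point_def
  by (rule pm_eval_mult)
     (rule monomial_value_add[where val = "\<lambda>v k. fixed_point_coord z I v ^ k"], simp_all add: power_add)

lemma at_fixed_point_0: "at_fixed_point z I 0 = 0"
  by (simp add: at_fixed_point_def)

lemma at_fixed_point_1: "at_fixed_point z I 1 = 1"
  unfolding at_fixed_point_def by (rule pm_eval_one) simp

lemma at_fixed_point_vars:
  "at_fixed_point z I hX = z I" "at_fixed_point z I (hY j) = z (skip I j)"
  "at_fixed_point z I (hZ a) = z a" "at_fixed_point z I (hC c) = c"
  by (simp_all add: at_fixed_point_def hX_def hY_def hZ_def hC_def pm_eval_single fixed_point_coord_def)

lemma bij_betw_skip:
  assumes "I \<in> {1..n}"
  shows "bij_betw (skip I) {1..n-1} ({1..n} - {I})"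
proof (rule bij_betw_byWitness[where f' = "\<lambda>a. if a < I then a else a - 1"])
qed (use assms in \<open>auto simp: skip_def\<close>)

lemma coeff_at_fixed_point_prod:
  "at_fixed_point z I (coeff (\<Prod>j\<in>S. [:f j, g j:]) i) =
   coeff (\<Prod>j\<in>S. [:at_fixed_point z I (f j), at_fixed_point z I (g j):]) i"
  by (rule coeff_prod_hom)
     (simp_all add: at_fixed_point_0 at_fixed_point_1 at_fixed_point_add at_fixed_point_mult coeff_linear)

lemma H_relation_at_fixed_point:
  assumes "I \<in> {1..n}"
  shows "at_fixed_point z I (coeff (H_relation n) i) = 0"
proof -
  have 1: "at_fixed_point z I (coeff (\<Prod>j=1..n-1. [:- hY j, 1:]) i) = coeff (\<Prod>j=1..n-1. [:- z (skip I j), 1:]) i" for i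
    unfolding coeff_at_fixed_point_prod by (simp add: at_fixed_point_vars at_fixed_point_uminus at_fixed_point_1)
  have 2: "at_fixed_point z I (coeff [:- hX, 1:] i) = coeff [:- z I, 1:] i" for i
    by (simp add: coeff_linear at_fixed_point_vars at_fixed_point_uminus at_fixed_point_0 at_fixed_point_1)
  have 3: "at_fixed_point z I (coeff (\<Prod>a=1..n. [:- hZ a, 1:]) i) = coeff (\<Prod>a=1..n. [:- z a, 1:]) i"
    unfolding coeff_at_fixed_point_prod by (simp add: at_fixed_point_vars at_fixed_point_uminus at_fixed_point_1)
  have "(\<Prod>a=1..n. [:- z a, 1:]) = [:- z I, 1:] * (\<Prod>a\<in>{1..n} - {I}. [:- z a, 1:])"
    using assms by (intro prod.remove) auto
  also have "(\<Prod>a\<in>{1..n} - {I}. [:- z a, 1:]) = (\<Prod>j=1..n-1. [:- z (skip I j), 1:])"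
    by (rule prod.reindex_bij_betw[OF bij_betw_skip[OF assms], symmetric])
  finally have eq: "(\<Prod>a=1..n. [:- z a, 1:]) = [:- z I, 1:] * (\<Prod>j=1..n-1. [:- z (skip I j), 1:])" .
  have "at_fixed_point z I (coeff ([:- hX, 1:] * (\<Prod>j=1..n-1. [:- hY j, 1:])) i) =
      coeff ([:- z I, 1:] * (\<Prod>j=1..n-1. [:- z (skip I j), 1:])) i"
    by (rule coeff_mult_hom[OF at_fixed_point_0 at_fixed_point_add at_fixed_point_mult 2 1])
  then show ?thesis
    unfolding H_relation_def coeff_diff at_fixed_point_diff 3 eq by simp
qed

lemma H_ideal_at_fixed_point:
  assumes "I \<in> {1..n}" "f \<in> H_ideal n z"
  shows "at_fixed_point z I f = 0"
proof (rule genideal_in_kernel[OF _ at_fixed_point_add at_fixed_point_mult H_generators_in_Hpoly])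
  show "f \<in> Idl\<^bsub>\<lparr>carrier = Hpoly n, mult = (*), one = 1, zero = 0, add = (+)\<rparr>\<^esub>
      (range (coeff (H_relation n)) \<union> {hZ a - hC (z a) |a. a \<in> {1..n}})"
    using assms(2) unfolding H_ideal_def hpoly_ring_eq .
  fix s assume "s \<in> range (coeff (H_relation n)) \<union> {hZ a - hC (z a) |a. a \<in> {1..n}}"
  then show "at_fixed_point z I s = 0"
    using H_relation_at_fixed_point[OF assms(1)] by (auto simp: at_fixed_point_diff at_fixed_point_vars)
qed (use cring_hpoly_ring[of n] in \<open>simp add: hpoly_ring_eq\<close>)

lemma H_class_eq_imp_at_fixed_point_eq:
  assumes "I \<in> {1..n}" "f \<in> Hpoly n" "g \<in> Hpoly n" "H_class n z f = H_class n z g"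
  shows "at_fixed_point z I f = at_fixed_point z I g"
proof -
  interpret ideal "H_ideal n z" "hpoly_ring n" by (rule ideal_H_ideal)
  have "f \<in> H_class n z f"
    unfolding H_class_def by (rule a_rcos_self) (use assms in \<open>simp add: carrier_hpoly_ring\<close>)
  then have "f \<in> H_ideal n z +>\<^bsub>hpoly_ring n\<^esub> g"
    using assms by (simp add: H_class_def)
  then obtain h where "h \<in> H_ideal n z" "f = h + g"
    unfolding a_r_coset_def' by (auto simp: hpoly_ring_eq)
  then show ?thesis
    using H_ideal_at_fixed_point[OF assms(1)] by (simp add: at_fixed_point_add)
qed

section \<open>Linear independence of the functions \<open>\<Psi>\<^sub>J\<close>\<close>

text \<open>Vandermonde: pair the power sums with the polynomial that vanishes at all nodes but one.\<close>

lemma power_sums_independent: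
  fixes c x :: "'i \<Rightarrow> 'f::field"
  assumes "finite S" "inj_on x S" and sums: "\<And>m. (\<Sum>j\<in>S. c j * x j ^ m) = 0" and i: "i \<in> S"
  shows "c i = 0"
proof -
  define p where "p = (\<Prod>a\<in>S - {i}. [:- x a, 1:])"
  have "(\<Sum>j\<in>S. c j * poly p (x j)) = (\<Sum>j\<in>S. \<Sum>m\<le>degree p. coeff p m * (c j * x j ^ m))"
    by (simp add: poly_altdef sum_distrib_left mult_ac)
  also have "\<dots> = (\<Sum>m\<le>degree p. coeff p m * (\<Sum>j\<in>S. c j * x j ^ m))"
    by (subst sum.swap) (simp add: sum_distrib_left)
  also have "\<dots> = 0" by (simp add: sums)
  finally have "0 = (\<Sum>j\<in>S. c j * poly p (x j))" by simp
  also have "\<dots> = c i * poly p (x i) + (\<Sum>j\<in>S - {i}. c j * poly p (x j))"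
    using assms by (intro sum.remove)
  also have "(\<Sum>j\<in>S - {i}. c j * poly p (x j)) = 0"
  proof (intro sum.neutral ballI)
    fix j assume "j \<in> S - {i}"
    then have "poly p (x j) = 0"
      unfolding p_def poly_prod using assms(1) by (intro prod_zero) auto
    then show "c j * poly p (x j) = 0" by simp
  qed
  finally have "c i * poly p (x i) = 0" by simp
  moreover have "poly p (x i) \<noteq> 0"
    unfolding p_def poly_prod using assms by (auto simp: inj_on_def)
  ultimately show ?thesis by simp
qed

text \<open>By the functional equation, a step to the left divides by \<open>w - r - 1\<close>, which has modulus at
  least \<open>1\<close> from some \<open>r\<close> on.\<close>

lemma Gamma_shift_bounded:
  fixes w :: complex
  assumes "w \<notin> \<int>"
  shows "\<exists>C. \<forall>r. norm (Gamma (w - of_nat r)) \<le> C"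
proof -
  define N where "N = nat \<lceil>norm w\<rceil>"
  define G where "G r = norm (Gamma (w - of_nat r))" for r
  have N: "norm w \<le> real N" unfolding N_def by linarith
  have step: "G (Suc r) \<le> G r" if r: "r \<ge> N" for r
  proof -
    let ?x = "w - of_nat (Suc r)"
    have "?x \<notin> \<int>" using assms by (metis Ints_add Ints_of_nat diff_add_cancel)
    then have "Gamma (?x + 1) = ?x * Gamma ?x"
      by (intro Gamma_plus1) (use nonpos_Ints_subset_Ints in auto)
    then have "G r = norm ?x * G (Suc r)"
      unfolding G_def by (simp add: norm_mult)
    moreover have "norm ?x \<ge> 1"
    proof -
      have "norm (of_nat (Suc r) :: complex) - norm w \<le> norm (of_nat (Suc r) - w)"
        by (rule norm_triangle_ineq2)
      then show ?thesis using N r by (simp add: norm_minus_commute del: of_nat_Suc)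
    qed
    moreover have "G (Suc r) \<ge> 0" by (simp add: G_def)
    ultimately show ?thesis using mult_right_mono[of 1 "norm ?x" "G (Suc r)"] by simp
  qed
  have "G r \<le> (\<Sum>k\<le>N. G k)" for r
  proof (induction r)
    case 0
    show ?case by (rule member_le_sum) (simp_all add: G_def)
  next
    case (Suc r)
    show ?case
    proof (cases "Suc r \<le> N")
      case True
      then show ?thesis by (intro member_le_sum) (simp_all add: G_def)
    next
      case False
      then show ?thesis using step[of r] Suc by simp
    qed
  qed
  then show ?thesis unfolding G_def by blast
qed

text \<open>Up to sign and the exponential factor, the residue of \<open>\<Phi>\<close> at \<open>t = z\<^sub>J + r\<close>.\<close>

definition res_coeff :: "nat \<Rightarrow> (nat \<Rightarrow> complex) \<Rightarrow> nat \<Rightarrow> nat \<Rightarrow> complex" where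
  "res_coeff n z J r = (-1) ^ r / fact r * (\<Prod>a\<in>{1..n} - {J}. Gamma (z a - z J - of_nat r))"

definition log_p :: "nat \<Rightarrow> (complex \<Rightarrow> real) \<Rightarrow> complex \<Rightarrow> complex" where
  "log_p n \<alpha> p = of_real pi * \<i> * (2 - of_nat n) + of_real (ln (norm p)) + \<i> * of_real (\<alpha> p)"

lemma L_dom_diff: "z \<in> L_dom n \<Longrightarrow> a \<in> {1..n} \<Longrightarrow> b \<in> {1..n} \<Longrightarrow> a \<noteq> b \<Longrightarrow> z a - z b \<notin> \<int>"
  by (auto simp: L_dom_def)

text \<open>Among the Gamma factors only \<open>Gamma (z\<^sub>J - t)\<close> has a pole at \<open>z\<^sub>J + r\<close>, because
  \<open>z\<^sub>a - z\<^sub>J\<close> is no integer for \<open>a \<noteq> J\<close>; the sign is that of \<open>t\<close> in \<open>z\<^sub>J - t\<close>.\<close>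

lemma residue_Phi:
  assumes z: "z \<in> L_dom n" and J: "J \<in> {1..n}"
  shows "residue (\<lambda>t. Phi n \<alpha> z p t * t ^ i) (z J + of_nat r) =
    - (res_coeff n z J r * exp ((z J + of_nat r) * log_p n \<alpha> p) * (z J + of_nat r) ^ i)"
proof -
  define t0 where "t0 = z J + of_nat r"
  define g where "g t = exp (t * log_p n \<alpha> p) * (\<Prod>a\<in>{1..n} - {J}. Gamma (z a - t)) * t ^ i" for t
  have Phi: "Phi n \<alpha> z p t * t ^ i = g t * Gamma (z J - t)" for t
    unfolding Phi_def g_def log_p_def using J by (subst prod.remove[of _ J]) (auto simp: mult_ac)
  have ana: "g analytic_on {t0}"
    unfolding g_def
  proof (intro analytic_intros ballI)
    fix a t assume a: "a \<in> {1..n} - {J}" and t: "t \<in> {t0}"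
    have "z a - t \<notin> \<int>"
      using L_dom_diff[OF z _ J, of a] a t unfolding t0_def
      by (metis Diff_iff Ints_add Ints_of_nat diff_add_cancel diff_diff_eq insertCI singletonD)
    then show "z a - t \<notin> \<int>\<^sub>\<le>\<^sub>0" using nonpos_Ints_subset_Ints by blast
  qed
  then obtain e where e: "e > 0" "g holomorphic_on ball t0 e"
    by (auto simp: analytic_on_def)
  define s where "s = ball t0 (min e 1)"
  have "residue (\<lambda>t. g t * Gamma (z J - t)) t0 = g t0 * (- ((-1) ^ r / fact r))"
  proof (rule residue_simple')
    show "open s" "t0 \<in> s" using e by (auto simp: s_def)
    show "(\<lambda>t. g t * Gamma (z J - t)) holomorphic_on (s - {t0})"
    proof (intro holomorphic_intros)
      show "g holomorphic_on s - {t0}"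
        using e(2) by (rule holomorphic_on_subset) (auto simp: s_def)
      fix t assume t: "t \<in> s - {t0}"
      show "z J - t \<notin> \<int>\<^sub>\<le>\<^sub>0"
      proof
        assume "z J - t \<in> \<int>\<^sub>\<le>\<^sub>0"
        then obtain m where "z J - t = - of_nat m" by (auto elim!: nonpos_Ints_cases')
        then have m: "t = z J + of_nat m" by (simp add: algebra_simps)
        then have "dist t0 t = norm (of_int (int r - int m) :: complex)"
          by (simp add: t0_def dist_norm)
        moreover have "dist t0 t < 1" "t \<noteq> t0" using t by (auto simp: s_def)
        ultimately have "\<bar>int r - int m\<bar> < 1" "r \<noteq> m"
          using m unfolding norm_of_int by (auto simp: t0_def)
        then show False by auto
      qed
    qed
    have "((\<lambda>t. Gamma (z J - t) * ((z J - t) + of_nat r)) \<longlongrightarrow> (-1) ^ r / fact r) (at t0)"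
    proof (rule filterlim_compose[OF Gamma_residues[of r]])
      have "((\<lambda>t. z J - t) \<longlongrightarrow> z J - t0) (at t0)" by (intro tendsto_intros)
      then show "LIM t at t0. z J - t :> at (- of_nat r)"
        unfolding filterlim_at by (auto simp: t0_def eventually_at_filter algebra_simps)
    qed
    moreover have "(g \<longlongrightarrow> g t0) (at t0)"
    proof -
      have "continuous_on (ball t0 e) g" using e(2) by (rule holomorphic_on_imp_continuous_on)
      then have "isCont g t0" using e(1) by (simp add: continuous_on_eq_continuous_at)
      then show ?thesis by (simp add: isCont_def)
    qed
    ultimately have "((\<lambda>t. g t * - (Gamma (z J - t) * ((z J - t) + of_nat r))) \<longlongrightarrow>
        g t0 * - ((-1) ^ r / fact r)) (at t0)"
      by (intro tendsto_intros)
    moreover have "g t * Gamma (z J - t) * (t - t0) = g t * - (Gamma (z J - t) * ((z J - t) + of_nat r))" for t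
      by (simp add: t0_def algebra_simps)
    ultimately show "((\<lambda>t. g t * Gamma (z J - t) * (t - t0)) \<longlongrightarrow> g t0 * - ((-1) ^ r / fact r)) (at t0)"
      by simp
  qed
  also have "g t0 * - ((-1) ^ r / fact r) =
      - (res_coeff n z J r * exp (t0 * log_p n \<alpha> p) * t0 ^ i)"
    by (simp add: g_def res_coeff_def t0_def diff_diff_eq mult_ac)
  finally show ?thesis unfolding Phi t0_def .
qed

text \<open>The Gamma factors are bounded and the power of \<open>z\<^sub>J + r\<close> grows at most like \<open>exp r\<close>, so the
  factor \<open>1 / r!\<close> makes the series converge for all \<open>q\<close>.\<close>

lemma summable_res_coeff:
  assumes z: "z \<in> L_dom n" and J: "J \<in> {1..n}"
  shows "summable (\<lambda>r. res_coeff n z J r * (z J + of_nat r) ^ i * q ^ r)"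
proof -
  have "\<forall>a\<in>{1..n} - {J}. \<exists>C. \<forall>r. norm (Gamma (z a - z J - of_nat r)) \<le> C"
    using L_dom_diff[OF z _ J] by (intro ballI Gamma_shift_bounded) auto
  then obtain C where C: "\<And>a r. a \<in> {1..n} - {J} \<Longrightarrow> norm (Gamma (z a - z J - of_nat r)) \<le> C a"
    by metis
  define B where "B = (\<Prod>a\<in>{1..n} - {J}. C a) * (fact i * exp (norm (z J)))"
  have C0: "(\<Prod>a\<in>{1..n} - {J}. C a) \<ge> 0"
    by (intro prod_nonneg ballI) (use C norm_ge_zero order_trans in blast)
  have bound: "norm (res_coeff n z J r * (z J + of_nat r) ^ i * q ^ r) \<le>
      B * ((exp 1 * norm q) ^ r / fact r)" for r
  proof -
    have "norm (\<Prod>a\<in>{1..n} - {J}. Gamma (z a - z J - of_nat r)) \<le> (\<Prod>a\<in>{1..n} - {J}. C a)"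
      unfolding prod_norm[symmetric] by (rule prod_mono) (use C in auto)
    moreover have "norm ((z J + of_nat r) ^ i) \<le> fact i * exp (norm (z J)) * exp 1 ^ r"
    proof -
      let ?x = "norm (z J) + real r"
      have "norm (z J + of_nat r) \<le> ?x" by (metis norm_of_nat norm_triangle_ineq)
      then have "norm ((z J + of_nat r) ^ i) \<le> ?x ^ i"
        unfolding norm_power by (intro power_mono) auto
      also have "\<dots> = fact i * (?x ^ i / fact i)" by simp
      also have "?x ^ i / fact i \<le> exp ?x"
      proof -
        \<comment> \<open>a single term of the exponential series\<close>
        have "(\<Sum>k\<in>{i}. ?x ^ k /\<^sub>R fact k) \<le> suminf (\<lambda>k. ?x ^ k /\<^sub>R fact k)"
          by (intro sum_le_suminf summable_exp_generic) (auto intro!: divide_nonneg_nonneg simp: field_simps)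
        then show ?thesis by (simp add: exp_def divide_inverse mult.commute)
      qed
      also have "exp ?x = exp (norm (z J)) * exp 1 ^ r"
        by (simp add: exp_add flip: exp_of_nat_mult)
      finally show ?thesis by (simp add: mult_ac)
    qed
    ultimately have "norm (\<Prod>a\<in>{1..n} - {J}. Gamma (z a - z J - of_nat r)) * norm ((z J + of_nat r) ^ i)
        \<le> (\<Prod>a\<in>{1..n} - {J}. C a) * (fact i * exp (norm (z J)) * exp 1 ^ r)"
      by (intro mult_mono C0) auto
    then have "norm (\<Prod>a\<in>{1..n} - {J}. Gamma (z a - z J - of_nat r)) * norm ((z J + of_nat r) ^ i) *
        (norm q ^ r / fact r) \<le> (\<Prod>a\<in>{1..n} - {J}. C a) * (fact i * exp (norm (z J)) * exp 1 ^ r) *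
        (norm q ^ r / fact r)"
      by (rule mult_right_mono) simp
    then show ?thesis
      by (simp add: res_coeff_def norm_mult norm_divide norm_power B_def power_mult_distrib mult_ac)
  qed
  have "summable (\<lambda>r. B * ((exp 1 * norm q) ^ r / fact r))"
    using summable_exp_generic[of "exp 1 * norm q"]
    by (intro summable_mult) (simp add: divide_inverse mult.commute)
  then show ?thesis
    by (rule summable_comparison_test'[where N = 0]) (use bound in auto)
qed

text \<open>A relation between functions \<open>p\<^sup>z\<^sup>J F\<^sub>J(p)\<close> with entire \<open>F\<^sub>J\<close> extends to all branches of
  \<open>log p\<close>. Going round the origin multiplies the \<open>J\<close>-th term by \<open>exp (2 \<pi> \<i> z\<^sub>J)\<close>; since these
  factors are distinct, each term vanishes on its own.\<close>

lemma monodromy_independence: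
  assumes "finite S" and dist: "\<And>a b. a \<in> S \<Longrightarrow> b \<in> S \<Longrightarrow> a \<noteq> b \<Longrightarrow> z a - z b \<notin> \<int>"
    and f: "\<And>J q. J \<in> S \<Longrightarrow> summable (\<lambda>r. f J r * q ^ r)"
    and D: "arg_branch D \<alpha>"
    and rel: "\<And>p. p \<in> D \<Longrightarrow>
      (\<Sum>J\<in>S. c J * exp (z J * log_p n \<alpha> p) * suminf (\<lambda>r. f J r * exp (log_p n \<alpha> p) ^ r)) = 0"
    and I: "I \<in> S"
  shows "c I * f I 0 = (0::complex)"
proof -
  define F where "F J q = suminf (\<lambda>r. f J r * q ^ r)" for J and q :: complex
  have DF: "\<exists>d. (F J has_field_derivative d) (at q)" if "J \<in> S" for J q
    unfolding F_def using termdiffs_strong_converges_everywhere[OF f[OF that]] by blast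
  have holF: "F J holomorphic_on UNIV" if "J \<in> S" for J
    unfolding holomorphic_on_def field_differentiable_def using DF[OF that] by simp
  define G where "G s = (\<Sum>J\<in>S. c J * exp (z J * s) * F J (exp s))" for s
  have holG: "G holomorphic_on UNIV"
  proof -
    have "(\<lambda>s. F J (exp s)) holomorphic_on UNIV" if "J \<in> S" for J
      using holomorphic_on_compose[OF holomorphic_on_exp, of "F J" UNIV]
        holomorphic_on_subset[OF holF[OF that], of "exp ` UNIV"] by (simp add: o_def)
    then show ?thesis unfolding G_def by (intro holomorphic_intros) auto
  qed
  obtain p0 where p0: "p0 \<in> D" using D by (auto simp: arg_branch_def)
  have exp_log: "exp (log_p n \<alpha> p) = exp (of_real pi * \<i> * (2 - of_nat n)) * p" if "p \<in> D" for p
  proof -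
    have "p \<noteq> 0" "p = of_real (norm p) * cis (\<alpha> p)" using D that by (auto simp: arg_branch_def)
    then have "exp (of_real (ln (norm p)) + \<i> * of_real (\<alpha> p)) = p"
      by (simp add: exp_add exp_of_real cis_conv_exp)
    then show ?thesis by (simp add: log_p_def exp_add mult.assoc)
  qed
  have islim: "log_p n \<alpha> p0 islimpt log_p n \<alpha> ` D"
    unfolding islimpt_approachable
  proof (intro allI impI)
    fix e :: real assume e: "e > 0"
    have "continuous_on D (log_p n \<alpha>)"
      unfolding log_p_def using D by (intro continuous_intros) (auto simp: arg_branch_def)
    then obtain d where d: "d > 0" "\<And>p. p \<in> D \<Longrightarrow> dist p p0 < d \<Longrightarrow> dist (log_p n \<alpha> p) (log_p n \<alpha> p0) < e"
      using p0 e unfolding continuous_on_iff by blast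
    have "p0 islimpt D"
      using D p0 by (auto simp: arg_branch_def intro: interior_limit_point simp: interior_open)
    then obtain p where p: "p \<in> D" "p \<noteq> p0" "dist p p0 < d"
      using d(1) unfolding islimpt_approachable by blast
    have "log_p n \<alpha> p \<noteq> log_p n \<alpha> p0"
      using exp_log[OF p(1)] exp_log[OF p0] p(2) by auto
    then show "\<exists>x'\<in>log_p n \<alpha> ` D. x' \<noteq> log_p n \<alpha> p0 \<and> dist x' (log_p n \<alpha> p0) < e"
      using d(2)[OF p(1,3)] p(1) by blast
  qed
  have G0: "G s = 0" for s
  proof (rule analytic_continuation[OF holG open_UNIV connected_UNIV subset_UNIV UNIV_I islim _ UNIV_I])
    fix s assume "s \<in> log_p n \<alpha> ` D"
    then show "G s = 0" using rel by (auto simp: G_def F_def)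
  qed
  have term0: "c I * exp (z I * s) * F I (exp s) = 0" for s
  proof (rule power_sums_independent[OF assms(1), where x = "\<lambda>J. exp (z J * (2 * of_real pi * \<i>))"])
    show "inj_on (\<lambda>J. exp (z J * (2 * of_real pi * \<i>))) S"
    proof (rule inj_onI, rule ccontr)
      fix a b assume ab: "a \<in> S" "b \<in> S" "a \<noteq> b"
        and "exp (z a * (2 * of_real pi * \<i>)) = exp (z b * (2 * of_real pi * \<i>))"
      then obtain m :: int where "z a * (2 * of_real pi * \<i>) = z b * (2 * of_real pi * \<i>) + of_int (2 * m) * of_real pi * \<i>"
        by (auto simp: exp_eq)
      then have "(z a - z b - of_int m) * (2 * of_real pi * \<i>) = 0"
        by (simp add: algebra_simps)
      then have "z a - z b = of_int m" by simp
      then show False using dist[OF ab] by auto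
    qed
    fix m :: nat
    have "exp (s + of_nat m * (2 * of_real pi * \<i>)) = exp s"
      by (simp add: exp_add exp_of_nat_mult)
    moreover have "exp (z J * (s + of_nat m * (2 * of_real pi * \<i>))) = exp (z J * s) * exp (z J * (2 * of_real pi * \<i>)) ^ m" for J
      by (simp add: exp_add algebra_simps flip: exp_of_nat_mult)
    ultimately show "(\<Sum>J\<in>S. c J * exp (z J * s) * F J (exp s) * exp (z J * (2 * of_real pi * \<i>)) ^ m) = 0"
      using G0[of "s + of_nat m * (2 * of_real pi * \<i>)"] by (simp add: G_def mult_ac)
  qed (rule I)
  have cF: "c I * F I q = 0" if "q \<noteq> 0" for q
    using term0[of "ln q"] that by simp
  have "isCont (F I) 0" using DF[OF I, of 0] DERIV_isCont by blast
  then have "((\<lambda>q. c I * F I q) \<longlongrightarrow> c I * F I 0) (at 0)"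
    unfolding isCont_def by (intro tendsto_intros)
  moreover have "((\<lambda>q. c I * F I q) \<longlongrightarrow> 0) (at 0)"
    by (rule tendsto_eventually, unfold eventually_at_filter, rule always_eventually) (blast intro: cF)
  ultimately have "c I * F I 0 = 0" by (rule tendsto_unique[OF trivial_limit_at])
  moreover have "F I 0 = f I 0" unfolding F_def by (rule powser_zero)
  ultimately show ?thesis by simp
qed

text \<open>Restrict to a point whose coordinates are powers \<open>exp (k y\<^sup>a)\<close>, with \<open>y\<close> chosen so that
  the finitely many monomials of \<open>q\<close> take different values; then vary \<open>k\<close>.\<close>

lemma Laurent_eq_0_if_vanishes:
  assumes q: "q \<in> Laurent n" and van: "\<And>z. z \<in> L_dom n \<Longrightarrow> eval_Z (Z_acute z) q = 0"
  shows "q = 0"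
proof -
  define K where "K = keys q"
  have K: "finite K" "\<And>m. m \<in> K \<Longrightarrow> keys m \<subseteq> {1..n}"
    using q by (auto simp: K_def Laurent_def)
  define P where "P m m' = (\<Sum>a\<in>{1..n}. monom (of_int (lookup m a - lookup m' a) :: real) a)"
    for m m' :: "nat \<Rightarrow>\<^sub>0 int"
  have P: "P m m' \<noteq> 0" if mm: "m \<in> K" "m' \<in> K" "m \<noteq> m'" for m m'
  proof -
    obtain a where a: "lookup m a \<noteq> lookup m' a"
      using mm(3) by (metis poly_mapping_eqI)
    then have "a \<in> keys m \<union> keys m'" by (auto simp: in_keys_iff)
    then have "a \<in> {1..n}" using K(2) mm by blast
    then have "coeff (P m m') a = of_int (lookup m a - lookup m' a)"
      by (simp add: P_def coeff_sum)
    then show ?thesis using a by auto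
  qed
  define U where "U = (\<Union>m\<in>K. \<Union>m'\<in>K - {m}. {y. poly (P m m') y = 0})"
  have "finite U"
    unfolding U_def using K(1) P by (intro finite_UN_I) (auto intro: poly_roots_finite)
  then have "\<not> {1::real<..} \<subseteq> U"
    using finite_subset infinite_Ioi by blast
  then obtain y where "y > 1" "y \<notin> U" by auto
  then have y: "y > 1" "\<And>m m'. m \<in> K \<Longrightarrow> m' \<in> K \<Longrightarrow> m \<noteq> m' \<Longrightarrow> poly (P m m') y \<noteq> 0"
    by (auto simp: U_def)
  define e where "e m = (\<Sum>a\<in>{1..n}. of_int (lookup m a) * y ^ a)" for m :: "nat \<Rightarrow>\<^sub>0 int"
  have e_diff: "e m - e m' = poly (P m m') y" for m m'
    by (simp add: e_def P_def poly_sum poly_monom left_diff_distrib sum_subtractf)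
  have inj: "inj_on (\<lambda>m. exp (complex_of_real (e m))) K"
  proof (rule inj_onI, rule ccontr)
    fix m m' assume mm: "m \<in> K" "m' \<in> K" "m \<noteq> m'"
      and "exp (complex_of_real (e m)) = exp (complex_of_real (e m'))"
    then have "e m = e m'" by (simp add: exp_of_real)
    then show False using y(2)[OF mm] e_diff[of m m'] by simp
  qed
  have "lookup q m = 0" if m: "m \<in> K" for m
  proof -
    have "lookup q m * exp (complex_of_real (e m)) = 0"
    proof (rule power_sums_independent[OF K(1) inj _ m, where c = "\<lambda>m. lookup q m * exp (complex_of_real (e m))"])
      fix k :: nat
      define z where "z = (\<lambda>a\<in>{1..n}. complex_of_real (real (Suc k) * y ^ a / (2 * pi)) / \<i>)"
      have "z \<in> L_dom n"
        unfolding L_dom_def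
      proof (intro CollectI conjI ballI impI)
        show "z \<in> {1..n} \<rightarrow>\<^sub>E UNIV" by (auto simp: z_def)
        fix a b assume ab: "a \<in> {1..n}" "b \<in> {1..n}" "a \<noteq> b"
        have zz: "z a - z b = complex_of_real (real (Suc k) * (y ^ a - y ^ b) / (2 * pi)) / \<i>"
          using ab by (simp only: z_def restrict_apply' right_diff_distrib diff_divide_distrib of_real_diff)
        have "y ^ a \<noteq> y ^ b" using y(1) ab(3) by simp
        then have "Im (z a - z b) \<noteq> 0" unfolding zz by simp
        then show "z a - z b \<notin> \<int>"
          by (metis Ints_cases complex_Im_of_int)
      qed
      then have "0 = eval_Z (Z_acute z) q" using van by simp
      also have "\<dots> = (\<Sum>m\<in>K. lookup q m * exp (complex_of_real (e m)) * exp (complex_of_real (e m)) ^ k)"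
        unfolding eval_Z_def K_def[symmetric]
      proof (rule sum.cong[OF HOL.refl])
        fix m assume m: "m \<in> K"
        have "(\<Prod>a\<in>keys m. Z_acute z a powi lookup m a) =
            (\<Prod>a\<in>{1..n}. Z_acute z a powi lookup m a)"
          using K(2)[OF m]
          by (intro monomial_value_superset[where val = "\<lambda>a i. Z_acute z a powi i"]) auto
        also have "\<dots> = (\<Prod>a\<in>{1..n}. exp (complex_of_real (real (Suc k) * (of_int (lookup m a) * y ^ a))))"
        proof (rule prod.cong[OF HOL.refl])
          fix a assume a: "a \<in> {1..n}"
          have "Z_acute z a = exp (complex_of_real (real (Suc k) * y ^ a))"
            using a by (simp add: Z_acute_def z_def)
          then show "Z_acute z a powi lookup m a =
              exp (complex_of_real (real (Suc k) * (of_int (lookup m a) * y ^ a)))"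
            by (simp add: exp_power_int mult_ac)
        qed
        also have "\<dots> = exp (\<Sum>a\<in>{1..n}. complex_of_real (real (Suc k) * (of_int (lookup m a) * y ^ a)))"
          by (rule exp_sum[symmetric]) simp
        also have "(\<Sum>a\<in>{1..n}. complex_of_real (real (Suc k) * (of_int (lookup m a) * y ^ a))) =
            of_nat (Suc k) * complex_of_real (e m)"
          by (simp add: e_def sum_distrib_left)
        also have "exp \<dots> = exp (complex_of_real (e m)) * exp (complex_of_real (e m)) ^ k"
          by (simp only: exp_of_nat_mult power_Suc)
        finally show "lookup q m * (\<Prod>a\<in>keys m. Z_acute z a powi lookup m a) =
            lookup q m * exp (complex_of_real (e m)) * exp (complex_of_real (e m)) ^ k"
          by simp
      qed
      finally show "(\<Sum>m\<in>K. lookup q m * exp (complex_of_real (e m)) * exp (complex_of_real (e m)) ^ k) = 0"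
        by simp
    qed
    then show ?thesis by simp
  qed
  then show ?thesis
    by (intro poly_mapping_eqI) (auto simp: K_def in_keys_iff)
qed

text \<open>The polynomial representing \<open>\<Psi>\<^sub>J\<close>.\<close>

definition psi_rep :: "nat \<Rightarrow> (complex \<Rightarrow> real) \<Rightarrow> nat \<Rightarrow> (nat \<Rightarrow> complex) \<Rightarrow> complex \<Rightarrow> hpoly" where
  "psi_rep n \<alpha> J z p = (\<Sum>i<n. hC (- suminf (\<lambda>r. residue (\<lambda>t. Phi n \<alpha> z p t * t ^ i) (z J + of_nat r))) *
             coeff (W_poly n) i)"

lemma psi_rep_in_Hpoly: "psi_rep n \<alpha> J z p \<in> Hpoly n"
  unfolding psi_rep_def by (intro Hpoly_sum Hpoly_mult hC_in_Hpoly coeff_W_poly_in_Hpoly)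

lemma Psi_J_eq: "Psi_J n \<alpha> J (z, p) = H_class n z (psi_rep n \<alpha> J z p)"
  by (simp add: Psi_J_def psi_rep_def)

text \<open>The restriction of \<open>\<Psi>\<^sub>J\<close> to the fixed point \<open>I\<close> is \<open>exp (z\<^sub>J log_p)\<close> times the power series in
  \<open>exp log_p\<close> with these coefficients.\<close>

definition fixed_coeff :: "nat \<Rightarrow> (nat \<Rightarrow> complex) \<Rightarrow> nat \<Rightarrow> nat \<Rightarrow> nat \<Rightarrow> complex" where
  "fixed_coeff n z I J r = res_coeff n z J r * (\<Prod>a\<in>{1..n} - {I}. z a - z J - of_nat r)"

lemma W_at_fixed_point:
  assumes I: "I \<in> {1..n}"
  shows "(\<Sum>i<n. at_fixed_point z I (coeff (W_poly n) i) * t ^ i) = (\<Prod>a\<in>{1..n} - {I}. z a - t)"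
proof -
  define w where "w = (\<Prod>j=1..n-1. [:z (skip I j), -1:])"
  have "at_fixed_point z I (coeff (W_poly n) i) = coeff w i" for i
    unfolding W_poly_def coeff_at_fixed_point_prod w_def
    by (simp add: at_fixed_point_vars at_fixed_point_uminus at_fixed_point_1)
  then have "(\<Sum>i<n. at_fixed_point z I (coeff (W_poly n) i) * t ^ i) = (\<Sum>i<n. coeff w i * t ^ i)"
    by simp
  also have "\<dots> = poly w t"
  proof -
    have "degree w = (\<Sum>j=1..n-1. degree [:z (skip I j), -1:])"
      unfolding w_def by (rule degree_prod_eq_sum_degree) simp
    then have "degree w < n" using I by simp
    then show ?thesis
      unfolding poly_altdef by (intro sum.mono_neutral_right) (auto simp: coeff_eq_0)
  qed
  also have "\<dots> = (\<Prod>j=1..n-1. z (skip I j) - t)"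
    by (simp add: w_def poly_prod)
  also have "\<dots> = (\<Prod>a\<in>{1..n} - {I}. z a - t)"
    by (rule prod.reindex_bij_betw[OF bij_betw_skip[OF I]])
  finally show ?thesis .
qed

lemma summable_fixed_coeff:
  assumes z: "z \<in> L_dom n" and I: "I \<in> {1..n}" and J: "J \<in> {1..n}"
  shows "summable (\<lambda>r. fixed_coeff n z I J r * q ^ r)"
proof -
  have "fixed_coeff n z I J r * q ^ r = (\<Sum>i<n. at_fixed_point z I (coeff (W_poly n) i) *
      (res_coeff n z J r * (z J + of_nat r) ^ i * q ^ r))" for r
  proof -
    have "fixed_coeff n z I J r = res_coeff n z J r *
        (\<Sum>i<n. at_fixed_point z I (coeff (W_poly n) i) * (z J + of_nat r) ^ i)"
      by (simp only: fixed_coeff_def diff_diff_eq W_at_fixed_point[OF I])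
    then show ?thesis by (simp add: sum_distrib_left sum_distrib_right mult_ac)
  qed
  then show ?thesis
    using summable_res_coeff[OF z J] by (simp add: summable_sum summable_mult)
qed

text \<open>At a fixed point the coefficients of \<open>W\<close> are numbers, so the series that were formed separately
  for each power of \<open>t\<close> recombine.\<close>

lemma psi_rep_at_fixed_point:
  assumes z: "z \<in> L_dom n" and I: "I \<in> {1..n}" and J: "J \<in> {1..n}"
  shows "at_fixed_point z I (psi_rep n \<alpha> J z p) = exp (z J * log_p n \<alpha> p) *
    suminf (\<lambda>r. fixed_coeff n z I J r * exp (log_p n \<alpha> p) ^ r)"
proof -
  define E where "E = exp (log_p n \<alpha> p)"
  define w where "w i = at_fixed_point z I (coeff (W_poly n) i)" for i
  define s where "s i r = res_coeff n z J r * (z J + of_nat r) ^ i * E ^ r" for i r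
  have res: "residue (\<lambda>t. Phi n \<alpha> z p t * t ^ i) (z J + of_nat r) = - (exp (z J * log_p n \<alpha> p) * s i r)" for i r
  proof -
    have "exp ((z J + of_nat r) * log_p n \<alpha> p) = exp (z J * log_p n \<alpha> p) * E ^ r"
      by (simp add: E_def distrib_right exp_add exp_of_nat_mult)
    then show ?thesis
      unfolding residue_Phi[OF z J] s_def by simp
  qed
  have summ: "summable (s i)" for i
    unfolding s_def by (rule summable_res_coeff[OF z J])
  have "suminf (\<lambda>r. residue (\<lambda>t. Phi n \<alpha> z p t * t ^ i) (z J + of_nat r)) =
      - (exp (z J * log_p n \<alpha> p) * suminf (s i))" for i
    unfolding res using summ[of i] by (simp add: suminf_minus suminf_mult summable_mult)
  then have "at_fixed_point z I (psi_rep n \<alpha> J z p) =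
      exp (z J * log_p n \<alpha> p) * (\<Sum>i<n. w i * suminf (s i))"
    by (simp add: psi_rep_def at_fixed_point_sum at_fixed_point_mult at_fixed_point_vars w_def
        sum_distrib_left mult_ac)
  also have "(\<Sum>i<n. w i * suminf (s i)) = (\<Sum>i<n. suminf (\<lambda>r. w i * s i r))"
    using summ by (simp add: suminf_mult)
  also have "\<dots> = suminf (\<lambda>r. \<Sum>i<n. w i * s i r)"
    using summ by (intro suminf_sum[symmetric] summable_mult)
  also have "(\<lambda>r. \<Sum>i<n. w i * s i r) = (\<lambda>r. fixed_coeff n z I J r * E ^ r)"
  proof
    fix r
    have "(\<Sum>i<n. w i * s i r) = res_coeff n z J r * (\<Sum>i<n. w i * (z J + of_nat r) ^ i) * E ^ r"
      by (simp add: s_def sum_distrib_left sum_distrib_right mult_ac)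
    then show "(\<Sum>i<n. w i * s i r) = fixed_coeff n z I J r * E ^ r"
      unfolding w_def W_at_fixed_point[OF I] by (simp add: fixed_coeff_def diff_diff_eq)
  qed
  finally show ?thesis by (simp add: E_def)
qed

text \<open>The leading coefficient is \<open>\<Prod>\<^sub>a Gamma (z\<^sub>a - z\<^sub>I) (z\<^sub>a - z\<^sub>I)\<close> over \<open>a \<noteq> I\<close>, and \<open>z\<^sub>a - z\<^sub>I\<close> is neither
  zero nor a pole.\<close>

lemma fixed_coeff_nonzero:
  assumes z: "z \<in> L_dom n" and I: "I \<in> {1..n}"
  shows "fixed_coeff n z I I 0 \<noteq> 0"
proof -
  have "z a - z I \<noteq> 0" "Gamma (z a - z I) \<noteq> 0" if "a \<in> {1..n} - {I}" for a
  proof -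
    have *: "z a - z I \<notin> \<int>" using L_dom_diff[OF z _ I] that by auto
    then show "z a - z I \<noteq> 0" by auto
    from * have "z a - z I \<notin> \<int>\<^sub>\<le>\<^sub>0" using nonpos_Ints_subset_Ints by blast
    then show "Gamma (z a - z I) \<noteq> 0" by (rule Gamma_nonzero)
  qed
  then show ?thesis by (simp add: fixed_coeff_def res_coeff_def)
qed

text \<open>The coefficients of a vanishing combination are read off one at a time, at the fixed point
  with the same index.\<close>

lemma Psi_independent:
  assumes z: "z \<in> L_dom n" and D: "arg_branch D \<alpha>"
    and rel: "\<And>p. p \<in> D \<Longrightarrow> H_class n z (\<Sum>J\<in>{1..n}. hC (c J) * psi_rep n \<alpha> J z p) =
      H_class n z (\<Sum>J\<in>{1..n}. hC (d J) * psi_rep n \<alpha> J z p)"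
    and I: "I \<in> {1..n}"
  shows "c I = d I"
proof -
  have "(c I - d I) * fixed_coeff n z I I 0 = 0"
  proof (rule monodromy_independence[of "{1..n}" z "fixed_coeff n z I" D \<alpha> "\<lambda>J. c J - d J" n I])
    show "z a - z b \<notin> \<int>" if "a \<in> {1..n}" "b \<in> {1..n}" "a \<noteq> b" for a b
      using L_dom_diff[OF z that] .
    show "summable (\<lambda>r. fixed_coeff n z I J r * q ^ r)" if "J \<in> {1..n}" for J q
      by (rule summable_fixed_coeff[OF z I that])
    fix p assume p: "p \<in> D"
    have val: "at_fixed_point z I (\<Sum>J\<in>{1..n}. hC (e J) * psi_rep n \<alpha> J z p) =
      (\<Sum>J\<in>{1..n}. e J * (exp (z J * log_p n \<alpha> p) * suminf (\<lambda>r. fixed_coeff n z I J r * exp (log_p n \<alpha> p) ^ r)))" for e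
      unfolding at_fixed_point_sum
      by (intro sum.cong HOL.refl) (simp only: at_fixed_point_mult at_fixed_point_vars psi_rep_at_fixed_point[OF z I])
    have "at_fixed_point z I (\<Sum>J\<in>{1..n}. hC (c J) * psi_rep n \<alpha> J z p) =
        at_fixed_point z I (\<Sum>J\<in>{1..n}. hC (d J) * psi_rep n \<alpha> J z p)"
      by (rule H_class_eq_imp_at_fixed_point_eq[OF I _ _ rel[OF p]])
         (intro Hpoly_sum Hpoly_mult hC_in_Hpoly psi_rep_in_Hpoly)+
    then show "(\<Sum>J\<in>{1..n}. (c J - d J) * exp (z J * log_p n \<alpha> p) *
        suminf (\<lambda>r. fixed_coeff n z I J r * exp (log_p n \<alpha> p) ^ r)) = 0"
      unfolding val by (simp add: left_diff_distrib sum_subtractf mult.assoc)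
  qed (use D I in simp_all)
  then show ?thesis using fixed_coeff_nonzero[OF z I] by simp
qed

section \<open>The module of solutions\<close>

text \<open>Sums in the structures with explicit carriers are computed as sums in a type class, along an
  additive map \<open>h\<close>.\<close>

lemma finsum_hom:
  fixes h :: "'a::comm_monoid_add \<Rightarrow> 'b" and G (structure)
  assumes G: "abelian_monoid G" and h0: "h 0 = \<zero>" and closed: "\<And>x. x \<in> C \<Longrightarrow> h x \<in> carrier G"
    and add: "\<And>x y. x \<in> C \<Longrightarrow> y \<in> C \<Longrightarrow> h (x + y) = h x \<oplus> h y"
    and C: "0 \<in> C" "\<And>x y. x \<in> C \<Longrightarrow> y \<in> C \<Longrightarrow> x + y \<in> C"
    and I: "finite I" "\<And>i. i \<in> I \<Longrightarrow> f i \<in> C"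
  shows "(\<Oplus>i\<in>I. h (f i)) = h (\<Sum>i\<in>I. f i)"
proof -
  interpret abelian_monoid G by (rule G)
  have "(\<Oplus>i\<in>I. h (f i)) = h (\<Sum>i\<in>I. f i) \<and> (\<Sum>i\<in>I. f i) \<in> C"
    using I
  proof (induction I rule: finite_induct)
    case empty
    then show ?case by (simp add: h0 C)
  next
    case (insert i I)
    then have "(\<Oplus>i\<in>insert i I. h (f i)) = h (f i) \<oplus> (\<Oplus>i\<in>I. h (f i))"
      by (intro finsum_insert) (auto intro: closed)
    with insert show ?case by (simp add: add C)
  qed
  then show ?thesis by simp
qed

definition Theta_rep :: "nat \<Rightarrow> (complex \<Rightarrow> real) \<Rightarrow> (nat \<Rightarrow> laurent) \<Rightarrow> (nat \<Rightarrow> complex) \<Rightarrow> complex \<Rightarrow> hpoly" where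
  "Theta_rep n \<alpha> u z p = (\<Sum>J\<in>{1..n}. hC (eval_Z (Z_acute z) (u J)) * psi_rep n \<alpha> J z p)"

text \<open>The map \<open>\<theta>\<close> in terms of the values of a class at the roots:
  \<open>\<theta>(f) = \<Sum>\<^sub>J f(Z\<^sub>J, Z) \<Psi>\<^sub>J\<close>.\<close>

definition Theta :: "nat \<Rightarrow> complex set \<Rightarrow> (complex \<Rightarrow> real) \<Rightarrow> (nat \<Rightarrow> laurent) \<Rightarrow> hfun" where
  "Theta n D \<alpha> u = (\<lambda>(z, p)\<in>L_dom n \<times> D. H_class n z (Theta_rep n \<alpha> u z p))"

lemma hC_add: "hC (a + b) = hC a + hC b"
  by (simp add: hC_def single_add)

lemma hC_mult: "hC (a * b) = hC a * hC b"
  by (simp add: hC_def mult_single)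

lemma Theta_rep_in_Hpoly: "Theta_rep n \<alpha> u z p \<in> Hpoly n"
  unfolding Theta_rep_def by (intro Hpoly_sum Hpoly_mult hC_in_Hpoly psi_rep_in_Hpoly)

lemma Theta_rep_add: "Theta_rep n \<alpha> (u + w) z p = Theta_rep n \<alpha> u z p + Theta_rep n \<alpha> w z p"
  by (simp add: Theta_rep_def eval_Z_add hC_add distrib_right sum.distrib)

lemma Theta_rep_scale: "Theta_rep n \<alpha> (vscale c u) z p = hC (eval_Z (Z_acute z) c) * Theta_rep n \<alpha> u z p"
  by (simp add: Theta_rep_def vscale_def eval_Z_mult[OF Z_acute_nonzero] hC_mult sum_distrib_left mult.assoc)

lemma Theta_apply:
  "z \<in> L_dom n \<Longrightarrow> p \<in> D \<Longrightarrow> Theta n D \<alpha> u (z, p) = H_class n z (Theta_rep n \<alpha> u z p)"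
  by (simp add: Theta_def)

lemma abelian_group_H_ring: "abelian_group (H_ring n z)"
  by (rule ring.is_abelian_group[OF cring.axioms(1)[OF cring_H_ring]])

lemma fun_module_carrierI:
  assumes "\<And>z p. z \<in> L_dom n \<Longrightarrow> p \<in> D \<Longrightarrow> f z p \<in> carrier (H_ring n z)"
  shows "(\<lambda>(z, p)\<in>L_dom n \<times> D. f z p) \<in> carrier (fun_module n D)"
  using assms by (auto simp: fun_module_def)

lemma fun_module_carrierD:
  "v \<in> carrier (fun_module n D) \<Longrightarrow> z \<in> L_dom n \<Longrightarrow> p \<in> D \<Longrightarrow> v (z, p) \<in> carrier (H_ring n z)"
  by (fastforce simp: fun_module_def PiE_def Pi_def)

lemma fun_module_ext:
  assumes "v \<in> carrier (fun_module n D)" "w \<in> carrier (fun_module n D)"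
    and "\<And>z p. z \<in> L_dom n \<Longrightarrow> p \<in> D \<Longrightarrow> v (z, p) = w (z, p)"
  shows "v = w"
  using assms(1,2) unfolding fun_module_def partial_object.simps
  by (rule PiE_ext) (use assms(3) in auto)

lemma fun_module_add:
  "v \<oplus>\<^bsub>fun_module n D\<^esub> w = (\<lambda>(z, p)\<in>L_dom n \<times> D. v (z, p) \<oplus>\<^bsub>H_ring n z\<^esub> w (z, p))"
  by (simp add: fun_module_def)

lemma fun_module_zero: "\<zero>\<^bsub>fun_module n D\<^esub> = (\<lambda>(z, p)\<in>L_dom n \<times> D. \<zero>\<^bsub>H_ring n z\<^esub>)"
  by (simp add: fun_module_def)

lemma fun_module_smult:
  "c \<odot>\<^bsub>fun_module n D\<^esub> v =
   (\<lambda>(z, p)\<in>L_dom n \<times> D. H_class n z (hC (eval_Z (Z_acute z) c)) \<otimes>\<^bsub>H_ring n z\<^esub> v (z, p))"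
  by (simp add: fun_module_def)

lemma abelian_group_fun_module: "abelian_group (fun_module n D)" (is "abelian_group ?F")
proof -
  have H: "abelian_monoid (H_ring n z)" for z
    by (rule abelian_group.axioms(1)[OF abelian_group_H_ring])
  show ?thesis
  proof (rule abelian_groupI)
    fix x y assume xy: "x \<in> carrier (?F)" "y \<in> carrier (?F)"
    show add: "x \<oplus>\<^bsub>?F\<^esub> y \<in> carrier (?F)"
      unfolding fun_module_add
      by (intro fun_module_carrierI abelian_monoid.a_closed[OF H] fun_module_carrierD[OF xy(1)]
          fun_module_carrierD[OF xy(2)])
    show "x \<oplus>\<^bsub>?F\<^esub> y = y \<oplus>\<^bsub>?F\<^esub> x"
      unfolding fun_module_add
      by (rule restrict_ext, clarify)
         (rule abelian_monoid.a_comm[OF H fun_module_carrierD[OF xy(1)] fun_module_carrierD[OF xy(2)]])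
    fix w assume w: "w \<in> carrier (?F)"
    show "x \<oplus>\<^bsub>?F\<^esub> y \<oplus>\<^bsub>?F\<^esub> w = x \<oplus>\<^bsub>?F\<^esub> (y \<oplus>\<^bsub>?F\<^esub> w)"
      unfolding fun_module_add
      by (rule restrict_ext, clarify, simp only: restrict_apply' SigmaI prod.case)
         (rule abelian_monoid.a_assoc[OF H fun_module_carrierD[OF xy(1)] fun_module_carrierD[OF xy(2)]
            fun_module_carrierD[OF w]])
  next
    show zero: "\<zero>\<^bsub>?F\<^esub> \<in> carrier (?F)"
      unfolding fun_module_zero by (intro fun_module_carrierI abelian_monoid.zero_closed[OF H])
    fix x assume x: "x \<in> carrier (?F)"
    show "\<zero>\<^bsub>?F\<^esub> \<oplus>\<^bsub>?F\<^esub> x = x"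
    proof (rule fun_module_ext)
      show "\<zero>\<^bsub>?F\<^esub> \<oplus>\<^bsub>?F\<^esub> x \<in> carrier (?F)"
        unfolding fun_module_add
        by (intro fun_module_carrierI abelian_monoid.a_closed[OF H] fun_module_carrierD[OF zero]
            fun_module_carrierD[OF x])
      fix z p assume zp: "z \<in> L_dom n" "p \<in> D"
      then show "(\<zero>\<^bsub>?F\<^esub> \<oplus>\<^bsub>?F\<^esub> x) (z, p) = x (z, p)"
        by (simp add: fun_module_add fun_module_zero abelian_monoid.l_zero[OF H fun_module_carrierD[OF x zp]])
    qed (rule x)
    let ?y = "\<lambda>(z, p)\<in>L_dom n \<times> D. \<ominus>\<^bsub>H_ring n z\<^esub> x (z, p)"
    have y: "?y \<in> carrier (?F)" 
      by (intro fun_module_carrierI abelian_group.a_inv_closed[OF abelian_group_H_ring]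
          fun_module_carrierD[OF x])
    have "?y \<oplus>\<^bsub>?F\<^esub> x = \<zero>\<^bsub>?F\<^esub>"
      unfolding fun_module_add fun_module_zero
      by (rule restrict_ext, clarify, simp only: restrict_apply' SigmaI prod.case)
         (rule abelian_group.l_neg[OF abelian_group_H_ring fun_module_carrierD[OF x]])
    with y show "\<exists>y\<in>carrier (?F). y \<oplus>\<^bsub>?F\<^esub> x = \<zero>\<^bsub>?F\<^esub>" by blast
  qed
qed

lemma Theta_closed: "Theta n D \<alpha> u \<in> carrier (fun_module n D)"
  unfolding Theta_def by (intro fun_module_carrierI H_class_closed Theta_rep_in_Hpoly)

lemma Theta_add_fun: "Theta n D \<alpha> (u + w) = Theta n D \<alpha> u \<oplus>\<^bsub>fun_module n D\<^esub> Theta n D \<alpha> w"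
  unfolding fun_module_add Theta_def
  by (rule restrict_ext) (auto simp: Theta_rep_add H_class_add Theta_rep_in_Hpoly)

lemma Theta_zero_fun: "Theta n D \<alpha> 0 = \<zero>\<^bsub>fun_module n D\<^esub>"
proof -
  interpret abelian_group "fun_module n D" by (rule abelian_group_fun_module)
  have "Theta n D \<alpha> 0 \<oplus>\<^bsub>fun_module n D\<^esub> Theta n D \<alpha> 0 = Theta n D \<alpha> 0"
    unfolding Theta_add_fun[symmetric] by (simp only: add_0)
  then show ?thesis
    using Theta_closed[of n D \<alpha> 0] by (metis add.r_cancel_one)
qed

lemma Theta_scale_fun: "Theta n D \<alpha> (vscale c u) = c \<odot>\<^bsub>fun_module n D\<^esub> Theta n D \<alpha> u"
  unfolding fun_module_smult Theta_def
  by (rule restrict_ext) (auto simp: Theta_rep_scale H_class_mult Theta_rep_in_Hpoly hC_in_Hpoly)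

lemma H_class_zero: "H_class n z 0 = \<zero>\<^bsub>H_ring n z\<^esub>"
proof -
  interpret abelian_group "H_ring n z" by (rule abelian_group_H_ring)
  have "H_class n z 0 \<oplus>\<^bsub>H_ring n z\<^esub> H_class n z 0 = H_class n z 0"
    using H_class_add[OF Hpoly_0 Hpoly_0, of n z] by simp
  then show ?thesis
    using H_class_closed[OF Hpoly_0, of n z] by (metis add.r_cancel_one)
qed

text \<open>The factor \<open>exp (2 \<pi> \<i> (m - 1) z\<^sub>J)\<close> in \<open>\<Psi>\<^sup>m\<close> is the value of \<open>X\<^sup>m\<^sup>-\<^sup>1\<close> at the root \<open>Z\<^sub>J\<close>.\<close>

lemma Psi_eq_Theta: "Psi n D \<alpha> m = Theta n D \<alpha> (pvec n m)"
  unfolding Psi_def Theta_def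
proof (rule restrict_ext)
  fix x assume "x \<in> L_dom n \<times> D"
  then obtain z p where x: "x = (z, p)" by (cases x)
  interpret H: abelian_group "H_ring n z" by (rule abelian_group_H_ring)
  define c where "c J = hC (exp (2 * of_real pi * \<i> * of_int (m - 1) * z J))" for J
  have "(\<Oplus>\<^bsub>H_ring n z\<^esub>J\<in>{1..n}. H_class n z (c J) \<otimes>\<^bsub>H_ring n z\<^esub> Psi_J n \<alpha> J (z, p)) =
      (\<Oplus>\<^bsub>H_ring n z\<^esub>J\<in>{1..n}. H_class n z (c J * psi_rep n \<alpha> J z p))"
  proof (rule H.finsum_cong'[OF HOL.refl])
    show "(\<lambda>J. H_class n z (c J * psi_rep n \<alpha> J z p)) \<in> {1..n} \<rightarrow> carrier (H_ring n z)"
      unfolding c_def by (intro Pi_I H_class_closed Hpoly_mult hC_in_Hpoly psi_rep_in_Hpoly)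
    fix J show "H_class n z (c J) \<otimes>\<^bsub>H_ring n z\<^esub> Psi_J n \<alpha> J (z, p) = H_class n z (c J * psi_rep n \<alpha> J z p)"
      unfolding c_def Psi_J_eq by (rule H_class_mult[OF hC_in_Hpoly psi_rep_in_Hpoly, symmetric])
  qed
  also have "\<dots> = H_class n z (\<Sum>J\<in>{1..n}. c J * psi_rep n \<alpha> J z p)"
    by (rule finsum_hom[where C = "Hpoly n" and h = "H_class n z", OF H.abelian_monoid_axioms])
       (auto simp: H_class_zero H_class_closed H_class_add Hpoly_0 Hpoly_add c_def
         intro!: Hpoly_mult hC_in_Hpoly psi_rep_in_Hpoly)
  also have "(\<Sum>J\<in>{1..n}. c J * psi_rep n \<alpha> J z p) = Theta_rep n \<alpha> (pvec n m) z p"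
    unfolding Theta_rep_def
  proof (rule sum.cong[OF HOL.refl])
    fix J assume "J \<in> {1..n}"
    then have "eval_Z (Z_acute z) (pvec n m J) = exp (2 * of_real pi * \<i> * of_int (m - 1) * z J)"
      by (simp add: pvec_def eval_Z_Zpow Z_acute_def exp_power_int mult_ac)
    then show "c J * psi_rep n \<alpha> J z p = hC (eval_Z (Z_acute z) (pvec n m J)) * psi_rep n \<alpha> J z p"
      by (simp add: c_def)
  qed
  finally show "(case x of (z, p) \<Rightarrow> \<Oplus>\<^bsub>H_ring n z\<^esub>J\<in>{1..n}. H_class n z (hC (exp (2 * of_real pi * \<i> * of_int (m - 1) * z J)))
         \<otimes>\<^bsub>H_ring n z\<^esub> Psi_J n \<alpha> J (z, p)) = (case x of (z, p) \<Rightarrow> H_class n z (Theta_rep n \<alpha> (pvec n m) z p))"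
    by (simp add: x c_def)
qed

lemma carrier_sol_space: "carrier (sol_space n D \<alpha>) = Theta n D \<alpha> ` Kvec n"
proof -
  have "(\<Oplus>\<^bsub>fun_module n D\<^esub>m\<in>{1..n}. Q m \<odot>\<^bsub>fun_module n D\<^esub> Psi n D \<alpha> (int m)) =
      Theta n D \<alpha> (\<Sum>m\<in>{1..n}. vscale (Q m) (pvec n (int m)))" for Q
    unfolding Psi_eq_Theta Theta_scale_fun[symmetric]
    by (rule finsum_hom[where C = UNIV and h = "Theta n D \<alpha>"])
       (simp_all add: abelian_group.axioms(1)[OF abelian_group_fun_module] Theta_zero_fun Theta_closed Theta_add_fun)
  then show ?thesis
    unfolding sol_space_def Kvec_def by auto
qed

lemma sol_space_ops:
  "v \<oplus>\<^bsub>sol_space n D \<alpha>\<^esub> w = v \<oplus>\<^bsub>fun_module n D\<^esub> w" "\<zero>\<^bsub>sol_space n D \<alpha>\<^esub> = \<zero>\<^bsub>fun_module n D\<^esub>"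
  "c \<odot>\<^bsub>sol_space n D \<alpha>\<^esub> v = c \<odot>\<^bsub>fun_module n D\<^esub> v"
  by (simp_all add: sol_space_def)

lemma Theta_add: "Theta n D \<alpha> (u + w) = Theta n D \<alpha> u \<oplus>\<^bsub>sol_space n D \<alpha>\<^esub> Theta n D \<alpha> w"
  by (simp only: sol_space_ops Theta_add_fun)

lemma Theta_zero: "Theta n D \<alpha> 0 = \<zero>\<^bsub>sol_space n D \<alpha>\<^esub>"
  by (simp only: sol_space_ops Theta_zero_fun)

lemma Theta_scale: "Theta n D \<alpha> (vscale c u) = c \<odot>\<^bsub>sol_space n D \<alpha>\<^esub> Theta n D \<alpha> u"
  by (simp only: sol_space_ops Theta_scale_fun)

lemma Theta_in_sol_space: "u \<in> Kvec n \<Longrightarrow> Theta n D \<alpha> u \<in> carrier (sol_space n D \<alpha>)"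
  by (simp add: carrier_sol_space)

lemma abelian_group_sol_space: "abelian_group (sol_space n D \<alpha>)" (is "abelian_group ?S")
proof (rule abelian_groupI)
  show "\<zero>\<^bsub>?S\<^esub> \<in> carrier (?S)"
    unfolding carrier_sol_space Theta_zero[symmetric] using Kvec_0 by blast
  fix x assume "x \<in> carrier (?S)"
  then obtain u where u: "u \<in> Kvec n" "x = Theta n D \<alpha> u" by (auto simp: carrier_sol_space)
  show "\<zero>\<^bsub>?S\<^esub> \<oplus>\<^bsub>?S\<^esub> x = x"
    by (simp only: u Theta_zero[symmetric] Theta_add[symmetric] add_0)
  have "Theta n D \<alpha> (- u) \<oplus>\<^bsub>?S\<^esub> x = \<zero>\<^bsub>?S\<^esub>"
    by (simp only: u Theta_zero[symmetric] Theta_add[symmetric] left_minus)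
  then show "\<exists>y\<in>carrier (?S). y \<oplus>\<^bsub>?S\<^esub> x = \<zero>\<^bsub>?S\<^esub>"
    using Theta_in_sol_space[OF K.M_uminus[OF u(1)]] by blast
  fix y assume "y \<in> carrier (?S)"
  then obtain v where v: "v \<in> Kvec n" "y = Theta n D \<alpha> v" by (auto simp: carrier_sol_space)
  show "x \<oplus>\<^bsub>?S\<^esub> y \<in> carrier (?S)"
    unfolding u(2) v(2) Theta_add[symmetric] by (intro Theta_in_sol_space Kvec_add u v)
  show "x \<oplus>\<^bsub>?S\<^esub> y = y \<oplus>\<^bsub>?S\<^esub> x"
    by (simp only: u v Theta_add[symmetric] add.commute)
  fix w assume "w \<in> carrier (?S)"
  then obtain t where t: "t \<in> Kvec n" "w = Theta n D \<alpha> t" by (auto simp: carrier_sol_space)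
  show "x \<oplus>\<^bsub>?S\<^esub> y \<oplus>\<^bsub>?S\<^esub> w = x \<oplus>\<^bsub>?S\<^esub> (y \<oplus>\<^bsub>?S\<^esub> w)"
    by (simp only: u v t Theta_add[symmetric] add.assoc)
qed

lemma finsum_Theta:
  assumes "finite I" "\<And>i. i \<in> I \<Longrightarrow> f i \<in> Kvec n"
  shows "(\<Oplus>\<^bsub>sol_space n D \<alpha>\<^esub>i\<in>I. Theta n D \<alpha> (f i)) = Theta n D \<alpha> (\<Sum>i\<in>I. f i)"
  by (rule finsum_hom[where C = "Kvec n" and h = "Theta n D \<alpha>"])
     (simp_all add: abelian_group.axioms(1)[OF abelian_group_sol_space] Theta_zero[symmetric]
       Theta_in_sol_space Theta_add Kvec_0 Kvec_add assms)

lemma Theta_diff: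
  assumes "u \<in> Kvec n" "w \<in> Kvec n"
  shows "Theta n D \<alpha> (u - w) = Theta n D \<alpha> u \<ominus>\<^bsub>sol_space n D \<alpha>\<^esub> Theta n D \<alpha> w"
proof -
  interpret abelian_group "sol_space n D \<alpha>" by (rule abelian_group_sol_space)
  have "\<ominus>\<^bsub>sol_space n D \<alpha>\<^esub> Theta n D \<alpha> w = Theta n D \<alpha> (- w)"
    using assms Theta_in_sol_space K.M_uminus
    by (intro minus_equality) (simp_all only: Theta_add[symmetric] Theta_zero[symmetric] left_minus)
  then show ?thesis
    by (simp only: a_minus_def Theta_add[symmetric] diff_conv_add_uminus)
qed

lemma Kvec_apply:
  assumes "u \<in> Kvec n"
  shows "u a \<in> Laurent n" "a \<notin> {1..n} \<Longrightarrow> u a = 0"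
proof -
  obtain Q where Q: "Q \<in> {1..n} \<rightarrow> Laurent n" "u = (\<Sum>m\<in>{1..n}. vscale (Q m) (pvec n (int m)))"
    using assms by (auto simp: Kvec_def)
  have u: "u a = (\<Sum>m\<in>{1..n}. Q m * pvec n (int m) a)"
    unfolding Q(2) sum_fun_apply vscale_def ..
  show "u a \<in> Laurent n"
    unfolding u using Q(1)
    by (intro Laurent_sum Laurent_mult) (auto simp: pvec_def intro!: Zpow_in_Laurent)
  show "u a = 0" if "a \<notin> {1..n}"
    unfolding u using that by (intro sum.neutral) (auto simp: pvec_def)
qed

text \<open>For fixed \<open>z\<close> the coefficients of the \<open>\<Psi>\<^sub>J\<close> agree; as \<open>z\<close> varies this determines the Laurent
  polynomials.\<close>

lemma Theta_inj:
  assumes D: "arg_branch D \<alpha>" and u: "u \<in> Kvec n" and w: "w \<in> Kvec n"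
    and eq: "Theta n D \<alpha> u = Theta n D \<alpha> w"
  shows "u = w"
proof
  fix a
  show "u a = w a"
  proof (cases "a \<in> {1..n}")
    case False
    then show ?thesis using Kvec_apply(2)[OF u False] Kvec_apply(2)[OF w False] by simp
  next
    case True
    have "u a - w a = 0"
    proof (rule Laurent_eq_0_if_vanishes)
      show "u a - w a \<in> Laurent n" by (intro Laurent_diff Kvec_apply(1) u w)
      fix z assume z: "z \<in> L_dom n"
      have "eval_Z (Z_acute z) (u a) = eval_Z (Z_acute z) (w a)"
      proof (rule Psi_independent[OF z D _ True, where c = "\<lambda>J. eval_Z (Z_acute z) (u J)" and d = "\<lambda>J. eval_Z (Z_acute z) (w J)"])
        fix p assume p: "p \<in> D"
        show "H_class n z (\<Sum>J\<in>{1..n}. hC (eval_Z (Z_acute z) (u J)) * psi_rep n \<alpha> J z p) =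
          H_class n z (\<Sum>J\<in>{1..n}. hC (eval_Z (Z_acute z) (w J)) * psi_rep n \<alpha> J z p)"
          using arg_cong[OF eq, of "\<lambda>v. v (z, p)"] Theta_apply[OF z p] by (simp add: Theta_rep_def)
      qed
      then show "eval_Z (Z_acute z) (u a - w a) = 0" by (simp add: eval_Z_diff)
    qed
    then show ?thesis by simp
  qed
qed


section \<open>The form on the module of solutions\<close>

lemma subst_X_conv_pm_eval: "subst_X f a = pm_eval (Zpow a) f"
  by (simp add: subst_X_def pm_eval_def)

definition LaurentX :: "nat \<Rightarrow> laurentX set" where
  "LaurentX n = {f. \<forall>m. lookup f m \<in> Laurent n}"

lemma laurentX_ring_eq: "laurentX_ring n = \<lparr>carrier = LaurentX n, mult = (*), one = 1, zero = 0, add = (+)\<rparr>"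
  by (simp add: laurentX_ring_def LaurentX_def)

lemma LaurentX_single: "c \<in> Laurent n \<Longrightarrow> single m c \<in> LaurentX n"
  by (simp add: LaurentX_def lookup_single when_def)

lemma LaurentX_0: "0 \<in> LaurentX n"
  by (simp add: LaurentX_def)

lemma LaurentX_1: "1 \<in> LaurentX n"
  using LaurentX_single[OF Laurent_1, of 0 n] by simp

lemma LaurentX_add: "f \<in> LaurentX n \<Longrightarrow> g \<in> LaurentX n \<Longrightarrow> f + g \<in> LaurentX n"
  by (simp add: LaurentX_def lookup_add Laurent_add)

lemma LaurentX_uminus: "f \<in> LaurentX n \<Longrightarrow> - f \<in> LaurentX n"
  by (simp add: LaurentX_def Laurent_uminus)

lemma LaurentX_mult: "f \<in> LaurentX n \<Longrightarrow> g \<in> LaurentX n \<Longrightarrow> f * g \<in> LaurentX n"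
proof -
  assume f: "f \<in> LaurentX n" and g: "g \<in> LaurentX n"
  have Sum_any: "Sum_any h \<in> Laurent n" if "\<And>i. h i \<in> Laurent n" for h :: "int \<Rightarrow> laurent"
    unfolding Sum_any.expand_set by (rule Laurent_sum) (rule that)
  show ?thesis
    unfolding LaurentX_def
  proof (intro CollectI allI)
    fix m
    have "(\<Sum>l. lookup f l * (\<Sum>q. lookup g q when m = l + q)) \<in> Laurent n"
      using f g by (intro Sum_any Laurent_mult) (simp_all add: LaurentX_def when_def)
    then show "lookup (f * g) m \<in> Laurent n"
      by (simp only: lookup_mult)
  qed
qed

lemma LaurentX_sum: "(\<And>i. i \<in> I \<Longrightarrow> f i \<in> LaurentX n) \<Longrightarrow> (\<Sum>i\<in>I. f i) \<in> LaurentX n"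
  by (induction I rule: infinite_finite_induct) (simp_all add: LaurentX_0 LaurentX_add)

lemma LaurentX_prod: "(\<And>i. i \<in> I \<Longrightarrow> f i \<in> LaurentX n) \<Longrightarrow> (\<Prod>i\<in>I. f i) \<in> LaurentX n"
  by (induction I rule: infinite_finite_induct) (simp_all add: LaurentX_1 LaurentX_mult)

lemma cring_laurentX_ring: "cring (laurentX_ring n)"
  unfolding laurentX_ring_eq
  by (rule cring_carrier_closed) (simp_all add: LaurentX_0 LaurentX_1 LaurentX_add LaurentX_mult LaurentX_uminus)

definition root_values :: "nat \<Rightarrow> laurentX \<Rightarrow> nat \<Rightarrow> laurent" where
  "root_values n f = (\<lambda>a. if a \<in> {1..n} then subst_X f a else 0)"

lemma root_values_add: "root_values n (f + g) = root_values n f + root_values n g"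
  by (rule ext) (simp add: root_values_def subst_X_conv_pm_eval pm_eval_add)

lemma root_values_sum: "root_values n (\<Sum>i\<in>I. f i) = (\<Sum>i\<in>I. root_values n (f i))"
proof
  fix a show "root_values n (\<Sum>i\<in>I. f i) a = (\<Sum>i\<in>I. root_values n (f i)) a"
    by (cases "a \<in> {1..n}")
       (simp_all add: root_values_def subst_X_conv_pm_eval pm_eval_sum sum_fun_apply del: atLeastAtMost_iff)
qed

lemma root_values_single: "root_values n (single m c) = vscale c (pvec n (m + 1))"
  by (rule ext) (simp add: root_values_def subst_X_conv_pm_eval pm_eval_single vscale_def pvec_def)

lemma K_generator_in_LaurentX:
  "(\<Prod>a=1..n. single 1 1 - single 0 (Zpow a 1)) \<in> LaurentX n"
proof (rule LaurentX_prod)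
  fix a assume "a \<in> {1..n}"
  then have "single 1 1 + - single 0 (Zpow a 1) \<in> LaurentX n"
    by (intro LaurentX_add LaurentX_uminus LaurentX_single Laurent_1 Zpow_in_Laurent)
  then show "single 1 1 - single 0 (Zpow a 1) \<in> LaurentX n" by simp
qed

lemma ideal_K_ideal: "ideal (K_ideal n) (laurentX_ring n)"
  unfolding K_ideal_def
  by (rule ring.genideal_ideal[OF cring.axioms(1)[OF cring_laurentX_ring]])
     (use K_generator_in_LaurentX in \<open>simp add: laurentX_ring_eq\<close>)

lemma K_ideal_root_values:
  assumes "f \<in> K_ideal n"
  shows "root_values n f = 0"
proof -
  let ?g = "\<Prod>a=1..n. single (1::int) (1::laurent) - single 0 (Zpow a 1)"
  have "pm_eval (Zpow a) f = 0" if a: "a \<in> {1..n}" for a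
  proof (rule genideal_in_kernel[where h = "pm_eval (Zpow a)" and C = "LaurentX n"])
    show "cring \<lparr>carrier = LaurentX n, mult = (*), one = 1, zero = 0, add = (+)\<rparr>"
      using cring_laurentX_ring[of n] by (simp only: laurentX_ring_eq)
    show "f \<in> Idl\<^bsub>\<lparr>carrier = LaurentX n, mult = (*), one = 1, zero = 0, add = (+)\<rparr>\<^esub> {?g}"
      using assms unfolding K_ideal_def laurentX_ring_eq .
    show "{?g} \<subseteq> LaurentX n" using K_generator_in_LaurentX[of n] by simp
    have "pm_eval (Zpow a) ?g = (\<Prod>b=1..n. pm_eval (Zpow a) (single 1 1 - single 0 (Zpow b 1)))"
      by (rule pm_eval_prod) (simp_all add: Zpow_add)
    also have "\<dots> = 0"
      using a by (intro prod_zero bexI[of _ a]) (simp_all add: pm_eval_diff pm_eval_single)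
    finally show "\<And>s. s \<in> {?g} \<Longrightarrow> pm_eval (Zpow a) s = 0" by simp
  qed (rule pm_eval_add, rule pm_eval_mult[OF Zpow_add])
  then show ?thesis by (intro ext) (auto simp: root_values_def subst_X_conv_pm_eval)
qed

definition K_class :: "nat \<Rightarrow> laurentX \<Rightarrow> laurentX set" where
  "K_class n f = K_ideal n +>\<^bsub>laurentX_ring n\<^esub> f"

lemma carrier_K_ring: "carrier (K_ring n) = K_class n ` LaurentX n"
  by (auto simp: K_ring_def FactRing_def A_RCOSETS_def' K_class_def laurentX_ring_eq)

lemma K_class_self:
  assumes "f \<in> LaurentX n"
  shows "f \<in> K_class n f"
proof -
  interpret ideal "K_ideal n" "laurentX_ring n" by (rule ideal_K_ideal)
  show ?thesis
    unfolding K_class_def by (rule a_rcos_self) (simp add: laurentX_ring_eq assms)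
qed

lemma K_class_root_values:
  assumes "g \<in> K_class n f" "f \<in> LaurentX n"
  shows "g \<in> LaurentX n" "root_values n g = root_values n f"
proof -
  interpret ideal "K_ideal n" "laurentX_ring n" by (rule ideal_K_ideal)
  obtain h where h: "h \<in> K_ideal n" "g = h + f"
    using assms(1) unfolding K_class_def a_r_coset_def' by (auto simp: laurentX_ring_eq)
  have "h \<in> LaurentX n" using a_Hcarr[OF h(1)] by (simp add: laurentX_ring_eq)
  then show "g \<in> LaurentX n" by (simp add: h LaurentX_add assms)
  show "root_values n g = root_values n f"
    unfolding h(2) root_values_add K_ideal_root_values[OF h(1)] by (rule add_0)
qed

context
  fixes n :: nat and D :: "complex set" and \<alpha> :: "complex \<Rightarrow> real"
  assumes n: "n \<ge> 1" and D: "arg_branch D \<alpha>"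
begin

lemma root_values_in_Kvec: "f \<in> LaurentX n \<Longrightarrow> root_values n f \<in> Kvec n"
  and theta_rep_eq: "f \<in> LaurentX n \<Longrightarrow> theta_rep n D \<alpha> f = Theta n D \<alpha> (root_values n f)"
proof -
  assume f: "f \<in> LaurentX n"
  have eq: "root_values n f = (\<Sum>m\<in>keys f. vscale (lookup f m) (pvec n (m + 1)))"
  proof
    fix a show "root_values n f a = (\<Sum>m\<in>keys f. vscale (lookup f m) (pvec n (m + 1))) a"
      by (cases "a \<in> {1..n}")
         (simp_all add: root_values_def subst_X_def sum_fun_apply vscale_def pvec_def del: atLeastAtMost_iff)
  qed
  have K: "vscale (lookup f m) (pvec n (m + 1)) \<in> Kvec n" for m
    using f by (intro Kvec_scale pvec_in_Kvec n) (simp add: LaurentX_def)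
  show "root_values n f \<in> Kvec n" unfolding eq by (intro K.M_sum K)
  show "theta_rep n D \<alpha> f = Theta n D \<alpha> (root_values n f)"
    unfolding theta_rep_def Psi_eq_Theta Theta_scale[symmetric] eq
    by (rule finsum_Theta) (simp_all add: K)
qed

lemma theta_K_class: "f \<in> LaurentX n \<Longrightarrow> theta n D \<alpha> (K_class n f) = Theta n D \<alpha> (root_values n f)"
  unfolding theta_def theta_rep_eq[symmetric]
  by (rule the_elem_image_unique)
     (use K_class_self in blast, simp add: theta_rep_eq K_class_root_values)

lemma A_K_K_class:
  assumes "f \<in> LaurentX n" "g \<in> LaurentX n"
  shows "A_K n (K_class n f) (K_class n g) = laurent_form n (root_values n f) (root_values n g)"
proof -
  have cong: "A_rep n f' g' = laurent_form n (root_values n f') (root_values n g')" for f' g'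
    unfolding A_rep_eq_laurent_form laurent_form_def frac_form_def
    by (intro arg_cong[where f = The] ext arg_cong2[where f = "(\<and>)"] arg_cong2[where f = "(=)"] sum.cong HOL.refl)
       (simp add: root_values_def)
  have "the_elem ((\<lambda>(f, g). A_rep n f g) ` (K_class n f \<times> K_class n g)) = (\<lambda>(f, g). A_rep n f g) (f, g)"
    by (rule the_elem_image_unique)
       (use K_class_self assms in blast, use assms in \<open>auto simp: cong K_class_root_values\<close>)
  then show ?thesis by (simp add: A_K_def cong)
qed

text \<open>The transported form is read off from a preimage of \<open>\<theta>\<close> picked by choice. Any such preimage has
  the prescribed values at the roots, because \<open>Theta\<close> is injective on \<open>Kvec n\<close>.\<close>

lemma A_form_Theta:
  assumes u: "u \<in> Kvec n" and w: "w \<in> Kvec n"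
  shows "A_form n D \<alpha> (Theta n D \<alpha> u) (Theta n D \<alpha> w) = laurent_form n u w"
proof -
  have "\<exists>f\<in>LaurentX n. inv_into (carrier (K_ring n)) (theta n D \<alpha>) (Theta n D \<alpha> v) = K_class n f \<and>
      root_values n f = v" if v: "v \<in> Kvec n" for v
  proof -
    obtain Q where Q: "Q \<in> {1..n} \<rightarrow> Laurent n" "v = (\<Sum>m\<in>{1..n}. vscale (Q m) (pvec n (int m)))"
      using v by (auto simp: Kvec_def)
    define g where "g = (\<Sum>m\<in>{1..n}. single (int m - 1) (Q m))"
    have g: "g \<in> LaurentX n"
      unfolding g_def using Q(1) by (intro LaurentX_sum LaurentX_single) auto
    have "root_values n g = v"
      unfolding g_def root_values_sum root_values_single Q(2) by simp
    then have "theta n D \<alpha> (K_class n g) = Theta n D \<alpha> v"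
      using theta_K_class[OF g] by simp
    then have im: "Theta n D \<alpha> v \<in> theta n D \<alpha> ` carrier (K_ring n)"
      unfolding carrier_K_ring using g by (metis imageI)
    obtain f where f: "f \<in> LaurentX n"
      "inv_into (carrier (K_ring n)) (theta n D \<alpha>) (Theta n D \<alpha> v) = K_class n f"
      using inv_into_into[OF im] unfolding carrier_K_ring by blast
    have "Theta n D \<alpha> (root_values n f) = Theta n D \<alpha> v"
      using f_inv_into_f[OF im] unfolding f(2) theta_K_class[OF f(1)] .
    then have "root_values n f = v"
      by (rule Theta_inj[OF D root_values_in_Kvec[OF f(1)] v])
    with f show ?thesis by blast
  qed
  from this[OF u] this[OF w] show ?thesis
    unfolding A_form_def by (auto simp: A_K_K_class)
qed

end

section \<open>Transport to exceptional bases of solutions\<close>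

definition lift_basis :: "nat \<Rightarrow> complex set \<Rightarrow> (complex \<Rightarrow> real) \<Rightarrow> (nat \<Rightarrow> nat \<Rightarrow> laurent) \<Rightarrow> nat \<Rightarrow> hfun" where
  "lift_basis n D \<alpha> b = (\<lambda>j\<in>{1..n}. Theta n D \<alpha> (b j))"

lemma vk_eq: "vk n D \<alpha> k m = Theta n D \<alpha> (pvec n (k + int m))"
  by (simp add: vk_def Psi_eq_Theta)

lemma vkl_eq: "n \<ge> 1 \<Longrightarrow> vkl n D \<alpha> k m l = Theta n D \<alpha> (tvec n k m l)"
  unfolding vkl_def vk_eq Theta_scale[symmetric] tvec_def
  by (rule finsum_Theta) (rule finite_atLeastAtMost, intro Kvec_scale pvec_in_Kvec sign_elem_sym_in_Laurent)

context
  fixes n :: nat and D :: "complex set" and \<alpha> :: "complex \<Rightarrow> real"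
  assumes n: "n \<ge> 1" and D: "arg_branch D \<alpha>"
begin

lemma finsum_lift_basis:
  assumes "b \<in> {1..n} \<rightarrow> Kvec n" "c \<in> {1..n} \<rightarrow> Laurent n"
  shows "(\<Oplus>\<^bsub>sol_space n D \<alpha>\<^esub>j\<in>{1..n}. c j \<odot>\<^bsub>sol_space n D \<alpha>\<^esub> lift_basis n D \<alpha> b j) =
    Theta n D \<alpha> (K.lin_comb n c b)"
proof -
  interpret S: abelian_group "sol_space n D \<alpha>" by (rule abelian_group_sol_space)
  have K: "vscale (c j) (b j) \<in> Kvec n" if "j \<in> {1..n}" for j
    using assms that by (intro Kvec_scale) auto
  have "(\<Oplus>\<^bsub>sol_space n D \<alpha>\<^esub>j\<in>{1..n}. c j \<odot>\<^bsub>sol_space n D \<alpha>\<^esub> lift_basis n D \<alpha> b j) =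
      (\<Oplus>\<^bsub>sol_space n D \<alpha>\<^esub>j\<in>{1..n}. Theta n D \<alpha> (vscale (c j) (b j)))"
  proof (rule S.finsum_cong'[OF HOL.refl])
    show "(\<lambda>j. Theta n D \<alpha> (vscale (c j) (b j))) \<in> {1..n} \<rightarrow> carrier (sol_space n D \<alpha>)"
      by (intro Pi_I Theta_in_sol_space K)
    fix j assume "j \<in> {1..n}"
    then show "c j \<odot>\<^bsub>sol_space n D \<alpha>\<^esub> lift_basis n D \<alpha> b j = Theta n D \<alpha> (vscale (c j) (b j))"
      by (simp only: lift_basis_def restrict_apply' Theta_scale)
  qed
  also have "\<dots> = Theta n D \<alpha> (K.lin_comb n c b)"
    unfolding K.lin_comb_def by (rule finsum_Theta) (simp_all only: K finite_atLeastAtMost)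
  finally show ?thesis .
qed

lemma lift_basis_exceptional:
  assumes b: "b \<in> K.exceptional n n"
  shows "lift_basis n D \<alpha> b \<in> exceptional_bases n D \<alpha>"
  unfolding exceptional_bases_def
proof (intro CollectI conjI ballI impI)
  have bK: "b \<in> {1..n} \<rightarrow> Kvec n" using b by (auto simp: K.exceptional_def)
  then have bj: "b j \<in> Kvec n" if "j \<in> {1..n}" for j using that by auto
  show "lift_basis n D \<alpha> b \<in> {1..n} \<rightarrow>\<^sub>E carrier (sol_space n D \<alpha>)"
    unfolding lift_basis_def by (simp add: bj Theta_in_sol_space)
  have A: "A_form n D \<alpha> (lift_basis n D \<alpha> b i) (lift_basis n D \<alpha> b j) = laurent_form n (b i) (b j)"
    if "i \<in> {1..n}" "j \<in> {1..n}" for i j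
    using that by (simp add: lift_basis_def A_form_Theta[OF n D] bj)
  show "A_form n D \<alpha> (lift_basis n D \<alpha> b i) (lift_basis n D \<alpha> b i) = 1" if "i \<in> {1..n}" for i
    using that b unfolding A[OF that that] by (simp add: K.exceptional_def K.gram_unitriangular_def)
  show "A_form n D \<alpha> (lift_basis n D \<alpha> b i) (lift_basis n D \<alpha> b j) = 0"
    if "i \<in> {1..n}" "j \<in> {1..n}" "j < i" for i j
    using that b unfolding A[OF that(1,2)] by (simp add: K.exceptional_def K.gram_unitriangular_def)
  fix v assume "v \<in> carrier (sol_space n D \<alpha>)"
  then obtain u where u: "u \<in> Kvec n" "v = Theta n D \<alpha> u" by (auto simp: carrier_sol_space)
  have "v = (\<Oplus>\<^bsub>sol_space n D \<alpha>\<^esub>j\<in>{1..n}. c j \<odot>\<^bsub>sol_space n D \<alpha>\<^esub> lift_basis n D \<alpha> b j) \<longleftrightarrow>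
      u = K.lin_comb n c b" if c: "c \<in> {1..n} \<rightarrow>\<^sub>E Laurent n" for c
  proof -
    have c': "c \<in> {1..n} \<rightarrow> Laurent n" using c by (auto simp: PiE_def)
    have "K.lin_comb n c b \<in> Kvec n"
      using K.combs_subset_M[OF bK] c' unfolding K.combs_def by blast
    then show ?thesis
      unfolding finsum_lift_basis[OF bK c'] u(2) using Theta_inj[OF D u(1)] by blast
  qed
  then have iff: "(c \<in> {1..n} \<rightarrow>\<^sub>E Laurent n \<and>
      v = (\<Oplus>\<^bsub>sol_space n D \<alpha>\<^esub>j\<in>{1..n}. c j \<odot>\<^bsub>sol_space n D \<alpha>\<^esub> lift_basis n D \<alpha> b j)) \<longleftrightarrow>
      (c \<in> {1..n} \<rightarrow>\<^sub>E Laurent n \<and> u = K.lin_comb n c b)" for c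
    by blast
  show "\<exists>!c. c \<in> {1..n} \<rightarrow>\<^sub>E Laurent n \<and>
        v = (\<Oplus>\<^bsub>sol_space n D \<alpha>\<^esub>j\<in>{1..n}. c j \<odot>\<^bsub>sol_space n D \<alpha>\<^esub> lift_basis n D \<alpha> b j)"
    unfolding iff by (rule K.exceptional_coeffs_unique[OF b u(1)])
qed

text \<open>The braid group acts through bijections of the whole set of exceptional bases, so every
  exceptional basis of solutions has to be lifted, not only \<open>Q\<^sub>k'\<close> and \<open>Q\<^sub>k''\<close>.\<close>

lemma exceptional_bases_lift:
  assumes "b' \<in> exceptional_bases n D \<alpha>"
  shows "\<exists>b\<in>K.exceptional n n. b' = lift_basis n D \<alpha> b"
proof -
  have b': "b' \<in> {1..n} \<rightarrow>\<^sub>E carrier (sol_space n D \<alpha>)"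
    using assms by (simp add: exceptional_bases_def)
  then have "\<forall>j\<in>{1..n}. \<exists>u\<in>Kvec n. b' j = Theta n D \<alpha> u"
    unfolding carrier_sol_space by blast
  then obtain b0 where b0: "\<And>j. j \<in> {1..n} \<Longrightarrow> b0 j \<in> Kvec n \<and> b' j = Theta n D \<alpha> (b0 j)"
    by metis
  define b where "b = restrict b0 {1..n}"
  have bE: "b \<in> {1..n} \<rightarrow>\<^sub>E Kvec n" using b0 by (auto simp: b_def)
  then have bK: "b \<in> {1..n} \<rightarrow> Kvec n" by (auto simp: PiE_def)
  have eq: "b' = lift_basis n D \<alpha> b"
    using b' b0 by (intro ext) (auto simp: lift_basis_def b_def PiE_def extensional_def)
  have A: "A_form n D \<alpha> (b' i) (b' j) = laurent_form n (b i) (b j)" if "i \<in> {1..n}" "j \<in> {1..n}" for i j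
    using that b0 by (simp add: b_def A_form_Theta[OF n D])
  have "K.gram_unitriangular n n b"
    using assms A unfolding K.gram_unitriangular_def exceptional_bases_def by force
  moreover have "Kvec n \<subseteq> K.combs n n b"
  proof
    fix u assume u: "u \<in> Kvec n"
    then have "\<exists>c. c \<in> {1..n} \<rightarrow>\<^sub>E Laurent n \<and> Theta n D \<alpha> u =
        (\<Oplus>\<^bsub>sol_space n D \<alpha>\<^esub>j\<in>{1..n}. c j \<odot>\<^bsub>sol_space n D \<alpha>\<^esub> b' j)"
      using assms Theta_in_sol_space[OF u, of D \<alpha>] unfolding exceptional_bases_def by blast
    then obtain c where c: "c \<in> {1..n} \<rightarrow>\<^sub>E Laurent n"
      "Theta n D \<alpha> u = (\<Oplus>\<^bsub>sol_space n D \<alpha>\<^esub>j\<in>{1..n}. c j \<odot>\<^bsub>sol_space n D \<alpha>\<^esub> b' j)" by blast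
    have c': "c \<in> {1..n} \<rightarrow> Laurent n" using c by (auto simp: PiE_def)
    have comb: "K.lin_comb n c b \<in> K.combs n n b" using c' unfolding K.combs_def by blast
    have "Theta n D \<alpha> u = Theta n D \<alpha> (K.lin_comb n c b)"
      using c(2) unfolding eq finsum_lift_basis[OF bK c'] .
    then have "u = K.lin_comb n c b"
      using Theta_inj[OF D u] K.combs_subset_M[OF bK] comb by blast
    then show "u \<in> K.combs n n b" using comb by simp
  qed
  ultimately have "b \<in> K.exceptional n n" using bE by (simp add: K.exceptional_def)
  with eq show ?thesis by blast
qed

lemma mutation_lift_basis:
  assumes i: "i \<in> {1..<n}" and b: "b \<in> {1..n} \<rightarrow> Kvec n"
  shows "mutation n D \<alpha> i (lift_basis n D \<alpha> b) = lift_basis n D \<alpha> (K.mutate n i b)"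
proof
  fix j
  have pos: "i \<in> {1..n}" "i + 1 \<in> {1..n}" using i by auto
  have bj: "b i \<in> Kvec n" "b (i + 1) \<in> Kvec n" using b pos by auto
  have at: "lift_basis n D \<alpha> b i = Theta n D \<alpha> (b i)" "lift_basis n D \<alpha> b (i + 1) = Theta n D \<alpha> (b (i + 1))"
    using pos by (simp_all only: lift_basis_def restrict_apply')
  have "lift_basis n D \<alpha> b (i + 1) \<ominus>\<^bsub>sol_space n D \<alpha>\<^esub>
      A_form n D \<alpha> (lift_basis n D \<alpha> b i) (lift_basis n D \<alpha> b (i + 1)) \<odot>\<^bsub>sol_space n D \<alpha>\<^esub> lift_basis n D \<alpha> b i =
      Theta n D \<alpha> (b (i + 1) - vscale (laurent_form n (b i) (b (i + 1))) (b i))"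
    unfolding at A_form_Theta[OF n D bj]
    by (simp only: Theta_scale[symmetric] Theta_diff[symmetric] bj Kvec_scale laurent_form_in_Laurent)
  then show "mutation n D \<alpha> i (lift_basis n D \<alpha> b) j = lift_basis n D \<alpha> (K.mutate n i b) j"
    unfolding mutation_def at
    using pos by (auto simp: K.mutate_def lift_basis_def)
qed

lemma braid_bijections_mutation: "braid_bijections n (mutation n D \<alpha>) (exceptional_bases n D \<alpha>)"
proof
  note exc = exceptional_bases_lift
  have K: "b \<in> {1..n} \<rightarrow> Kvec n" if "b \<in> K.exceptional n n" for b
    using that by (auto simp: K.exceptional_def)
  have mut: "mutation n D \<alpha> i (lift_basis n D \<alpha> b) = lift_basis n D \<alpha> (K.mutate n i b)"
    "K.mutate n i b \<in> K.exceptional n n"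
    if "i \<in> {1..<n}" "b \<in> K.exceptional n n" for i b
    using mutation_lift_basis[OF that(1) K[OF that(2)]] K.exceptional_mutate[OF that] by auto
  have inj: "b = b'" if "b \<in> K.exceptional n n" "b' \<in> K.exceptional n n"
    "lift_basis n D \<alpha> b = lift_basis n D \<alpha> b'" for b b'
  proof
    fix j show "b j = b' j"
    proof (cases "j \<in> {1..n}")
      case True
      then have "Theta n D \<alpha> (b j) = Theta n D \<alpha> (b' j)"
        using fun_cong[OF that(3), of j] by (simp only: lift_basis_def restrict_apply')
      then show ?thesis
        by (rule Theta_inj[OF D funcset_mem[OF K[OF that(1)] True] funcset_mem[OF K[OF that(2)] True]])
    next
      case False
      then show ?thesis
        using that(1,2) by (auto simp: K.exceptional_def PiE_def extensional_def)
    qed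
  qed
  fix i assume i: "i \<in> {1..<n}"
  show "bij_betw (mutation n D \<alpha> i) (exceptional_bases n D \<alpha>) (exceptional_bases n D \<alpha>)"
  proof (rule bij_betw_imageI)
    note bij = K.bij_betw_mutate[OF i, of n]
    show "inj_on (mutation n D \<alpha> i) (exceptional_bases n D \<alpha>)"
    proof (rule inj_onI)
      fix x y assume xy: "x \<in> exceptional_bases n D \<alpha>" "y \<in> exceptional_bases n D \<alpha>"
        "mutation n D \<alpha> i x = mutation n D \<alpha> i y"
      obtain b c where b: "b \<in> K.exceptional n n" "x = lift_basis n D \<alpha> b"
        and c: "c \<in> K.exceptional n n" "y = lift_basis n D \<alpha> c"
        using exc xy(1,2) by metis
      have "K.mutate n i b = K.mutate n i c"
        using inj[OF mut(2)[OF i b(1)] mut(2)[OF i c(1)]] xy(3)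
        unfolding b(2) c(2) mut(1)[OF i b(1)] mut(1)[OF i c(1)] by blast
      then have "b = c"
        using bij b(1) c(1) by (auto simp: bij_betw_def dest: inj_onD)
      then show "x = y" by (simp add: b c)
    qed
    show "mutation n D \<alpha> i ` exceptional_bases n D \<alpha> = exceptional_bases n D \<alpha>"
    proof (intro equalityI subsetI)
      fix y assume "y \<in> mutation n D \<alpha> i ` exceptional_bases n D \<alpha>"
      then obtain b where "b \<in> K.exceptional n n" "y = mutation n D \<alpha> i (lift_basis n D \<alpha> b)"
        using exc by blast
      then show "y \<in> exceptional_bases n D \<alpha>"
        using mut[OF i] lift_basis_exceptional by metis
    next
      fix y assume "y \<in> exceptional_bases n D \<alpha>"
      then obtain c where c: "c \<in> K.exceptional n n" "y = lift_basis n D \<alpha> c" using exc by blast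
      then obtain b where "b \<in> K.exceptional n n" "K.mutate n i b = c"
        using bij unfolding bij_betw_def by (metis imageE)
      then show "y \<in> mutation n D \<alpha> i ` exceptional_bases n D \<alpha>"
        using mut(1)[OF i] lift_basis_exceptional c(2) by (metis imageI)
    qed
  qed
  fix b assume "b \<in> exceptional_bases n D \<alpha>"
  then obtain c where c: "c \<in> K.exceptional n n" "b = lift_basis n D \<alpha> c" using exc by blast
  show "mutation n D \<alpha> i (mutation n D \<alpha> (Suc i) (mutation n D \<alpha> i b)) =
      mutation n D \<alpha> (Suc i) (mutation n D \<alpha> i (mutation n D \<alpha> (Suc i) b))"
    if "Suc i \<in> {1..<n}"
    using K.mutate_braid[OF i c(1) that] unfolding c(2) by (simp only: mut i that c(1))
  show "mutation n D \<alpha> i (mutation n D \<alpha> j b) = mutation n D \<alpha> j (mutation n D \<alpha> i b)"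
    if "j \<in> {1..<n}" "Suc i < j" for j
    using K.mutate_far[OF that(2), of n c] unfolding c(2) by (simp only: mut i that c(1))
qed

text \<open>The class of a product of generators contains many words, also with inverse letters; since the
  mutations are bijections satisfying the braid relations, the positive word computes the action.\<close>

lemma braid_act_positive_word:
  assumes b: "b \<in> K.exceptional n n" and ps: "set ps \<subseteq> {1..<n}"
  shows "braid_act n D \<alpha> (foldr (monoid.mult (braid_group n)) (map (tau n) ps) \<one>\<^bsub>braid_group n\<^esub>) (lift_basis n D \<alpha> b) =
    lift_basis n D \<alpha> (foldr (K.mutate n) ps b) \<and> foldr (K.mutate n) ps b \<in> K.exceptional n n"
proof -
  interpret B: braid_bijections n "mutation n D \<alpha>" "exceptional_bases n D \<alpha>"
    by (rule braid_bijections_mutation)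
  have letter: "letter_act n D \<alpha> = B.letter"
    by (simp add: letter_act_def B.letter_def fun_eq_iff)
  have word: "map (\<lambda>i. (i, True)) ps \<in> braid_words n"
    using ps by (auto simp: braid_words_def)
  have "foldr B.letter (map (\<lambda>i. (i, True)) ps) (lift_basis n D \<alpha> b) =
      lift_basis n D \<alpha> (foldr (K.mutate n) ps b) \<and> foldr (K.mutate n) ps b \<in> K.exceptional n n"
    using ps
  proof (induction ps)
    case Nil
    then show ?case using b by simp
  next
    case (Cons i ps)
    let ?b = "foldr (K.mutate n) ps b"
    have IH: "foldr B.letter (map (\<lambda>i. (i, True)) ps) (lift_basis n D \<alpha> b) = lift_basis n D \<alpha> ?b"
      "?b \<in> K.exceptional n n" and i: "i \<in> {1..<n}"
      using Cons by auto
    have "?b \<in> {1..n} \<rightarrow> Kvec n" using IH(2) by (auto simp: K.exceptional_def)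
    from mutation_lift_basis[OF i this] K.exceptional_mutate[OF i IH(2)] show ?case
      by (simp add: IH(1)) (simp add: B.letter_def)
  qed
  then show ?thesis
    unfolding braid_product_word[OF ps] braid_act_def letter
      B.class_acts_as_word[OF word lift_basis_exceptional[OF b]] .
qed

lemma Qprime_eq: "Qprime n D \<alpha> k = lift_basis n D \<alpha> (qprime n k)"
proof
  fix j
  show "Qprime n D \<alpha> k j = lift_basis n D \<alpha> (qprime n k) j"
  proof (cases "j \<in> {1..n}")
    case False
    then show ?thesis by (simp add: Qprime_def lift_basis_def Let_def del: atLeastAtMost_iff)
  next
    case j: True
    then show ?thesis
    proof (cases rule: position_cases)
      case (1 h)
      then show ?thesis
        using j qprime_odd[OF 1(2), of k] by (simp add: Qprime_def Let_def lift_basis_def vk_eq)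
    next
      case (2 h)
      have L: "lift_basis n D \<alpha> (qprime n k) (2 * h) = Theta n D \<alpha> (tvec n k (n + 1 - h) (h + 1))"
        using j 2(1) qprime_even[OF 2(2,3), of k] by (simp add: lift_basis_def)
      consider m where "n = 2 * m + 1" | "n = 2 * h" | m where "n = 2 * m" "h \<noteq> m"
        by (metis evenE oddE)
      then show ?thesis
        unfolding 2(1) L using 2(2,3)
        by cases (simp_all add: Qprime_def Let_def vk_eq vkl_eq tvec_self)
    qed
  qed
qed

lemma Qdprime_eq: "Qdprime n D \<alpha> k = lift_basis n D \<alpha> (qdprime n k)"
proof
  fix j
  show "Qdprime n D \<alpha> k j = lift_basis n D \<alpha> (qdprime n k) j"
  proof (cases "j \<in> {1..n}")
    case False
    then show ?thesis by (simp add: Qdprime_def lift_basis_def Let_def del: atLeastAtMost_iff)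
  next
    case j: True
    then show ?thesis
    proof (cases rule: position_cases)
      case (2 h)
      then show ?thesis
        using j qdprime_even[OF 2(2,3), of k] by (simp add: Qdprime_def Let_def lift_basis_def vk_eq)
    next
      case (1 h)
      have L: "lift_basis n D \<alpha> (qdprime n k) (2 * h + 1) = Theta n D \<alpha> (tvec n k (n - h) (h + 1))"
        using j 1(1) qdprime_odd[OF 1(2), of k] by (simp add: lift_basis_def)
      consider m where "n = 2 * m" | "n = 2 * h + 1" | m where "n = 2 * m + 1" "h \<noteq> m"
        by (metis evenE oddE)
      then show ?thesis
        unfolding 1(1) L using 1(2)
        by cases (simp_all add: Qdprime_def Let_def vk_eq vkl_eq tvec_self)
    qed
  qed
qed

end

theorem corollary7p2:
  fixes n :: nat and k :: int and D :: "complex set" and \<alpha> :: "complex \<Rightarrow> real"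
  assumes "n \<ge> 2" and "arg_branch D \<alpha>"
  shows "Qdprime n D \<alpha> k = braid_act n D \<alpha> (delta_odd n) (Qprime n D \<alpha> k) \<and>
         Qprime n D \<alpha> (k - 1) =
           (let b = braid_act n D \<alpha> (delta_even n) (Qdprime n D \<alpha> k)
            in b(1 := ((-1) ^ (n + 1) * inv_Z (elem_sym n n)) \<odot>\<^bsub>sol_space n D \<alpha>\<^esub> b 1))"
proof -
  have n: "n \<ge> 1" using assms(1) by simp
  note lift = Qprime_eq[OF n assms(2)] Qdprime_eq[OF n assms(2)]
  have sub: "set (filter odd [1..<n]) \<subseteq> {1..<n}" "set (filter even [1..<n]) \<subseteq> {1..<n}" by auto
  have odd: "braid_act n D \<alpha> (delta_odd n) (Qprime n D \<alpha> k) = Qdprime n D \<alpha> k"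
    and exc: "qdprime n k \<in> K.exceptional n n"
    using braid_act_positive_word[OF n assms(2) exceptional_qprime[OF n] sub(1), of k]
    unfolding delta_odd_def lift odd_mutations_qprime by auto
  define b where "b = foldr (K.mutate n) (filter even [1..<n]) (qdprime n k)"
  have even: "braid_act n D \<alpha> (delta_even n) (Qdprime n D \<alpha> k) = lift_basis n D \<alpha> b"
    using braid_act_positive_word[OF n assms(2) exc sub(2)]
    unfolding delta_even_def lift b_def by blast
  define c where "c = (-1) ^ (n + 1) * inv_Z (elem_sym n n)"
  have "Qprime n D \<alpha> (k - 1) = lift_basis n D \<alpha> (b(1 := vscale c (b 1)))"
    unfolding lift c_def even_mutations_qdprime[OF n b_def] ..
  also have "\<dots> = (lift_basis n D \<alpha> b)(1 := c \<odot>\<^bsub>sol_space n D \<alpha>\<^esub> lift_basis n D \<alpha> b 1)"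
  proof
    fix j
    have "1 \<in> {1..n}" using n by simp
    then show "lift_basis n D \<alpha> (b(1 := vscale c (b 1))) j =
        ((lift_basis n D \<alpha> b)(1 := c \<odot>\<^bsub>sol_space n D \<alpha>\<^esub> lift_basis n D \<alpha> b 1)) j"
      by (cases "j = 1") (simp_all only: lift_basis_def restrict_apply' Theta_scale fun_upd_same, simp add: restrict_def)
  qed
  finally show ?thesis
    unfolding even Let_def c_def using odd by simp
qed

end
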